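(* Let $f$ be an inner function with $f(0)=0$ and $a=|f'(0)|<1$. Then there exist constants $C=C(f)>0$ and $q_0=q_0(f)>0$, depending only on $f$, such that the following holds. Let $1\le k\le q$ be positive integers with $q\ge q_0$, let $\boldsymbol{\varepsilon}=\{\varepsilon_j\}_{j=1}^k$ with each $\varepsilon_j\in\{1,-1\}$, and let $\boldsymbol{n}=\{n_j\}_{j=1}^k$ where $n_1<n_2<\cdots<n_k$ are positive integers with $n_{j+1}-n_j>q$ for $j=1,\ldots,k-1$. Then $$I(\boldsymbol{\varepsilon},\boldsymbol{n}):=\left|\int_{\partial\mathbb{D}}\prod_{j=1}^{k}f^{\varepsilon_jn_j}\,dm\right|\le C^k\,k!\,a^{\Phi(\boldsymbol{\varepsilon},\boldsymbol{n})},$$ where $$\Phi(\boldsymbol{\varepsilon},\boldsymbol{n})=\sum_{j=1}^{k-1}\delta_j\,(n_{j+1}-n_j)$$ for some coefficients $\delta_j=\delta_j(\boldsymbol{\varepsilon},\boldsymbol{n})\in\{0,1/2,1\}$, $j=1,\ldots,k-1$, with $\delta_1=1$ and $\delta_{k-1}\ge 1/2$, and such that for $j=2,\ldots,k-1$ one has $\delta_j=1$ if and only if $\delta_{j-1}=0$. Furthermore, the coefficients can be taken so that, for $j=2,\ldots,k-1$, if $\delta_{j-1}>0$ then $\delta_j$ depends only on $\varepsilon_{j+1},\ldots,\varepsilon_k$ and $n_j,\ldots,n_k$ (for given $f$, $k$ and $j$).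
   Context: $\mathbb{D}$ is the open unit disc and $m$ is normalized Lebesgue measure on the unit circle $\partial\mathbb{D}$. An inner function is an analytic map $f:\mathbb{D}\to\mathbb{D}$ whose radial limits have modulus one at $m$-almost every point of $\partial\mathbb{D}$; the boundary function, defined $m$-a.e. by $f(z)=\lim_{r\to1^-}f(rz)$, is also denoted $f$. For a positive integer $n$, $f^n$ denotes the $n$-th iterate of $f$ (not the power), regarded as a function defined $m$-a.e. on $\partial\mathbb{D}$, and $f^{-n}$ denotes the function $f^{-n}(z)=\overline{f^n(z)}$, $z\in\partial\mathbb{D}$ (complex conjugate, not inverse). When $k=1$ the sum defining $\Phi$ is empty, so $\Phi=0$, and the conditions on the $\delta_j$ are void. Convention: $0^0=1$ and $0^s=0$ for $s>0$. *)

theory Defs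
  imports "HOL-Complex_Analysis.Complex_Analysis" "HOL-Probability.Probability"
begin

text \<open>Normalized Lebesgue measure on the unit circle.\<close>

definition circle_measure :: "complex measure" where
  "circle_measure =
     distr (uniform_measure lborel {0..<2 * pi}) (restrict_space borel (sphere 0 1)) cis"

lemma space_circle_measure: "space circle_measure = sphere 0 1"
  by (simp add: circle_measure_def space_restrict_space)

lemma prob_space_circle_measure: "prob_space circle_measure"
proof -
  have 1: "prob_space (uniform_measure lborel {0..<2 * pi})"
    by (rule prob_space_uniform_measure) auto
  have "cis \<in> borel \<rightarrow>\<^sub>M restrict_space borel (sphere 0 1)"
    by (intro measurable_restrict_space2 borel_measurable_continuous_onI
        continuous_on_cis continuous_on_id) auto
  then have "cis \<in> uniform_measure lborel {0..<2 * pi} \<rightarrow>\<^sub>M restrict_space borel (sphere 0 1)"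
    by (simp cong: measurable_cong_sets)
  then show ?thesis
    unfolding circle_measure_def by (rule prob_space.prob_space_distr[OF 1])
qed

definition inner_function :: "(complex \<Rightarrow> complex) \<Rightarrow> bool" where
  "inner_function f \<longleftrightarrow>
     f holomorphic_on ball 0 1 \<and> f ` ball 0 1 \<subseteq> ball 0 1 \<and>
     (AE z in circle_measure.
        \<exists>w. ((\<lambda>r. f (complex_of_real r * z)) \<longlongrightarrow> w) (at_left 1) \<and> cmod w = 1)"

text \<open>
  The radial boundary function. At points where the radial limit does not exist the
  value is an unspecified constant; for inner functions these points form a null set.
\<close>

definition boundary_fun :: "(complex \<Rightarrow> complex) \<Rightarrow> complex \<Rightarrow> complex" where
  "boundary_fun f z = Lim (at_left 1) (\<lambda>r. f (complex_of_real r * z))"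

text \<open>
  For a sign e and a positive integer n this is the boundary function of the n-th
  iterate of f if e = 1, and its complex conjugate (not an inverse) if e = -1.
\<close>

definition signed_iterate :: "(complex \<Rightarrow> complex) \<Rightarrow> int \<Rightarrow> nat \<Rightarrow> complex \<Rightarrow> complex" where
  "signed_iterate f e n z =
     (if e = 1 then boundary_fun (f ^^ n) z else cnj (boundary_fun (f ^^ n) z))"

text \<open>
  A k-tuple is a function on the naturals of which only the values at 1, ..., k are used.
\<close>

definition iterate_integral ::
    "(complex \<Rightarrow> complex) \<Rightarrow> nat \<Rightarrow> (nat \<Rightarrow> int) \<Rightarrow> (nat \<Rightarrow> nat) \<Rightarrow> real" where
  "iterate_integral f k \<epsilon> n =
     cmod (LINT z|circle_measure. (\<Prod>j=1..k. signed_iterate f (\<epsilon> j) (n j) z))"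

definition admissible :: "nat \<Rightarrow> nat \<Rightarrow> (nat \<Rightarrow> int) \<Rightarrow> (nat \<Rightarrow> nat) \<Rightarrow> bool" where
  "admissible k q \<epsilon> n \<longleftrightarrow>
     1 \<le> k \<and> k \<le> q \<and>
     (\<forall>j\<in>{1..k}. \<epsilon> j \<in> {1, -1}) \<and>
     (\<forall>j\<in>{1..k}. 0 < n j) \<and> strict_mono_on {1..k} n \<and>
     (\<forall>j\<in>{1..k-1}. int (n (j + 1)) - int (n j) > int q)"

definition coeff_conditions :: "nat \<Rightarrow> (nat \<Rightarrow> real) \<Rightarrow> bool" where
  "coeff_conditions k d \<longleftrightarrow>
     (\<forall>j\<in>{1..k-1}. d j \<in> {0, 1/2, 1}) \<and>
     (k \<ge> 2 \<longrightarrow> d 1 = 1 \<and> d (k - 1) \<ge> 1/2) \<and>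
     (\<forall>j\<in>{2..k-1}. d j = 1 \<longleftrightarrow> d (j - 1) = 0)"

definition Phi :: "nat \<Rightarrow> (nat \<Rightarrow> real) \<Rightarrow> (nat \<Rightarrow> nat) \<Rightarrow> real" where
  "Phi k d n = (\<Sum>j=1..k-1. d j * (real (n (j + 1)) - real (n j)))"

text \<open>Real exponentiation with the convention that the zeroth power of 0 is 1.\<close>

definition rpow :: "real \<Rightarrow> real \<Rightarrow> real" where
  "rpow a s = (if s = 0 then 1 else a powr s)"

end

theory Submission
  imports Defs "HOL-Real_Asymp.Real_Asymp"
begin

text \<open>
  The boundary integral of a product of iterates \<open>f\<^sup>n\<close> and conjugates of iterates is the limit, as
  \<open>r \<rightarrow> 1\<close>, of the same average over the circle of radius \<open>r\<close>: bounded holomorphic functions have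
  radial limits almost everywhere (\<open>fatou_radial_limits\<close>), and the integrands are bounded by 1. On
  circles inside the disc the average can be read off Taylor coefficients. So the correlation is the
  Hardy space inner product \<open>\<langle>A, B\<rangle> = \<Sum>\<^sub>n a\<^sub>n cnj b\<^sub>n\<close>, where \<open>A\<close> is the product of the iterates with
  sign 1 and \<open>B\<close> that of the iterates with sign -1. In this form no boundary function has to be
  composed with another one.

  That \<open>f\<close> is inner means that its Hardy norm is 1 while \<open>|f| < 1\<close> inside the disc, and this makes
  multiplication by \<open>f\<close> an isometry (\<open>h2_inner_mult_inner_map\<close>). The powers of \<open>f\<close> are then orthonormal
  because \<open>f 0 = 0\<close>, composition with \<open>f\<close> is an isometry as well, all iterates are again inner maps,
  and for an inner map \<open>\<phi>\<close> one has the transfer identity (\<open>h2_inner_transfer\<close>)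

    \<open>\<langle>z\<^sup>l (A \<circ> \<phi>), B \<circ> \<phi>\<rangle> = \<Sum>\<^sub>j \<langle>z\<^sup>l, \<phi>\<^sup>j\<rangle> \<langle>z\<^sup>j A, B\<rangle>\<close>, summed over \<open>j \<le> l\<close>.

  Apply it with \<open>\<phi>\<close> the iterate of \<open>f\<close> over the gap \<open>g = n (j + 1) - n j\<close> between two successive times.
  A correlation becomes a sum over paths of integer frequencies: a gap changes the frequency from
  \<open>l \<noteq> 0\<close> to some \<open>j\<close> between 1 and \<open>l\<close> (of the same sign), and the factor \<open>f\<close> or \<open>cnj f\<close> at the next
  time shifts the frequency by \<open>1\<close> or \<open>-1\<close>. The iterates satisfy \<open>|f\<^sup>g z| \<le> K a\<^sup>g\<close> on some disc of
  radius \<open>\<rho>\<close> (\<open>koenigs_bound\<close>), so the Cauchy estimate bounds the weight \<open>\<langle>z\<^sup>l, \<phi>\<^sup>j\<rangle>\<close> by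
  \<open>(K a\<^sup>g)\<^sup>j / \<rho>\<^sup>l\<close>. As soon as all gaps are so long that \<open>K a\<^sup>g / \<rho> \<le> 1 / 2\<close>, the loss \<open>\<rho>\<^sup>-\<^sup>l\<close> of a high
  frequency is paid for by the factor that created it, and the sum over \<open>j\<close> is a geometric series
  dominated by \<open>j = 1\<close>. Hence every gap crossed at a non-zero frequency contributes a constant
  times \<open>a\<^sup>g\<close>. A gap crossed at frequency 0 contributes nothing, but the next factor moves the frequency
  away from 0, so two successive gaps are never both free. Moreover the first gap is crossed at
  frequency \<open>1\<close> or \<open>-1\<close>, and the frequency at the last time must be 0, so the last gap is not free.
  The correlation is therefore at most \<open>C\<^sup>k\<close> times \<open>a\<close> to the cost of the cheapest admissible choice of
  free gaps (\<open>path_cost\<close>, \<open>tail_corr_bound\<close>).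

  Finally the coefficients are read off the cheapest choice: 0 for a free gap, 1 for the first gap and
  for a gap after a free one, and 1/2 for a paid gap after a paid one. Lowering a cost from 1 to 1/2
  only lowers the sum, so the resulting exponent is at most the cost of the cheapest choice. Since this
  choice is found by dynamic programming from the last gap backwards, whether a gap that follows a paid one is
  free depends on that gap and the later ones only. If \<open>a = 0\<close>, the iterates have no linear term, so frequency 1 dies
  at the first gap, or is left over if there is only one time, and the correlation vanishes.
\<close>

section \<open>Averages over circles and the Parseval identity\<close>

text \<open>
  Integrals over the circle are computed in the angle, where Lebesgue measure and the fundamental
  theorem of calculus are at hand.
\<close>

definition angle_measure :: "real measure" where
  "angle_measure = uniform_measure lborel {0..<2 * pi}"

lemma prob_space_angle_measure: "prob_space angle_measure"
  unfolding angle_measure_def by (rule prob_space_uniform_measure) auto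

interpretation angle: prob_space angle_measure
  by (rule prob_space_angle_measure)

lemma sets_angle_measure [measurable_cong, simp]: "sets angle_measure = sets borel"
  by (simp add: angle_measure_def)

lemma space_angle_measure [simp]: "space angle_measure = UNIV"
  by (simp add: angle_measure_def)

lemma integrable_angle_measure:
  fixes F :: "real \<Rightarrow> 'a :: {banach, second_countable_topology}"
  assumes "continuous_on UNIV F" "\<And>t. norm (F t) \<le> B"
  shows "integrable angle_measure F"
proof (rule angle.integrable_const_bound[of _ B])
  show "F \<in> borel_measurable angle_measure"
    using borel_measurable_continuous_onI[OF assms(1)] by simp
qed (use assms(2) in auto)

lemma integral_angle_measure:
  fixes F :: "real \<Rightarrow> 'a :: euclidean_space"
  assumes "continuous_on UNIV F"
  shows "(LINT t|angle_measure. F t) = integral {0..2 * pi} F /\<^sub>R (2 * pi)"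
proof -
  have F [measurable]: "F \<in> borel_measurable borel"
    using borel_measurable_continuous_onI[OF assms] .
  have "(LINT t|angle_measure. F t) =
          (LINT t|lborel. (indicator {0..<2*pi} t / (2*pi)) *\<^sub>R F t)"
    unfolding angle_measure_def uniform_measure_def
  proof (subst integral_density[symmetric])
    show "(LINT t|density lborel (\<lambda>x. indicator {0..<2 * pi} x / emeasure lborel {0..<2 * pi}). F t) =
          (LINT x|density lborel (\<lambda>x. ennreal (indicator {0..<2 * pi} x / (2 * pi))). F x)"
      by (intro arg_cong2[where f = "integral\<^sup>L"] refl density_cong AE_I2)
         (auto simp: divide_ennreal indicator_def split: if_splits
           simp flip: ennreal_1)
  qed (auto simp: indicator_def)
  also have "\<dots> = (LINT t|lborel. (indicator {0..2*pi} t *\<^sub>R F t) /\<^sub>R (2*pi))"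
  proof (rule integral_cong_AE)
    have "AE t in lborel. t \<noteq> 2 * (pi::real)"
      using AE_lborel_singleton by blast
    then show "AE t in lborel. (indicator {0..<2*pi} t / (2*pi)) *\<^sub>R F t =
                 (indicator {0..2*pi} t *\<^sub>R F t) /\<^sub>R (2*pi)"
      by eventually_elim (auto simp: indicator_def field_simps)
  qed auto
  also have "\<dots> = (LINT t:{0..2*pi}|lborel. F t) /\<^sub>R (2*pi)"
    by (simp only: set_lebesgue_integral_def integral_scaleR_right)
  also have "(LINT t:{0..2*pi}|lborel. F t) = integral {0..2*pi} F"
    by (intro set_borel_integral_eq_integral borel_integrable_atLeastAtMost'
          continuous_on_subset[OF assms]) auto
  finally show ?thesis .
qed

lemma integral_cis_power:
  "(LINT t|angle_measure. cis t ^ n * cnj (cis t) ^ m) = of_bool (n = m)"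
proof -
  define k where "k = int n - int m"
  have eq: "cis t ^ n * cnj (cis t) ^ m = cis (of_int k * t)" for t
  proof -
    have "cis t ^ n * cnj (cis t) ^ m = cis (real n * t) * cis (real m * (- t))"
      by (simp only: cis_cnj Complex.DeMoivre)
    also have "\<dots> = cis (of_int k * t)"
      unfolding cis_mult by (rule arg_cong[where f = cis]) (simp add: k_def algebra_simps)
    finally show ?thesis .
  qed
  have "integral {0..2 * pi} (\<lambda>t. cis (of_int k * t)) = (if k = 0 then 2 * pi else 0)"
  proof (cases "k = 0")
    case False
    have "((\<lambda>t. cis (of_int k * t)) has_integral
        (cis (of_int k * (2 * pi)) / (\<i> * k) - cis (of_int k * 0) / (\<i> * k))) {0..2 * pi}"
    proof (rule fundamental_theorem_of_calculus)
      fix t :: real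
      have "((\<lambda>z. exp (\<i> * (k * z)) / (\<i> * k)) has_field_derivative exp (\<i> * (k * of_real t)))
              (at (of_real t))"
        using False by (auto intro!: derivative_eq_intros simp: field_simps)
      from has_vector_derivative_real_field[OF this]
      show "((\<lambda>t. cis (of_int k * t) / (\<i> * k)) has_vector_derivative cis (of_int k * t))
              (at t within {0..2*pi})"
        by (simp add: cis_conv_exp)
    qed simp
    moreover have "cis (of_int k * (2 * pi)) = 1"
      using cis_multiple_2pi[of "of_int k"] by (simp add: mult_ac)
    ultimately show ?thesis using False by (simp add: integral_unique)
  qed (simp add: scaleR_conv_of_real)
  then show ?thesis
    by (subst integral_angle_measure)
       (auto simp: eq k_def scaleR_conv_of_real intro!: continuous_intros)
qed

text \<open>
  The absolutely convergent series converges uniformly, so it can be integrated term by term against a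
  bounded factor.
\<close>

lemma sums_integral_cis_series:
  assumes c: "summable (\<lambda>m. cmod (c m))"
    and X: "continuous_on UNIV X" "\<And>t. cmod (X t) \<le> K"
  shows "(\<lambda>m. c m * (LINT t|angle_measure. cis t ^ m * X t)) sums
           (LINT t|angle_measure. (\<Sum>m. c m * cis t ^ m) * X t)"
proof -
  have cont: "continuous_on UNIV (\<lambda>t. c m * cis t ^ m * X t)" for m
    by (intro continuous_intros X)
  have bd: "norm (c m * cis t ^ m * X t) \<le> cmod (c m) * K" for m t
    by (simp add: norm_mult norm_power mult_left_mono X)
  have int: "integrable angle_measure (\<lambda>t. c m * cis t ^ m * X t)" for m
    using integrable_angle_measure[OF cont bd] .
  have sc: "summable (\<lambda>m. cmod (c m) * K)"
    using c by (rule summable_mult2)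
  have sn: "summable (\<lambda>m. norm (c m * cis t ^ m * X t))" for t
    using bd by (intro summable_comparison_test[OF _ sc]) auto
  have "(\<lambda>m. LINT t|angle_measure. c m * cis t ^ m * X t) sums
          (LINT t|angle_measure. (\<Sum>m. c m * cis t ^ m * X t))"
  proof (rule sums_integral)
    show "summable (\<lambda>m. LINT t|angle_measure. norm (c m * cis t ^ m * X t))"
    proof (rule summable_comparison_test[OF _ sc], intro exI allI impI)
      fix m
      have "(LINT t|angle_measure. norm (c m * cis t ^ m * X t)) \<le>
              (LINT t|angle_measure. cmod (c m) * K)"
        using int bd by (intro integral_mono) auto
      then show "norm (LINT t|angle_measure. norm (c m * cis t ^ m * X t)) \<le> cmod (c m) * K"
        using angle.prob_space by simp
    qed
  qed (use int sn in auto)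
  moreover have "(\<Sum>m. c m * cis t ^ m * X t) = (\<Sum>m. c m * cis t ^ m) * X t" for t
  proof -
    have "summable (\<lambda>m. c m * cis t ^ m)"
      by (rule summable_norm_cancel) (simp add: norm_mult norm_power c)
    then show ?thesis by (rule suminf_mult2[symmetric])
  qed
  moreover have "(LINT t|angle_measure. c m * cis t ^ m * X t) =
      c m * (LINT t|angle_measure. cis t ^ m * X t)" for m
    by (simp add: mult.assoc)
  ultimately show ?thesis by simp
qed

lemma continuous_on_cis_series:
  assumes c: "summable (\<lambda>m. cmod (c m))"
  shows "continuous_on UNIV (\<lambda>t. \<Sum>m. c m * cis t ^ m)"
proof (rule uniform_limit_theorem)
  show "uniform_limit UNIV (\<lambda>n t. \<Sum>m<n. c m * cis t ^ m) (\<lambda>t. \<Sum>m. c m * cis t ^ m) sequentially"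
    by (rule Weierstrass_m_test[OF _ c]) (simp add: norm_mult norm_power)
  show "\<forall>\<^sub>F n in sequentially. continuous_on UNIV (\<lambda>t. \<Sum>m<n. c m * cis t ^ m)"
    by (intro always_eventually allI continuous_intros)
qed simp

lemma cmod_cis_series_le:
  assumes c: "summable (\<lambda>m. cmod (c m))"
  shows "cmod (\<Sum>m. c m * cis t ^ m) \<le> (\<Sum>m. cmod (c m))"
proof -
  have "summable (\<lambda>m. norm (c m * cis t ^ m))"
    using c by (simp add: norm_mult norm_power)
  from summable_norm[OF this] show ?thesis by (simp add: norm_mult norm_power)
qed

text \<open>
  Integrating term by term twice reduces the identity to the orthogonality of the characters. Absolute
  summability of the coefficients is what holds on circles strictly inside the disc.
\<close>

theorem parseval_cis_series:
  assumes c: "summable (\<lambda>m. cmod (c m))" and d: "summable (\<lambda>m. cmod (d m))"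
  shows "(\<lambda>m. c m * cnj (d m)) sums
           (LINT t|angle_measure. (\<Sum>m. c m * cis t ^ m) * cnj (\<Sum>m. d m * cis t ^ m))"
proof -
  have coeff: "(LINT t|angle_measure. cis t ^ n * cnj (\<Sum>m. d m * cis t ^ m)) = cnj (d n)" for n
  proof -
    have "(\<lambda>m. d m * (LINT t|angle_measure. cis t ^ m * cnj (cis t ^ n))) sums
           (LINT t|angle_measure. (\<Sum>m. d m * cis t ^ m) * cnj (cis t ^ n))"
      by (rule sums_integral_cis_series[where K = 1])
         (use d in \<open>auto intro!: continuous_intros simp: norm_power\<close>)
    then have "(\<lambda>m. d m * of_bool (m = n)) sums
           (LINT t|angle_measure. (\<Sum>m. d m * cis t ^ m) * cnj (cis t ^ n))"
      using integral_cis_power by simp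
    moreover have "(\<lambda>m. d m * of_bool (m = n)) sums d n"
      using sums_single[of n d] by (simp add: of_bool_def if_distrib cong: if_cong)
    ultimately have "(LINT t|angle_measure. (\<Sum>m. d m * cis t ^ m) * cnj (cis t ^ n)) = d n"
      by (rule sums_unique2)
    then have "(LINT t|angle_measure. cnj ((\<Sum>m. d m * cis t ^ m) * cnj (cis t ^ n))) = cnj (d n)"
      by (simp only: Bochner_Integration.integral_cnj)
    then show ?thesis
      by (simp add: mult.commute)
  qed
  have "(\<lambda>n. c n * (LINT t|angle_measure. cis t ^ n * cnj (\<Sum>m. d m * cis t ^ m))) sums
        (LINT t|angle_measure. (\<Sum>m. c m * cis t ^ m) * cnj (\<Sum>m. d m * cis t ^ m))"
    by (rule sums_integral_cis_series[where K = "\<Sum>m. cmod (d m)"])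
       (use c in \<open>auto intro!: continuous_intros continuous_on_cis_series[OF d]
          simp: cmod_cis_series_le[OF d]\<close>)
  then show ?thesis by (simp only: coeff)
qed

definition taylor_coeff :: "(complex \<Rightarrow> complex) \<Rightarrow> nat \<Rightarrow> complex" where
  "taylor_coeff A n = (deriv ^^ n) A 0 / fact n"

lemma taylor_sums:
  assumes "A holomorphic_on ball 0 1" "norm z < 1"
  shows "(\<lambda>n. taylor_coeff A n * z ^ n) sums A z"
  using holomorphic_power_series[OF assms(1), of z] assms(2)
  by (simp add: taylor_coeff_def)

text \<open>
  The series converges at some larger radius, and a power series converges absolutely inside its circle
  of convergence.
\<close>

lemma taylor_summable:
  assumes "A holomorphic_on ball 0 1" "0 \<le> r" "r < 1"
  shows "summable (\<lambda>n. cmod (taylor_coeff A n * of_real r ^ n))"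
proof -
  define s where "s = (1 + r) / 2"
  have s: "0 \<le> s" "r < s" "s < 1" using assms by (auto simp: s_def)
  have "summable (\<lambda>n. taylor_coeff A n * of_real s ^ n)"
    using taylor_sums[OF assms(1), of "of_real s"] s by (auto simp: sums_iff)
  then show ?thesis
    by (rule powser_insidea) (use s assms in auto)
qed

text \<open>
  The sesquilinear average over the circle of radius \<open>r\<close> that approximates the Hardy space inner product.
\<close>

definition circle_mean ::
    "real \<Rightarrow> (complex \<Rightarrow> complex) \<Rightarrow> (complex \<Rightarrow> complex) \<Rightarrow> complex" where
  "circle_mean r A B =
     (LINT t|angle_measure. A (of_real r * cis t) * cnj (B (of_real r * cis t)))"

lemma continuous_on_circle:
  assumes "A holomorphic_on ball 0 1" "0 \<le> r" "r < 1"
  shows "continuous_on UNIV (\<lambda>t. A (of_real r * cis t))"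
  by (rule continuous_on_compose2[OF holomorphic_on_imp_continuous_on[OF assms(1)]])
     (use assms in \<open>auto intro!: continuous_intros simp: norm_mult\<close>)

lemma taylor_series_on_circle:
  assumes "A holomorphic_on ball 0 1" "0 \<le> r" "r < 1"
  shows "A (of_real r * cis t) = (\<Sum>m. (taylor_coeff A m * of_real r ^ m) * cis t ^ m)"
  using taylor_sums[OF assms(1), of "of_real r * cis t"] assms
  by (auto simp: norm_mult power_mult_distrib sums_iff mult_ac)

theorem circle_mean_sums:
  assumes A: "A holomorphic_on ball 0 1" and B: "B holomorphic_on ball 0 1"
    and r: "0 \<le> r" "r < 1"
  shows "(\<lambda>n. taylor_coeff A n * cnj (taylor_coeff B n) * of_real (r ^ (2 * n)))
            sums circle_mean r A B"
proof -
  have "(taylor_coeff A n * of_real r ^ n) * cnj (taylor_coeff B n * of_real r ^ n) =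
      taylor_coeff A n * cnj (taylor_coeff B n) * of_real (r ^ (2 * n))" for n
    by (simp add: mult_2 power_add)
  with parseval_cis_series[OF taylor_summable[OF A r] taylor_summable[OF B r]] show ?thesis
    by (simp only: circle_mean_def taylor_series_on_circle[OF A r] taylor_series_on_circle[OF B r])
qed

section \<open>The inner product of the Hardy space\<close>

lemma eventually_radius_in_unit_interval: "\<forall>\<^sub>F r in at_left (1::real). r \<in> {0<..<1}"
  by (rule eventually_at_leftI[of 0]) auto

definition bdd_hol :: "(complex \<Rightarrow> complex) \<Rightarrow> bool" where
  "bdd_hol A \<longleftrightarrow> A holomorphic_on ball 0 1 \<and> bounded (A ` ball 0 1)"

text \<open>
  The inner product of the Hardy space \<open>H\<^sup>2\<close>, defined through coefficients rather than boundary values, so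
  that it makes sense before any radial limit is known to exist.
\<close>

definition h2_inner :: "(complex \<Rightarrow> complex) \<Rightarrow> (complex \<Rightarrow> complex) \<Rightarrow> complex" where
  "h2_inner A B = (\<Sum>n. taylor_coeff A n * cnj (taylor_coeff B n))"

abbreviation h2_norm2 :: "(complex \<Rightarrow> complex) \<Rightarrow> real" where
  "h2_norm2 A \<equiv> (\<Sum>n. (cmod (taylor_coeff A n))\<^sup>2)"

lemma bdd_hol_holomorphic: "bdd_hol A \<Longrightarrow> A holomorphic_on ball 0 1"
  by (simp add: bdd_hol_def)

lemma bdd_holE:
  assumes "bdd_hol A"
  obtains K where "K > 0" "\<And>z. cmod z < 1 \<Longrightarrow> cmod (A z) \<le> K"
  using assms by (auto simp: bdd_hol_def bounded_pos)

lemma bdd_holI: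
  assumes "A holomorphic_on ball 0 1" "\<And>z. cmod z < 1 \<Longrightarrow> cmod (A z) \<le> K"
  shows "bdd_hol A"
  using assms by (auto simp: bdd_hol_def bounded_iff intro!: exI[of _ K])

lemma bdd_hol_const [intro, simp]: "bdd_hol (\<lambda>z. c)"
  by (rule bdd_holI[of _ "cmod c"]) auto

lemma bdd_hol_ident [intro, simp]: "bdd_hol (\<lambda>z. z)"
  by (rule bdd_holI[of _ 1]) auto

lemma bdd_hol_add [intro]:
  assumes "bdd_hol A" "bdd_hol B" shows "bdd_hol (\<lambda>z. A z + B z)"
proof -
  obtain K where K: "K > 0" "\<And>z. cmod z < 1 \<Longrightarrow> cmod (A z) \<le> K"
    using bdd_holE[OF assms(1)] by blast
  obtain L where L: "L > 0" "\<And>z. cmod z < 1 \<Longrightarrow> cmod (B z) \<le> L"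
    using bdd_holE[OF assms(2)] by blast
  show ?thesis
  proof (rule bdd_holI[of _ "K + L"])
    show "(\<lambda>z. A z + B z) holomorphic_on ball 0 1"
      using assms by (intro holomorphic_on_add bdd_hol_holomorphic)
  qed (use K L in \<open>auto intro: norm_triangle_mono\<close>)
qed

lemma bdd_hol_mult [intro]:
  assumes "bdd_hol A" "bdd_hol B" shows "bdd_hol (\<lambda>z. A z * B z)"
proof -
  obtain K where K: "K > 0" "\<And>z. cmod z < 1 \<Longrightarrow> cmod (A z) \<le> K"
    using bdd_holE[OF assms(1)] by blast
  obtain L where L: "L > 0" "\<And>z. cmod z < 1 \<Longrightarrow> cmod (B z) \<le> L"
    using bdd_holE[OF assms(2)] by blast
  show ?thesis
  proof (rule bdd_holI[of _ "K * L"])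
    show "(\<lambda>z. A z * B z) holomorphic_on ball 0 1"
      using assms by (intro holomorphic_on_mult bdd_hol_holomorphic)
    show "cmod (A z * B z) \<le> K * L" if "cmod z < 1" for z
      unfolding norm_mult using K L that by (intro mult_mono) (auto intro: less_imp_le)
  qed
qed

lemma bdd_hol_power [intro]: "bdd_hol A \<Longrightarrow> bdd_hol (\<lambda>z. A z ^ n)"
  by (induction n) auto

lemma bdd_hol_sum [intro]:
  "(\<And>i. i \<in> I \<Longrightarrow> bdd_hol (A i)) \<Longrightarrow> bdd_hol (\<lambda>z. \<Sum>i\<in>I. A i z)"
  by (induction I rule: infinite_finite_induct) auto

lemma bdd_hol_prod [intro]:
  "(\<And>i. i \<in> I \<Longrightarrow> bdd_hol (A i)) \<Longrightarrow> bdd_hol (\<lambda>z. \<Prod>i\<in>I. A i z)"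
  by (induction I rule: infinite_finite_induct) auto

lemma bdd_hol_diff [intro]: "bdd_hol A \<Longrightarrow> bdd_hol B \<Longrightarrow> bdd_hol (\<lambda>z. A z - B z)"
  using bdd_hol_add[of A "\<lambda>z. (-1) * B z"] bdd_hol_mult[of "\<lambda>z. -1" B] by simp

lemma bdd_hol_comp:
  assumes "bdd_hol A" "\<phi> holomorphic_on ball 0 1" "\<phi> ` ball 0 1 \<subseteq> ball 0 1"
  shows "bdd_hol (\<lambda>z. A (\<phi> z))"
proof -
  have "A \<circ> \<phi> holomorphic_on ball 0 1"
    using assms by (intro holomorphic_on_compose_gen[of _ _ _ "ball 0 1"]) (auto simp: bdd_hol_def)
  moreover have "(\<lambda>z. A (\<phi> z)) ` ball 0 1 \<subseteq> A ` ball 0 1"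
    using assms(3) by auto
  ultimately show ?thesis
    using assms(1) unfolding bdd_hol_def o_def by (meson bounded_subset)
qed

lemmas bdd_hol_intros =
  bdd_hol_const bdd_hol_ident bdd_hol_add bdd_hol_diff bdd_hol_mult bdd_hol_power bdd_hol_sum
  bdd_hol_prod

lemma cmod_circle_mean_le:
  assumes "A holomorphic_on ball 0 1" "B holomorphic_on ball 0 1" "0 \<le> r" "r < 1"
    and "\<And>t. cmod (A (of_real r * cis t)) * cmod (B (of_real r * cis t)) \<le> K"
  shows "cmod (circle_mean r A B) \<le> K"
proof -
  have int: "integrable angle_measure (\<lambda>t. A (of_real r * cis t) * cnj (B (of_real r * cis t)))"
    by (rule integrable_angle_measure[of _ K])
       (use assms in \<open>auto intro!: continuous_intros continuous_on_circle simp: norm_mult\<close>)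
  have "cmod (circle_mean r A B) \<le>
      (LINT t|angle_measure. cmod (A (of_real r * cis t) * cnj (B (of_real r * cis t))))"
    unfolding circle_mean_def by (rule integral_norm_bound)
  also have "\<dots> \<le> (LINT t|angle_measure. K)"
    using integrable_norm[OF int] assms(5) by (intro integral_mono) (auto simp: norm_mult)
  finally show ?thesis using angle.prob_space by simp
qed

lemma Re_circle_mean_sums:
  assumes "A holomorphic_on ball 0 1" "0 \<le> r" "r < 1"
  shows "(\<lambda>n. (cmod (taylor_coeff A n))\<^sup>2 * r ^ (2 * n)) sums Re (circle_mean r A A)"
proof -
  have "Re (taylor_coeff A n * cnj (taylor_coeff A n) * of_real (r ^ (2 * n))) =
      (cmod (taylor_coeff A n))\<^sup>2 * r ^ (2 * n)" for n
    by (simp only: complex_norm_square[symmetric] Re_complex_of_real flip: of_real_mult)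
  with sums_Re[OF circle_mean_sums[OF assms(1,1,2,3)]] show ?thesis by (simp only:)
qed

text \<open>
  By Parseval the weighted sums over circles of radius \<open>r < 1\<close> are averages of \<open>|A|\<^sup>2\<close>, hence at most
  \<open>K\<^sup>2\<close>; let \<open>r\<close> tend to 1 in a partial sum.
\<close>

lemma taylor_square_sum_bound:
  assumes "A holomorphic_on ball 0 1" "\<And>z. cmod z < 1 \<Longrightarrow> cmod (A z) \<le> K"
  shows "summable (\<lambda>n. (cmod (taylor_coeff A n))\<^sup>2)" "h2_norm2 A \<le> K\<^sup>2"
proof -
  have K: "0 \<le> K" using assms(2)[of 0] by (simp add: order_trans[OF norm_ge_zero])
  have r: "(\<Sum>n<N. (cmod (taylor_coeff A n))\<^sup>2 * r ^ (2 * n)) \<le> K\<^sup>2" if r: "0 \<le> r" "r < 1" for r N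
  proof -
    have *: "(\<lambda>n. (cmod (taylor_coeff A n))\<^sup>2 * r ^ (2 * n)) sums Re (circle_mean r A A)"
      by (intro Re_circle_mean_sums assms r)
    then have "(\<Sum>n<N. (cmod (taylor_coeff A n))\<^sup>2 * r ^ (2 * n)) \<le> Re (circle_mean r A A)"
      using sum_le_suminf[of "\<lambda>n. (cmod (taylor_coeff A n))\<^sup>2 * r ^ (2 * n)" "{..<N}"] r
      by (auto simp: sums_iff)
    also have "\<dots> \<le> cmod (circle_mean r A A)" by (rule complex_Re_le_cmod)
    also have "\<dots> \<le> K\<^sup>2"
      unfolding power2_eq_square
      using r K by (intro cmod_circle_mean_le assms mult_mono) (auto simp: norm_mult)
    finally show ?thesis .
  qed
  have le: "(\<Sum>n<N. (cmod (taylor_coeff A n))\<^sup>2) \<le> K\<^sup>2" for N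
  proof (rule tendsto_upperbound)
    show "((\<lambda>r. \<Sum>n<N. (cmod (taylor_coeff A n))\<^sup>2 * r ^ (2 * n)) \<longlongrightarrow>
        (\<Sum>n<N. (cmod (taylor_coeff A n))\<^sup>2)) (at_left 1)"
      by (rule tendsto_eq_rhs, (rule tendsto_intros)+) simp
    from eventually_radius_in_unit_interval
    show "\<forall>\<^sub>F r in at_left 1. (\<Sum>n<N. (cmod (taylor_coeff A n))\<^sup>2 * r ^ (2 * n)) \<le> K\<^sup>2"
      by eventually_elim (use r in auto)
  qed simp
  show s: "summable (\<lambda>n. (cmod (taylor_coeff A n))\<^sup>2)"
    by (rule bounded_imp_summable[of _ "K\<^sup>2"]) (use le[of "Suc _"] in \<open>auto simp: lessThan_Suc_atMost\<close>)
  show "h2_norm2 A \<le> K\<^sup>2"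
    by (rule suminf_le_const[OF s]) (use le in auto)
qed

lemma summable_taylor_square: "bdd_hol A \<Longrightarrow> summable (\<lambda>n. (cmod (taylor_coeff A n))\<^sup>2)"
  by (metis taylor_square_sum_bound(1) bdd_holE bdd_hol_holomorphic)

lemma summable_taylor_product:
  assumes "bdd_hol A" "bdd_hol B"
  shows "summable (\<lambda>n. cmod (taylor_coeff A n) * cmod (taylor_coeff B n))"
proof (rule summable_comparison_test)
  show "summable (\<lambda>n. (cmod (taylor_coeff A n))\<^sup>2 + (cmod (taylor_coeff B n))\<^sup>2)"
    by (intro summable_add summable_taylor_square assms)
  have "x * y \<le> x\<^sup>2 + y\<^sup>2" if "0 \<le> x" "0 \<le> y" for x y :: real
    using that sum_squares_bound[of x y] mult_nonneg_nonneg[of x y] by linarith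
  then show "\<exists>N. \<forall>n\<ge>N. norm (cmod (taylor_coeff A n) * cmod (taylor_coeff B n))
      \<le> (cmod (taylor_coeff A n))\<^sup>2 + (cmod (taylor_coeff B n))\<^sup>2"
    by auto
qed

text \<open>
  Abel summation of the Parseval series: the terms are dominated by the summable
  \<open>|a\<^sub>n| |b\<^sub>n|\<close> uniformly in \<open>r\<close>. This identity passes between coefficients and averages.
\<close>

theorem h2_inner_limit:
  assumes "bdd_hol A" "bdd_hol B"
  shows "((\<lambda>r. circle_mean r A B) \<longlongrightarrow> h2_inner A B) (at_left 1)"
proof -
  note ev = eventually_radius_in_unit_interval
  have "((\<lambda>r::real. \<Sum>n. taylor_coeff A n * cnj (taylor_coeff B n) * of_real (r ^ (2 * n)))
      \<longlongrightarrow> h2_inner A B) (at_left 1)"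
    unfolding h2_inner_def
  proof (rule tannerys_theorem[THEN conjunct2, THEN conjunct2])
    show "summable (\<lambda>n. cmod (taylor_coeff A n) * cmod (taylor_coeff B n))"
      by (rule summable_taylor_product[OF assms])
    show "((\<lambda>r::real. taylor_coeff A n * cnj (taylor_coeff B n) * of_real (r ^ (2 * n)))
      \<longlongrightarrow> taylor_coeff A n * cnj (taylor_coeff B n)) (at_left 1)" for n
      by (rule tendsto_eq_rhs, (rule tendsto_intros)+) simp
    have "\<forall>\<^sub>F (k, r) in at_top \<times>\<^sub>F at_left (1::real). r \<in> {0<..<1}"
      using eventually_prodI[OF always_eventually[of "\<lambda>_. True"] ev, of at_top]
      by (auto simp: case_prod_unfold)
    then show "\<forall>\<^sub>F (k, r) in at_top \<times>\<^sub>F at_left (1::real).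
        cmod (taylor_coeff A k * cnj (taylor_coeff B k) * of_real (r ^ (2 * k)))
        \<le> cmod (taylor_coeff A k) * cmod (taylor_coeff B k)"
      by eventually_elim
         (auto simp: norm_mult norm_power power_le_one mult_left_le simp del: of_real_power)
  qed auto
  moreover have "\<forall>\<^sub>F r in at_left (1::real).
      (\<Sum>n. taylor_coeff A n * cnj (taylor_coeff B n) * of_real (r ^ (2 * n))) = circle_mean r A B"
    using ev
  proof eventually_elim
    case (elim r)
    then show ?case
      using circle_mean_sums[of A B r] assms by (auto simp: bdd_hol_def sums_iff)
  qed
  ultimately show ?thesis by (rule Lim_transform_eventually)
qed

lemma taylor_coeff_linear:
  assumes "A holomorphic_on ball 0 1" "B holomorphic_on ball 0 1"
  shows "taylor_coeff (\<lambda>z. A z + B z) n = taylor_coeff A n + taylor_coeff B n"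
    and "taylor_coeff (\<lambda>z. A z - B z) n = taylor_coeff A n - taylor_coeff B n"
  using assms
  by (simp_all add: taylor_coeff_def higher_deriv_add[of _ "ball 0 1"] add_divide_distrib diff_divide_distrib
       higher_deriv_diff[of _ "ball 0 1"])

lemma taylor_coeff_cmult:
  "A holomorphic_on ball 0 1 \<Longrightarrow> taylor_coeff (\<lambda>z. c * A z) n = c * taylor_coeff A n"
  by (simp add: taylor_coeff_def higher_deriv_cmult[of _ "ball 0 1"])

lemma summable_h2_inner:
  assumes "bdd_hol A" "bdd_hol B"
  shows "summable (\<lambda>n. taylor_coeff A n * cnj (taylor_coeff B n))"
  by (rule summable_norm_cancel) (simp add: norm_mult summable_taylor_product assms)

lemma h2_inner_cnj: "bdd_hol A \<Longrightarrow> bdd_hol B \<Longrightarrow> h2_inner B A = cnj (h2_inner A B)"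
  unfolding h2_inner_def
  using sums_cnj[of "\<lambda>n. taylor_coeff A n * cnj (taylor_coeff B n)" "h2_inner A B"]
    summable_sums[OF summable_h2_inner, of A B]
  by (simp add: h2_inner_def sums_iff mult.commute)

lemma h2_inner_add_left:
  assumes "bdd_hol A" "bdd_hol A'" "bdd_hol B"
  shows "h2_inner (\<lambda>z. A z + A' z) B = h2_inner A B + h2_inner A' B"
  unfolding h2_inner_def
  by (subst suminf_add) (use assms in \<open>auto simp: taylor_coeff_linear bdd_hol_holomorphic summable_h2_inner algebra_simps\<close>)

lemma h2_inner_cmult_left:
  assumes "bdd_hol A" "bdd_hol B"
  shows "h2_inner (\<lambda>z. c * A z) B = c * h2_inner A B"
  unfolding h2_inner_def
  by (subst suminf_mult[symmetric]) (use assms in \<open>auto simp: taylor_coeff_cmult bdd_hol_holomorphic summable_h2_inner algebra_simps\<close>)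

lemma h2_inner_zero_left [simp]: "h2_inner (\<lambda>z. 0) B = 0"
proof -
  have "taylor_coeff (\<lambda>z. 0) n = 0" for n
    by (simp add: taylor_coeff_def)
  then show ?thesis by (simp add: h2_inner_def)
qed

lemma h2_inner_sum_left:
  assumes "finite I" "\<And>i. i \<in> I \<Longrightarrow> bdd_hol (A i)" "bdd_hol B"
  shows "h2_inner (\<lambda>z. \<Sum>i\<in>I. c i * A i z) B = (\<Sum>i\<in>I. c i * h2_inner (A i) B)"
  using assms
proof (induction I)
  case (insert i I)
  then have "h2_inner (\<lambda>z. c i * A i z + (\<Sum>i\<in>I. c i * A i z)) B =
      h2_inner (\<lambda>z. c i * A i z) B + h2_inner (\<lambda>z. \<Sum>i\<in>I. c i * A i z) B"
    by (intro h2_inner_add_left bdd_hol_intros) auto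
  with insert show ?case by (simp add: h2_inner_cmult_left)
qed auto

lemma h2_inner_sum_right:
  assumes "finite I" "\<And>i. i \<in> I \<Longrightarrow> bdd_hol (B i)" "bdd_hol A"
  shows "h2_inner A (\<lambda>z. \<Sum>i\<in>I. c i * B i z) = (\<Sum>i\<in>I. cnj (c i) * h2_inner A (B i))"
proof -
  have "h2_inner A (\<lambda>z. \<Sum>i\<in>I. c i * B i z) = cnj (h2_inner (\<lambda>z. \<Sum>i\<in>I. c i * B i z) A)"
    using assms by (intro h2_inner_cnj bdd_hol_intros) auto
  also have "\<dots> = (\<Sum>i\<in>I. cnj (c i) * cnj (h2_inner (B i) A))"
    using assms by (subst h2_inner_sum_left) auto
  also have "\<dots> = (\<Sum>i\<in>I. cnj (c i) * h2_inner A (B i))"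
    using assms by (intro sum.cong) (auto simp: h2_inner_cnj[of _ A] complex_cnj_cnj)
  finally show ?thesis .
qed

lemma h2_inner_self: "h2_inner A A = of_real (h2_norm2 A)" if "bdd_hol A"
  unfolding h2_inner_def
  by (subst suminf_of_real) (use summable_taylor_square[OF that] in \<open>auto simp flip: complex_norm_square\<close>)

lemma h2_norm2_nonneg: "0 \<le> h2_norm2 A" if "bdd_hol A"
  by (intro suminf_nonneg summable_taylor_square that) auto

theorem h2_cauchy_schwarz:
  assumes "bdd_hol A" "bdd_hol B"
  shows "cmod (h2_inner A B) \<le> sqrt (h2_norm2 A) * sqrt (h2_norm2 B)"
proof -
  have "(\<Sum>n<N. cmod (taylor_coeff A n) * cmod (taylor_coeff B n)) \<le>
      sqrt (h2_norm2 A) * sqrt (h2_norm2 B)" for N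
  proof -
    have "(\<Sum>n<N. cmod (taylor_coeff A n) * cmod (taylor_coeff B n)) \<le>
        L2_set (\<lambda>n. cmod (taylor_coeff A n)) {..<N} * L2_set (\<lambda>n. cmod (taylor_coeff B n)) {..<N}"
      using L2_set_mult_ineq[of "\<lambda>n. cmod (taylor_coeff A n)" "\<lambda>n. cmod (taylor_coeff B n)" "{..<N}"]
      by simp
    also have "\<dots> \<le> sqrt (h2_norm2 A) * sqrt (h2_norm2 B)"
      unfolding L2_set_def
      by (intro mult_mono real_sqrt_le_mono sum_le_suminf summable_taylor_square assms)
         (auto intro!: sum_nonneg h2_norm2_nonneg assms)
    finally show ?thesis .
  qed
  then have "(\<Sum>n. cmod (taylor_coeff A n) * cmod (taylor_coeff B n)) \<le>
      sqrt (h2_norm2 A) * sqrt (h2_norm2 B)"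
    by (intro suminf_le_const summable_taylor_product assms)
  moreover have "cmod (h2_inner A B) \<le> (\<Sum>n. cmod (taylor_coeff A n) * cmod (taylor_coeff B n))"
    unfolding h2_inner_def
    by (rule order_trans[OF summable_norm])
       (auto simp: norm_mult intro!: summable_taylor_product assms)
  ultimately show ?thesis by linarith
qed

section \<open>Inner maps as isometries, and the transfer identity\<close>

lemma h2_inner_diff_left:
  assumes "bdd_hol A" "bdd_hol A'" "bdd_hol B"
  shows "h2_inner (\<lambda>z. A z - A' z) B = h2_inner A B - h2_inner A' B"
  unfolding h2_inner_def
  by (subst suminf_diff) (use assms in \<open>auto simp: taylor_coeff_linear bdd_hol_holomorphic summable_h2_inner algebra_simps\<close>)

lemma h2_inner_diff_right:
  assumes "bdd_hol A" "bdd_hol B" "bdd_hol B'"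
  shows "h2_inner A (\<lambda>z. B z - B' z) = h2_inner A B - h2_inner A B'"
  unfolding h2_inner_def
  by (subst suminf_diff) (use assms in \<open>auto simp: taylor_coeff_linear bdd_hol_holomorphic summable_h2_inner algebra_simps\<close>)

lemma h2_inner_tendsto:
  assumes A: "bdd_hol A" "\<And>N. bdd_hol (A' N)" "(\<lambda>N. h2_norm2 (\<lambda>z. A' N z - A z)) \<longlonglongrightarrow> 0"
    and B: "bdd_hol B" "\<And>N. bdd_hol (B' N)" "(\<lambda>N. h2_norm2 (\<lambda>z. B' N z - B z)) \<longlonglongrightarrow> 0"
  shows "(\<lambda>N. h2_inner (A' N) (B' N)) \<longlonglongrightarrow> h2_inner A B"
proof -
  let ?a = "\<lambda>N z. A' N z - A z" and ?b = "\<lambda>N z. B' N z - B z"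
  have bh: "bdd_hol (?a N)" "bdd_hol (?b N)" for N
    by (intro bdd_hol_intros A B)+
  have small: "(\<lambda>N. h2_inner (X N) (Y N)) \<longlonglongrightarrow> 0"
    if "\<And>N. bdd_hol (X N)" "\<And>N. bdd_hol (Y N)"
      "(\<lambda>N. sqrt (h2_norm2 (X N)) * sqrt (h2_norm2 (Y N))) \<longlonglongrightarrow> 0" for X Y
    by (rule Lim_null_comparison[OF always_eventually[rule_format] that(3)])
       (rule h2_cauchy_schwarz[OF that(1,2)])
  have "(\<lambda>N. h2_inner (?a N) (?b N) + h2_inner (?a N) B + h2_inner A (?b N) + h2_inner A B)
      \<longlonglongrightarrow> 0 + 0 + 0 + h2_inner A B"
    by (intro tendsto_add small tendsto_const bh A B;
        rule tendsto_eq_rhs, (rule tendsto_intros A B)+) simp_all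
  moreover have "h2_inner (?a N) (?b N) + h2_inner (?a N) B + h2_inner A (?b N) + h2_inner A B
      = h2_inner (A' N) (B' N)" for N
    using A(1,2) B(1,2) bh by (simp add: h2_inner_diff_left h2_inner_diff_right)
  ultimately show ?thesis by simp
qed

lemma taylor_coeff_power: "taylor_coeff (\<lambda>z. z ^ l) n = of_bool (n = l)"
proof -
  have "(deriv ^^ n) (\<lambda>z::complex. z ^ l) 0 = pochhammer (of_nat (Suc l - n)) n * 0 ^ (l - n)"
    using higher_deriv_power[of n 0 l 0] by simp
  moreover have "pochhammer (1 :: complex) n = fact n" by (simp add: pochhammer_fact)
  ultimately show ?thesis
    by (cases n l rule: linorder_cases) (auto simp: taylor_coeff_def power_0_left pochhammer_0_left)
qed

lemma h2_inner_power_left: "h2_inner (\<lambda>z. z ^ l) B = cnj (taylor_coeff B l)"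
proof -
  have "(\<lambda>n. of_bool (n = l) * cnj (taylor_coeff B n)) sums (cnj (taylor_coeff B l))"
    using sums_single[of l "\<lambda>n. cnj (taylor_coeff B n)"]
    by (simp add: of_bool_def if_distrib if_distribR cong: if_cong)
  then show ?thesis by (simp add: h2_inner_def taylor_coeff_power sums_iff)
qed

lemma h2_inner_power_right: "h2_inner A (\<lambda>z. z ^ l) = taylor_coeff A l"
proof -
  have "(\<lambda>n. taylor_coeff A n * cnj (of_bool (n = l))) sums (taylor_coeff A l)"
    using sums_single[of l "\<lambda>n. taylor_coeff A n"]
    by (simp add: of_bool_def if_distrib if_distribR cong: if_cong)
  then show ?thesis by (simp add: h2_inner_def taylor_coeff_power sums_iff)
qed

lemma h2_inner_one_left: "h2_inner (\<lambda>z. 1) B = cnj (B 0)"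
  using h2_inner_power_left[of 0 B] by (simp add: taylor_coeff_def)

lemma h2_inner_one_right: "h2_inner A (\<lambda>z. 1) = A 0"
  using h2_inner_power_right[of A 0] by (simp add: taylor_coeff_def)

text \<open>
  The norm condition says that the boundary values have modulus one almost everywhere, but without
  mentioning boundary values; in this form the property is stable under composition by pure
  Hilbert space reasoning.
\<close>

definition inner_map :: "(complex \<Rightarrow> complex) \<Rightarrow> bool" where
  "inner_map \<phi> \<longleftrightarrow> \<phi> holomorphic_on ball 0 1 \<and> \<phi> ` ball 0 1 \<subseteq> ball 0 1 \<and> \<phi> 0 = 0 \<and>
     h2_inner \<phi> \<phi> = 1"

lemma inner_mapD:
  assumes "inner_map \<phi>"
  shows "\<phi> holomorphic_on ball 0 1" "\<phi> ` ball 0 1 \<subseteq> ball 0 1" "\<phi> 0 = 0" "h2_inner \<phi> \<phi> = 1"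
    "\<And>z. cmod z < 1 \<Longrightarrow> cmod (\<phi> z) < 1"
  using assms by (auto simp: inner_map_def image_subset_iff)

lemma inner_map_bdd_hol: "inner_map \<phi> \<Longrightarrow> bdd_hol \<phi>"
  using inner_mapD by (intro bdd_holI[of _ 1]) (auto intro: less_imp_le)

lemma inner_map_comp_bdd_hol: "inner_map \<phi> \<Longrightarrow> bdd_hol A \<Longrightarrow> bdd_hol (\<lambda>z. A (\<phi> z))"
  by (rule bdd_hol_comp[OF _ inner_mapD(1,2)])

lemma inner_map_ident: "inner_map (\<lambda>z. z)"
proof -
  have "h2_inner (\<lambda>z. z) (\<lambda>z. z) = 1"
    using h2_inner_power_left[of 1 "\<lambda>z. z"] taylor_coeff_power[of 1 1] by simp
  then show ?thesis by (auto simp: inner_map_def)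
qed

text \<open>
  On the circle of radius \<open>r\<close> the two averages differ by the average of \<open>(1 - |\<phi>|\<^sup>2) A cnj B\<close>. The
  weight \<open>1 - |\<phi>|\<^sup>2\<close> is non-negative and its average tends to \<open>1 - \<langle>\<phi>, \<phi>\<rangle> = 0\<close>, while \<open>A\<close> and \<open>B\<close>
  are bounded.
\<close>

theorem h2_inner_mult_inner_map:
  assumes \<phi>: "inner_map \<phi>" and A: "bdd_hol A" and B: "bdd_hol B"
  shows "h2_inner (\<lambda>z. \<phi> z * A z) (\<lambda>z. \<phi> z * B z) = h2_inner A B"
proof -
  note \<phi>b = inner_map_bdd_hol[OF \<phi>]
  obtain K where K: "K > 0" "\<And>z. cmod z < 1 \<Longrightarrow> cmod (A z) \<le> K"
    using bdd_holE[OF A] by blast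
  obtain L where L: "L > 0" "\<And>z. cmod z < 1 \<Longrightarrow> cmod (B z) \<le> L"
    using bdd_holE[OF B] by blast
  have le: "cmod (circle_mean r A B - circle_mean r (\<lambda>z. \<phi> z * A z) (\<lambda>z. \<phi> z * B z))
      \<le> K * L * (1 - Re (circle_mean r \<phi> \<phi>))" if r: "r \<in> {0<..<1}" for r
  proof -
    define w where "w = (\<lambda>t. of_real r * cis t)"
    have w: "cmod (w t) < 1" for t using r by (simp add: w_def norm_mult)
    have int: "integrable angle_measure (\<lambda>t. X (w t) * cnj (Y (w t)))"
      if XY: "bdd_hol X" "bdd_hol Y" for X Y
    proof -
      obtain k where k: "k > 0" "\<And>z. cmod z < 1 \<Longrightarrow> cmod (X z) \<le> k"
        using bdd_holE[OF XY(1)] by blast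
      obtain l where l: "l > 0" "\<And>z. cmod z < 1 \<Longrightarrow> cmod (Y z) \<le> l"
        using bdd_holE[OF XY(2)] by blast
      have "continuous_on UNIV (\<lambda>t. X (w t) * cnj (Y (w t)))"
        unfolding w_def using r XY
        by (intro continuous_intros continuous_on_circle bdd_hol_holomorphic) auto
      moreover have "cmod (X (w t) * cnj (Y (w t))) \<le> k * l" for t
        using k l w by (auto simp: norm_mult intro!: mult_mono)
      ultimately show ?thesis by (rule integrable_angle_measure)
    qed
    have eq: "circle_mean r X Y = (LINT t|angle_measure. X (w t) * cnj (Y (w t)))" for X Y
      by (simp add: circle_mean_def w_def)
    have int2: "integrable angle_measure (\<lambda>t. K * L * (1 - Re (\<phi> (w t) * cnj (\<phi> (w t)))))"
      using integrable_Re[OF int[OF \<phi>b \<phi>b]] by (intro integrable_mult_right integrable_diff) auto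
    have "circle_mean r A B - circle_mean r (\<lambda>z. \<phi> z * A z) (\<lambda>z. \<phi> z * B z) =
      (LINT t|angle_measure. A (w t) * cnj (B (w t)) - \<phi> (w t) * A (w t) * cnj (\<phi> (w t) * B (w t)))"
      unfolding eq by (rule Bochner_Integration.integral_diff[symmetric])
        (intro int bdd_hol_intros A B \<phi>b)+
    also have "cmod \<dots> \<le> (LINT t|angle_measure. K * L * (1 - Re (\<phi> (w t) * cnj (\<phi> (w t)))))"
    proof (rule order_trans[OF integral_norm_bound], rule integral_mono)
      show "integrable angle_measure (\<lambda>t. cmod (A (w t) * cnj (B (w t)) -
              \<phi> (w t) * A (w t) * cnj (\<phi> (w t) * B (w t))))"
        by (intro integrable_norm Bochner_Integration.integrable_diff int bdd_hol_intros A B \<phi>b)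
      fix t
      have "A (w t) * cnj (B (w t)) - \<phi> (w t) * A (w t) * cnj (\<phi> (w t) * B (w t)) =
          A (w t) * cnj (B (w t)) * (1 - \<phi> (w t) * cnj (\<phi> (w t)))"
        by (simp add: algebra_simps)
      also have "1 - \<phi> (w t) * cnj (\<phi> (w t)) = of_real (1 - (cmod (\<phi> (w t)))\<^sup>2)"
        by (simp only: complex_norm_square of_real_diff of_real_1)
      also have "cmod (A (w t) * cnj (B (w t)) * of_real (1 - (cmod (\<phi> (w t)))\<^sup>2)) =
          cmod (A (w t)) * cmod (B (w t)) * (1 - (cmod (\<phi> (w t)))\<^sup>2)"
        using inner_mapD(5)[OF \<phi> w[of t]]
        by (simp add: norm_mult power_le_one del: of_real_diff)
      also have "\<dots> \<le> K * L * (1 - (cmod (\<phi> (w t)))\<^sup>2)"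
        using inner_mapD(5)[OF \<phi> w[of t]] K L w[of t]
        by (intro mult_right_mono mult_mono) (auto simp: power_le_one)
      also have "(cmod (\<phi> (w t)))\<^sup>2 = Re (\<phi> (w t) * cnj (\<phi> (w t)))"
        by (simp only: complex_norm_square[symmetric] Re_complex_of_real)
      finally show "cmod (A (w t) * cnj (B (w t)) - \<phi> (w t) * A (w t) * cnj (\<phi> (w t) * B (w t)))
          \<le> K * L * (1 - Re (\<phi> (w t) * cnj (\<phi> (w t))))" .
    qed (rule int2)
    also have "\<dots> = K * L * (1 - Re (circle_mean r \<phi> \<phi>))"
      using integrable_Re[OF int[OF \<phi>b \<phi>b]] angle.prob_space int[OF \<phi>b \<phi>b]
      unfolding eq by (subst integral_mult_right_zero, subst Bochner_Integration.integral_diff)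
        (auto simp del: complex_mult_cnj cnj.simps times_complex.simps)
    finally show ?thesis .
  qed
  have "((\<lambda>r. circle_mean r A B - circle_mean r (\<lambda>z. \<phi> z * A z) (\<lambda>z. \<phi> z * B z)) \<longlongrightarrow> 0) (at_left 1)"
  proof (rule Lim_null_comparison)
    from eventually_radius_in_unit_interval
    show "\<forall>\<^sub>F r in at_left 1. cmod (circle_mean r A B - circle_mean r (\<lambda>z. \<phi> z * A z) (\<lambda>z. \<phi> z * B z))
        \<le> K * L * (1 - Re (circle_mean r \<phi> \<phi>))"
      by eventually_elim (rule le)
    have "((\<lambda>r. K * L * (1 - Re (circle_mean r \<phi> \<phi>))) \<longlongrightarrow> K * L * (1 - Re (h2_inner \<phi> \<phi>))) (at_left 1)"
      by (intro tendsto_intros h2_inner_limit \<phi>b)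
    then show "((\<lambda>r. K * L * (1 - Re (circle_mean r \<phi> \<phi>))) \<longlongrightarrow> 0) (at_left 1)"
      by (simp add: inner_mapD[OF \<phi>])
  qed
  moreover have "((\<lambda>r. circle_mean r A B - circle_mean r (\<lambda>z. \<phi> z * A z) (\<lambda>z. \<phi> z * B z)) \<longlongrightarrow>
      h2_inner A B - h2_inner (\<lambda>z. \<phi> z * A z) (\<lambda>z. \<phi> z * B z)) (at_left 1)"
    by (intro tendsto_intros h2_inner_limit bdd_hol_intros A B \<phi>b)
  ultimately show ?thesis
    using tendsto_unique[OF trivial_limit_at_left_real] by fastforce
qed

lemma h2_inner_mult_inner_map_power:
  assumes \<phi>: "inner_map \<phi>" and A: "bdd_hol A" and B: "bdd_hol B"
  shows "h2_inner (\<lambda>z. \<phi> z ^ n * A z) (\<lambda>z. \<phi> z ^ n * B z) = h2_inner A B"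
proof (induction n)
  case (Suc n)
  have "h2_inner (\<lambda>z. \<phi> z * (\<phi> z ^ n * A z)) (\<lambda>z. \<phi> z * (\<phi> z ^ n * B z)) =
      h2_inner (\<lambda>z. \<phi> z ^ n * A z) (\<lambda>z. \<phi> z ^ n * B z)"
    by (intro h2_inner_mult_inner_map bdd_hol_intros inner_map_bdd_hol assms)
  with Suc show ?case by (simp add: mult.assoc)
qed simp

lemma h2_norm2_shift: "h2_norm2 (\<lambda>z. z ^ n * A z) = h2_norm2 A" if "bdd_hol A"
proof -
  have "complex_of_real (h2_norm2 (\<lambda>z. z ^ n * A z)) = of_real (h2_norm2 A)"
    using h2_inner_mult_inner_map_power[OF inner_map_ident that that, of n]
    by (subst (1 2) h2_inner_self[symmetric]) (auto intro!: bdd_hol_intros that)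
  then show ?thesis by (simp only: of_real_eq_iff)
qed

text \<open>
  The Schwarz lemma, phrased for the quotient \<open>\<phi> z / z\<close>.
\<close>

lemma self_map_factor:
  assumes "\<phi> holomorphic_on ball 0 1" "\<phi> ` ball 0 1 \<subseteq> ball 0 1" "\<phi> 0 = 0"
  obtains h where "h holomorphic_on ball 0 1" "\<And>z. cmod z < 1 \<Longrightarrow> \<phi> z = z * h z"
    "\<And>z. cmod z < 1 \<Longrightarrow> cmod (h z) \<le> 1" "h 0 = deriv \<phi> 0"
proof -
  obtain h where h: "h holomorphic_on ball 0 1" "\<And>z. cmod z < 1 \<Longrightarrow> \<phi> z = z * h z" "deriv \<phi> 0 = h 0"
    using Schwarz3[OF assms(1,3)] by blast
  have lt: "\<And>z. cmod z < 1 \<Longrightarrow> cmod (\<phi> z) < 1" using assms(2) by (auto simp: image_subset_iff)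
  have "cmod (h z) \<le> 1" if "cmod z < 1" for z
  proof (cases "z = 0")
    case True
    then show ?thesis using Schwarz_Lemma(2)[OF assms(1,3) lt that] h by simp
  next
    case False
    then show ?thesis using Schwarz_Lemma(1)[OF assms(1,3) lt that] h(2)[OF that]
      by (simp add: norm_mult)
  qed
  with h that show ?thesis by metis
qed

lemma inner_map_norm_le:
  assumes "inner_map \<phi>" "cmod z < 1" shows "cmod (\<phi> z) \<le> cmod z"
  by (rule Schwarz_Lemma(1)) (use assms in \<open>auto simp: inner_mapD\<close>)

text \<open>
  Common powers of \<open>\<phi>\<close> cancel by the isometry property. What remains is either evaluation at 0 of a
  multiple of \<open>\<phi>\<close>, or a Taylor coefficient of \<open>\<phi>\<^sup>s\<^sup>-\<^sup>p\<close>, whose order of vanishing at 0 is at least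
  \<open>s - p\<close>.
\<close>

lemma h2_inner_inner_map_powers:
  assumes \<phi>: "inner_map \<phi>"
  shows "h2_inner (\<lambda>z. z ^ l * \<phi> z ^ p) (\<lambda>z. \<phi> z ^ s) =
    (if p \<le> s \<and> s - p \<le> l then h2_inner (\<lambda>z. z ^ l) (\<lambda>z. \<phi> z ^ (s - p)) else 0)"
proof (cases "p \<le> s")
  case True
  have "h2_inner (\<lambda>z. \<phi> z ^ p * z ^ l) (\<lambda>z. \<phi> z ^ p * \<phi> z ^ (s - p)) =
      h2_inner (\<lambda>z. z ^ l) (\<lambda>z. \<phi> z ^ (s - p))"
    by (intro h2_inner_mult_inner_map_power bdd_hol_intros inner_map_bdd_hol \<phi>)
  then have eq: "h2_inner (\<lambda>z. z ^ l * \<phi> z ^ p) (\<lambda>z. \<phi> z ^ s) =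
      h2_inner (\<lambda>z. z ^ l) (\<lambda>z. \<phi> z ^ (s - p))"
    using True by (simp add: mult.commute flip: power_add)
  have "h2_inner (\<lambda>z. z ^ l) (\<lambda>z. \<phi> z ^ (s - p)) = 0" if "l < s - p"
  proof -
    obtain h where h: "h holomorphic_on ball 0 1" "\<And>z. cmod z < 1 \<Longrightarrow> \<phi> z = z * h z"
        "\<And>z. cmod z < 1 \<Longrightarrow> cmod (h z) \<le> 1"
      using self_map_factor[OF inner_mapD(1-3)[OF \<phi>]] by metis
    have "taylor_coeff (\<lambda>z. \<phi> z ^ (s - p)) l = taylor_coeff (\<lambda>z. z ^ l * (z ^ (s - p - l) * h z ^ (s - p))) l"
      unfolding taylor_coeff_def
    proof (intro arg_cong2[where f = "(/)"] refl higher_deriv_cong_ev)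
      have "\<forall>\<^sub>F z in nhds (0::complex). z \<in> ball 0 1"
        by (rule eventually_nhds_in_open) auto
      then show "\<forall>\<^sub>F z in nhds 0. \<phi> z ^ (s - p) = z ^ l * (z ^ (s - p - l) * h z ^ (s - p))"
        by eventually_elim (use h that in \<open>auto simp: power_mult_distrib mult.assoc simp flip: power_add\<close>)
    qed
    also have "cnj \<dots> = h2_inner (\<lambda>z. z ^ l * 1) (\<lambda>z. z ^ l * (z ^ (s - p - l) * h z ^ (s - p)))"
      using h2_inner_power_left by simp
    also have "\<dots> = h2_inner (\<lambda>z. 1) (\<lambda>z. z ^ (s - p - l) * h z ^ (s - p))"
      using h by (intro h2_inner_mult_inner_map_power inner_map_ident bdd_hol_intros) (auto intro: bdd_holI)
    also have "\<dots> = 0"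
    proof -
      have "0 < s - p - l" using that by linarith
      then show ?thesis unfolding h2_inner_one_left by simp
    qed
    finally show ?thesis using h2_inner_power_left by simp
  qed
  with eq True show ?thesis by auto
next
  case False
  have "h2_inner (\<lambda>z. \<phi> z ^ s * (z ^ l * \<phi> z ^ (p - s))) (\<lambda>z. \<phi> z ^ s * 1) =
      h2_inner (\<lambda>z. z ^ l * \<phi> z ^ (p - s)) (\<lambda>z. 1)"
    by (intro h2_inner_mult_inner_map_power bdd_hol_intros inner_map_bdd_hol \<phi>)
  also have "\<dots> = 0"
    using False by (simp add: h2_inner_one_right inner_mapD(3)[OF \<phi>])
  also have "(\<lambda>z. \<phi> z ^ s * (z ^ l * \<phi> z ^ (p - s))) = (\<lambda>z. z ^ l * \<phi> z ^ p)"
    using False by (auto simp: mult.left_commute simp flip: power_add)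
  finally show ?thesis using False by simp
qed

definition taylor_poly :: "(complex \<Rightarrow> complex) \<Rightarrow> nat \<Rightarrow> complex \<Rightarrow> complex" where
  "taylor_poly A N z = (\<Sum>n<N. taylor_coeff A n * z ^ n)"

lemma bdd_hol_taylor_poly: "bdd_hol (taylor_poly A N)"
  unfolding taylor_poly_def[abs_def] by (intro bdd_hol_intros)

lemma taylor_coeff_taylor_poly: "taylor_coeff (taylor_poly A N) n = (if n < N then taylor_coeff A n else 0)"
proof -
  have "taylor_coeff (taylor_poly A N) n = h2_inner (taylor_poly A N) (\<lambda>z. z ^ n)"
    by (simp add: h2_inner_power_right)
  also have "\<dots> = (\<Sum>i<N. taylor_coeff A i * of_bool (n = i))"
    unfolding taylor_poly_def[abs_def]
    by (subst h2_inner_sum_left) (auto simp: h2_inner_power_right taylor_coeff_power intro!: bdd_hol_intros)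
  also have "\<dots> = (if n < N then taylor_coeff A n else 0)"
    by (auto simp: of_bool_def if_distrib cong: if_cong)
  finally show ?thesis .
qed

lemma taylor_poly_tendsto:
  assumes "bdd_hol A"
  shows "(\<lambda>N. h2_norm2 (\<lambda>z. taylor_poly A N z - A z)) \<longlonglongrightarrow> 0"
proof -
  have "h2_norm2 (\<lambda>z. taylor_poly A N z - A z) = (\<Sum>n. (cmod (taylor_coeff A (n + N)))\<^sup>2)" for N
  proof -
    have c: "taylor_coeff (\<lambda>z. taylor_poly A N z - A z) n = (if n < N then 0 else - taylor_coeff A n)" for n
      using assms bdd_hol_taylor_poly
      by (subst taylor_coeff_linear) (auto simp: taylor_coeff_taylor_poly bdd_hol_holomorphic)
    have "summable (\<lambda>n. (cmod (taylor_coeff (\<lambda>z. taylor_poly A N z - A z) n))\<^sup>2)"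
      by (intro summable_taylor_square bdd_hol_intros assms bdd_hol_taylor_poly)
    from suminf_split_initial_segment[OF this, of N] show ?thesis by (simp add: c)
  qed
  then show ?thesis
    using suminf_exist_split2[OF summable_taylor_square[OF assms]] by simp
qed

text \<open>
  The powers of \<open>\<phi>\<close> are orthonormal, so composition with \<open>\<phi>\<close> preserves the norm of a polynomial.
\<close>

lemma h2_norm2_taylor_poly_comp:
  assumes \<phi>: "inner_map \<phi>" and A: "bdd_hol A"
  shows "h2_norm2 (\<lambda>z. taylor_poly A N (\<phi> z)) \<le> h2_norm2 A"
proof -
  have ortho: "h2_inner (\<lambda>z. \<phi> z ^ i) (\<lambda>z. \<phi> z ^ j) = of_bool (i = j)" for i j
    using h2_inner_inner_map_powers[OF \<phi>, of 0 i j] by (auto simp: h2_inner_one_left)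
  have "h2_inner (\<lambda>z. taylor_poly A N (\<phi> z)) (\<lambda>z. taylor_poly A N (\<phi> z)) =
      (\<Sum>i<N. taylor_coeff A i * (\<Sum>j<N. cnj (taylor_coeff A j) * of_bool (i = j)))"
    unfolding taylor_poly_def
    by (subst h2_inner_sum_left; (subst h2_inner_sum_right)?)
       (auto simp: ortho intro!: bdd_hol_intros inner_map_bdd_hol[OF \<phi>])
  also have "\<dots> = of_real (\<Sum>i<N. (cmod (taylor_coeff A i))\<^sup>2)"
    unfolding of_real_sum
    by (intro sum.cong refl) (auto simp: of_bool_def if_distrib simp flip: complex_norm_square cong: if_cong)
  finally have "complex_of_real (h2_norm2 (\<lambda>z. taylor_poly A N (\<phi> z))) =
      of_real (\<Sum>i<N. (cmod (taylor_coeff A i))\<^sup>2)"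
    by (simp only: h2_inner_self[OF inner_map_comp_bdd_hol[OF \<phi> bdd_hol_taylor_poly]])
  then have "h2_norm2 (\<lambda>z. taylor_poly A N (\<phi> z)) = (\<Sum>i<N. (cmod (taylor_coeff A i))\<^sup>2)"
    by (simp only: of_real_eq_iff)
  also have "\<dots> \<le> h2_norm2 A"
    by (intro sum_le_suminf summable_taylor_square A) auto
  finally show ?thesis .
qed

lemma Re_circle_mean_le:
  assumes "bdd_hol A" "0 \<le> r" "r < 1"
  shows "Re (circle_mean r A A) \<le> h2_norm2 A"
proof (rule sums_le[OF _ Re_circle_mean_sums summable_sums[OF summable_taylor_square[OF assms(1)]]])
  show "(cmod (taylor_coeff A n))\<^sup>2 * r ^ (2 * n) \<le> (cmod (taylor_coeff A n))\<^sup>2" for n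
    using assms by (intro mult_left_le) (auto simp: power_le_one)
qed (use assms in \<open>auto simp: bdd_hol_holomorphic\<close>)

lemma h2_norm2_le:
  assumes A: "bdd_hol A" and "\<And>r. 0 < r \<Longrightarrow> r < 1 \<Longrightarrow> Re (circle_mean r A A) \<le> K"
  shows "h2_norm2 A \<le> K"
proof -
  have "Re (h2_inner A A) \<le> K"
  proof (rule tendsto_upperbound)
    show "((\<lambda>r. Re (circle_mean r A A)) \<longlongrightarrow> Re (h2_inner A A)) (at_left 1)"
      by (intro tendsto_intros h2_inner_limit A)
    from eventually_radius_in_unit_interval
    show "\<forall>\<^sub>F r in at_left 1. Re (circle_mean r A A) \<le> K"
      by eventually_elim (use assms in auto)
  qed simp
  then show ?thesis by (simp add: h2_inner_self[OF A])
qed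

text \<open>
  Littlewood subordination. The circle of radius \<open>r\<close> is mapped into the disc of radius \<open>r\<close>, where the
  Taylor polynomials converge boundedly, so the averages of \<open>A \<circ> \<phi>\<close> are limits of averages that are
  bounded by the norm of \<open>A\<close>.
\<close>

theorem h2_norm2_comp_le:
  assumes \<phi>: "inner_map \<phi>" and A: "bdd_hol A"
  shows "h2_norm2 (\<lambda>z. A (\<phi> z)) \<le> h2_norm2 A"
proof (rule h2_norm2_le)
  show "bdd_hol (\<lambda>z. A (\<phi> z))" by (rule inner_map_comp_bdd_hol[OF \<phi> A])
  fix r :: real assume r: "0 < r" "r < 1"
  define w where "w = (\<lambda>t. \<phi> (of_real r * cis t))"
  have w: "cmod (w t) \<le> r" for t
    using inner_map_norm_le[OF \<phi>, of "of_real r * cis t"] r by (simp add: w_def norm_mult)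
  have w_app: "w t = \<phi> (of_real r * cis t)" for t by (simp add: w_def)
  define S where "S = (\<Sum>n. cmod (taylor_coeff A n * of_real r ^ n))"
  have sum: "summable (\<lambda>n. cmod (taylor_coeff A n * of_real r ^ n))"
    using taylor_summable r A by (auto simp: bdd_hol_holomorphic)
  have bound: "cmod (taylor_poly A N (w t)) \<le> S" for N t
  proof -
    have "cmod (taylor_poly A N (w t)) \<le> (\<Sum>n<N. cmod (taylor_coeff A n * w t ^ n))"
      unfolding taylor_poly_def by (rule norm_sum)
    also have "\<dots> \<le> (\<Sum>n<N. cmod (taylor_coeff A n * of_real r ^ n))"
      using w r by (intro sum_mono) (auto simp: norm_mult norm_power intro!: mult_left_mono power_mono)
    also have "\<dots> \<le> S" unfolding S_def by (rule sum_le_suminf[OF sum]) auto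
    finally show ?thesis .
  qed
  have S: "0 \<le> S" using bound[of 0 0] by (simp add: taylor_poly_def)
  have cw: "continuous_on UNIV w"
    unfolding w_def using continuous_on_circle[OF inner_mapD(1)[OF \<phi>]] r by auto
  have "(\<lambda>N. circle_mean r (\<lambda>z. taylor_poly A N (\<phi> z)) (\<lambda>z. taylor_poly A N (\<phi> z))) \<longlonglongrightarrow>
      circle_mean r (\<lambda>z. A (\<phi> z)) (\<lambda>z. A (\<phi> z))"
    unfolding circle_mean_def w_app[symmetric]
  proof (rule integral_dominated_convergence[where w = "\<lambda>_. S * S" and
        f = "\<lambda>t. A (w t) * cnj (A (w t))" and
        s = "\<lambda>N t. taylor_poly A N (w t) * cnj (taylor_poly A N (w t))"])
    have lim: "(\<lambda>N. taylor_poly A N (w t)) \<longlonglongrightarrow> A (w t)" for t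
    proof -
      have "cmod (w t) < 1" using w[of t] r by linarith
      then show ?thesis
        using taylor_sums[OF bdd_hol_holomorphic[OF A]] unfolding sums_def taylor_poly_def by blast
    qed
    show "AE t in angle_measure. (\<lambda>N. taylor_poly A N (w t) * cnj (taylor_poly A N (w t))) \<longlonglongrightarrow> A (w t) * cnj (A (w t))"
      by (intro AE_I2 tendsto_intros lim)
    show "AE t in angle_measure. cmod (taylor_poly A N (w t) * cnj (taylor_poly A N (w t))) \<le> S * S" for N
      by (intro AE_I2) (auto simp: norm_mult intro!: mult_mono bound S)
    have "continuous_on UNIV (\<lambda>t. A (w t))"
      unfolding w_def using continuous_on_circle[OF bdd_hol_holomorphic[OF inner_map_comp_bdd_hol[OF \<phi> A]]] r by auto
    then have "continuous_on UNIV (\<lambda>t. A (w t) * cnj (A (w t)))"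
      by (intro continuous_intros)
    from borel_measurable_continuous_onI[OF this]
    show "(\<lambda>t. A (w t) * cnj (A (w t))) \<in> borel_measurable angle_measure" by simp
    have "continuous_on UNIV (\<lambda>t. taylor_poly A N (w t) * cnj (taylor_poly A N (w t)))" for N
      unfolding taylor_poly_def by (intro continuous_intros cw)
    from borel_measurable_continuous_onI[OF this]
    show "(\<lambda>t. taylor_poly A N (w t) * cnj (taylor_poly A N (w t))) \<in> borel_measurable angle_measure" for N
      by simp
  qed auto
  then have "(\<lambda>N. Re (circle_mean r (\<lambda>z. taylor_poly A N (\<phi> z)) (\<lambda>z. taylor_poly A N (\<phi> z)))) \<longlonglongrightarrow>
      Re (circle_mean r (\<lambda>z. A (\<phi> z)) (\<lambda>z. A (\<phi> z)))"
    by (rule tendsto_Re)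
  then show "Re (circle_mean r (\<lambda>z. A (\<phi> z)) (\<lambda>z. A (\<phi> z))) \<le> h2_norm2 A"
  proof (rule LIMSEQ_le_const2, intro exI allI impI)
    fix N
    show "Re (circle_mean r (\<lambda>z. taylor_poly A N (\<phi> z)) (\<lambda>z. taylor_poly A N (\<phi> z))) \<le> h2_norm2 A"
      using Re_circle_mean_le[OF inner_map_comp_bdd_hol[OF \<phi> bdd_hol_taylor_poly[of A N]], of r] r
        h2_norm2_taylor_poly_comp[OF \<phi> A, of N] by simp
  qed
qed

text \<open>
  This describes the adjoint of composition with \<open>\<phi>\<close>: it maps \<open>z\<^sup>l\<close> to a polynomial of degree at most \<open>l\<close>.
  For monomials \<open>A\<close> and \<open>B\<close> it is the preceding computation with powers of \<open>\<phi>\<close>, it extends to Taylor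
  polynomials by sesquilinearity, and to all bounded functions because composition with \<open>\<phi>\<close> does not
  increase the norm.
\<close>

theorem h2_inner_transfer:
  assumes \<phi>: "inner_map \<phi>" and A: "bdd_hol A" and B: "bdd_hol B"
  shows "h2_inner (\<lambda>z. z ^ l * A (\<phi> z)) (\<lambda>z. B (\<phi> z)) =
    (\<Sum>j\<le>l. h2_inner (\<lambda>z. z ^ l) (\<lambda>z. \<phi> z ^ j) * h2_inner (\<lambda>z. z ^ j * A z) B)"
proof -
  define c where "c = (\<lambda>j. h2_inner (\<lambda>z. z ^ l) (\<lambda>z. \<phi> z ^ j))"
  note bh = bdd_hol_intros inner_map_comp_bdd_hol[OF \<phi>] bdd_hol_taylor_poly inner_map_bdd_hol[OF \<phi>] A B
  have mono: "h2_inner (\<lambda>z. z ^ l * \<phi> z ^ p) (\<lambda>z. \<phi> z ^ s) =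
      (\<Sum>j\<le>l. c j * h2_inner (\<lambda>z. z ^ j * z ^ p) (\<lambda>z. z ^ s))" for p s
  proof -
    have "(\<Sum>j\<le>l. c j * h2_inner (\<lambda>z. z ^ j * z ^ p) (\<lambda>z. z ^ s)) =
        (\<Sum>j\<le>l. if p \<le> s \<and> j = s - p then c j else 0)"
      by (intro sum.cong refl) (auto simp: h2_inner_power_right taylor_coeff_power simp flip: power_add)
    also have "\<dots> = (if p \<le> s \<and> s - p \<le> l then c (s - p) else 0)"
      by auto
    finally show ?thesis by (simp add: c_def h2_inner_inner_map_powers[OF \<phi>])
  qed
  have poly: "h2_inner (\<lambda>z. z ^ l * taylor_poly A N (\<phi> z)) (\<lambda>z. taylor_poly B N (\<phi> z)) =
    (\<Sum>j\<le>l. c j * h2_inner (\<lambda>z. z ^ j * taylor_poly A N z) (taylor_poly B N))" for N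
  proof -
    have gen: "h2_inner (\<lambda>z. z ^ i * taylor_poly A N (\<psi> z)) (\<lambda>z. taylor_poly B N (\<psi> z)) =
      (\<Sum>p<N. taylor_coeff A p * (\<Sum>s<N. cnj (taylor_coeff B s) *
          h2_inner (\<lambda>z. z ^ i * \<psi> z ^ p) (\<lambda>z. \<psi> z ^ s)))" if "inner_map \<psi>" for i \<psi>
    proof -
      have eq: "(\<lambda>z. z ^ i * taylor_poly A N (\<psi> z)) = (\<lambda>z. \<Sum>p<N. taylor_coeff A p * (z ^ i * \<psi> z ^ p))"
        by (simp add: taylor_poly_def sum_distrib_left mult_ac)
      show ?thesis
        unfolding eq
        apply (subst h2_inner_sum_left)
        subgoal by simp
        subgoal by (intro bh inner_map_bdd_hol[OF that])
        subgoal by (intro inner_map_comp_bdd_hol[OF that] bdd_hol_taylor_poly)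
        unfolding taylor_poly_def
        by (subst h2_inner_sum_right) (auto intro!: bh inner_map_bdd_hol[OF that])
    qed
    show ?thesis
      using gen[OF \<phi>, of l] gen[OF inner_map_ident]
      by (simp add: mono sum_distrib_left mult_ac sum.swap[of _ "{..l}" "{..<N}"])
  qed
  have conv: "(\<lambda>N. h2_inner (\<lambda>z. z ^ i * taylor_poly A N (\<psi> z)) (\<lambda>z. taylor_poly B N (\<psi> z))) \<longlonglongrightarrow>
      h2_inner (\<lambda>z. z ^ i * A (\<psi> z)) (\<lambda>z. B (\<psi> z))" if \<psi>: "inner_map \<psi>" for i \<psi>
  proof (rule h2_inner_tendsto)
    have *: "(\<lambda>N. h2_norm2 (\<lambda>z. taylor_poly X N (\<psi> z) - X (\<psi> z))) \<longlonglongrightarrow> 0" if X: "bdd_hol X" for X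
    proof (rule Lim_null_comparison[OF _ taylor_poly_tendsto[OF X]], intro always_eventually allI)
      fix N
      have "bdd_hol (\<lambda>z. taylor_poly X N z - X z)" by (intro bh X)
      from h2_norm2_comp_le[OF \<psi> this] h2_norm2_nonneg[OF inner_map_comp_bdd_hol[OF \<psi> this]]
      show "norm (h2_norm2 (\<lambda>z. taylor_poly X N (\<psi> z) - X (\<psi> z))) \<le> h2_norm2 (\<lambda>z. taylor_poly X N z - X z)"
        by simp
    qed
    show "(\<lambda>N. h2_norm2 (\<lambda>z. taylor_poly B N (\<psi> z) - B (\<psi> z))) \<longlonglongrightarrow> 0"
      by (rule *[OF B])
    have "h2_norm2 (\<lambda>z. z ^ i * taylor_poly A N (\<psi> z) - z ^ i * A (\<psi> z)) =
        h2_norm2 (\<lambda>z. taylor_poly A N (\<psi> z) - A (\<psi> z))" for N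
      unfolding right_diff_distrib[symmetric]
      by (intro h2_norm2_shift bh inner_map_comp_bdd_hol[OF \<psi>])
    then show "(\<lambda>N. h2_norm2 (\<lambda>z. z ^ i * taylor_poly A N (\<psi> z) - z ^ i * A (\<psi> z))) \<longlonglongrightarrow> 0"
      using *[OF A] by simp
  qed (intro bh inner_map_comp_bdd_hol[OF \<psi>])+
  have "(\<lambda>N. \<Sum>j\<le>l. c j * h2_inner (\<lambda>z. z ^ j * taylor_poly A N z) (taylor_poly B N)) \<longlonglongrightarrow>
      (\<Sum>j\<le>l. c j * h2_inner (\<lambda>z. z ^ j * A z) B)"
    by (intro tendsto_intros conv[OF inner_map_ident])
  with conv[OF \<phi>, of l] poly show ?thesis
    unfolding c_def by (simp add: LIMSEQ_unique)
qed

text \<open>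
  The transfer identity with \<open>l = 0\<close> says that composition is an isometry, so the norm of \<open>\<phi> \<circ> \<psi>\<close> is
  that of \<open>\<phi>\<close>.
\<close>

lemma inner_map_comp:
  assumes "inner_map \<phi>" "inner_map \<psi>"
  shows "inner_map (\<lambda>z. \<phi> (\<psi> z))"
proof -
  have "h2_inner (\<lambda>z. \<phi> (\<psi> z)) (\<lambda>z. \<phi> (\<psi> z)) = 1"
    using h2_inner_transfer[of \<psi> \<phi> \<phi> 0] assms inner_mapD(4)[OF assms(1)]
    by (simp add: inner_map_bdd_hol h2_inner_one_right)
  moreover have "(\<lambda>z. \<phi> (\<psi> z)) holomorphic_on ball 0 1"
    using holomorphic_on_compose_gen[OF inner_mapD(1)[OF assms(2)] inner_mapD(1)[OF assms(1)]]
      inner_mapD(2)[OF assms(2)] by (simp add: o_def)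
  ultimately show ?thesis
    using assms by (auto simp: inner_map_def)
qed

lemma inner_map_funpow: "inner_map \<phi> \<Longrightarrow> inner_map (\<phi> ^^ n)"
proof (induction n)
  case 0
  then show ?case using inner_map_ident by (simp add: id_def)
next
  case (Suc n)
  then show ?case using inner_map_comp[of \<phi> "\<phi> ^^ n"] by (simp add: o_def)
qed

section \<open>Radial limits from tangential derivatives\<close>

lemma has_contour_integral_unit_circle_iff:
  "(F has_contour_integral I) (circlepath 0 1) \<longleftrightarrow>
     ((\<lambda>t. F (cis t) * \<i> * cis t) has_integral I) {0..2 * pi}"
  using has_contour_integral_part_circlepath_iff[of 0 "2 * pi" F I 0 1]
  by (simp add: circlepath_def)

lemma unit_circle_reflect:
  assumes "cmod c = 1"
  shows "1 - of_real r * c = c * cnj (c - of_real r)" "cmod (1 - of_real r * c) = cmod (c - of_real r)"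
proof -
  have "c * cnj c = 1" using complex_norm_square[of c] assms by simp
  then show eq: "1 - of_real r * c = c * cnj (c - of_real r)" by (simp add: algebra_simps)
  show "cmod (1 - of_real r * c) = cmod (c - of_real r)"
    unfolding eq by (simp only: norm_mult complex_mod_cnj assms mult_1)
qed

lemma one_minus_mult_nonzero:
  assumes "0 < r" "r < 1" "cmod z \<le> 1"
  shows "1 - of_real r * z \<noteq> 0"
proof
  assume "1 - of_real r * z = 0"
  then have "of_real r * z = 1" by simp
  then have "cmod (of_real r * z) = 1" by simp
  then have "r * cmod z = 1" using assms by (simp add: norm_mult)
  moreover have "r * cmod z \<le> r" using assms by (simp add: mult_left_le)
  ultimately show False using assms by linarith
qed

text \<open>
  The pole \<open>r\<close> is at least as far from \<open>c\<close> as half the distance from \<open>c\<close> to 1. This is what lets a factor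
  \<open>|c - 1|\<^sup>2\<close> compensate two of the four factors \<open>|c - r|\<close> in the denominator of the kernel below.
\<close>

lemma dist_one_le:
  assumes "cmod c = 1" "0 < r" "r < 1"
  shows "1 - r \<le> cmod (c - of_real r)" "cmod (c - 1) \<le> 2 * cmod (c - of_real r)"
proof -
  show le: "1 - r \<le> cmod (c - of_real r)"
    using norm_triangle_ineq2[of c "of_real r"] assms by simp
  have "cmod (c - 1) \<le> cmod (c - of_real r) + cmod (of_real r - 1)"
    using norm_triangle_ineq[of "c - of_real r" "of_real r - 1"] by simp
  also have "cmod (of_real r - 1) = 1 - r"
    using assms norm_of_real[of "r - 1", where 'a = complex] by simp
  finally show "cmod (c - 1) \<le> 2 * cmod (c - of_real r)" using le by linarith
qed

text \<open>
  On the unit circle \<open>(1 - r z) = z cnj (z - r)\<close>, so the Poisson kernel is the Cauchy kernel at \<open>r\<close> applied to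
  the function \<open>(1 - r\<^sup>2) / (1 - r z)\<close>, whose value at \<open>r\<close> is 1.
\<close>

lemma poisson_kernel_integral:
  assumes r: "0 < r" "r < 1"
  shows "((\<lambda>t. (1 - r\<^sup>2) / (cmod (cis t - of_real r))\<^sup>2) has_integral 2 * pi) {0..2 * pi}"
proof -
  note ne = one_minus_mult_nonzero[OF r]
  define F :: "complex \<Rightarrow> complex" where "F = (\<lambda>z. of_real (1 - r\<^sup>2) / (1 - of_real r * z))"
  have "((\<lambda>z. F z / (z - of_real r)) has_contour_integral 2 * of_real pi * \<i> * F (of_real r)) (circlepath 0 1)"
    unfolding F_def
    by (rule Cauchy_integral_circlepath) (use ne r in \<open>auto intro!: continuous_intros holomorphic_intros\<close>)
  also have "F (of_real r) = 1"
    using ne[of "of_real r"] r by (simp add: F_def power2_eq_square)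
  finally have "((\<lambda>t. F (cis t) / (cis t - of_real r) * \<i> * cis t) has_integral (2 * of_real pi * \<i>)) {0..2 * pi}"
    unfolding has_contour_integral_unit_circle_iff by simp
  moreover have "F (cis t) / (cis t - of_real r) * \<i> * cis t =
      \<i> * of_real ((1 - r\<^sup>2) / (cmod (cis t - of_real r))\<^sup>2)" for t
  proof -
    have "F (cis t) / (cis t - of_real r) * \<i> * cis t =
      of_real (1 - r\<^sup>2) / (cis t * cnj (cis t - of_real r)) / (cis t - of_real r) * \<i> * cis t"
      by (simp only: F_def unit_circle_reflect(1)[OF norm_cis])
    also have "\<dots> = \<i> * of_real (1 - r\<^sup>2) / ((cis t - of_real r) * cnj (cis t - of_real r))"
      by (simp add: mult.commute del: complex_cnj_diff)
    finally show ?thesis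
      by (simp only: complex_norm_square[symmetric] of_real_divide times_divide_eq_right)
  qed
  ultimately have "((\<lambda>t. \<i> * of_real ((1 - r\<^sup>2) / (cmod (cis t - of_real r))\<^sup>2)) has_integral (2 * of_real pi * \<i>)) {0..2 * pi}"
    by simp
  from has_integral_linear[OF this bounded_linear_Im] show ?thesis
    by (simp add: o_def)
qed

text \<open>
  In the Cauchy formula for the derivative at \<open>r\<close> the kernel \<open>1 / (z - r)\<^sup>2\<close> is too large near 1. Subtracting
  \<open>1 / (1 - r z)\<^sup>2\<close> does not change the integral, since this function is holomorphic in the disc, and yields the
  kernel \<open>(1 - r\<^sup>2) (1 - z\<^sup>2) / ((z - r)\<^sup>2 (1 - r z)\<^sup>2)\<close>. Its product with \<open>|z - 1|\<close> is at most 8 times the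
  Poisson kernel. Hence a function that is \<open>\<epsilon>\<close>-small compared with \<open>|z - 1|\<close> near 1 has a small
  derivative at \<open>r\<close>, up to a contribution from far away that vanishes as \<open>r\<close> tends to 1.
\<close>

lemma radial_derivative_bound:
  assumes cont: "continuous_on (cball 0 1) H" and hol: "H holomorphic_on ball 0 1"
    and B: "\<And>z. cmod z = 1 \<Longrightarrow> cmod (H z) \<le> B"
    and near: "\<And>z. cmod z = 1 \<Longrightarrow> cmod (z - 1) < \<delta> \<Longrightarrow> cmod (H z) \<le> \<epsilon> * cmod (z - 1)"
    and pos: "\<delta> > 0" "\<epsilon> > 0"
    and r: "0 < r" "r < 1"
  shows "cmod (deriv H (of_real r)) \<le> 8 * \<epsilon> + (64 * B / \<delta> ^ 4) * (1 - r\<^sup>2)"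
proof -
  note ne = one_minus_mult_nonzero[OF r]
  have B0: "0 \<le> B" using B[of 1] by (meson norm_ge_zero norm_one order_trans)
  have r2: "0 < 1 - r\<^sup>2" using r by (simp add: power_less_one_iff)
  have "(\<lambda>z. H z / (z - of_real r)\<^sup>2) contour_integrable_on circlepath 0 1"
    by (rule Cauchy_derivative_integral_circlepath[OF cont hol]) (use r in auto)
  then have 1: "((\<lambda>z. H z / (z - of_real r)\<^sup>2) has_contour_integral (2 * pi * \<i>) * deriv H (of_real r)) (circlepath 0 1)"
    using has_contour_integral_integral Cauchy_contour_integral_circlepath_2[OF cont hol, of "of_real r"] r
    by fastforce
  have "((\<lambda>z. (z * (H z / (1 - of_real r * z)\<^sup>2)) / (z - 0)) has_contour_integral
      2 * of_real pi * \<i> * (0 * (H 0 / (1 - of_real r * 0)\<^sup>2))) (circlepath 0 1)"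
    by (rule Cauchy_integral_circlepath)
       (use ne in \<open>auto intro!: continuous_intros holomorphic_intros cont hol\<close>)
  then have 2: "((\<lambda>z. H z / (1 - of_real r * z)\<^sup>2) has_contour_integral 0) (circlepath 0 1)"
    unfolding has_contour_integral_unit_circle_iff by simp
  define K where "K = (\<lambda>c. H c / (c - of_real r)\<^sup>2 - H c / (1 - of_real r * c)\<^sup>2)"
  have int: "((\<lambda>t. K (cis t) * \<i> * cis t) has_integral (2 * pi * \<i>) * deriv H (of_real r)) {0..2 * pi}"
    using has_contour_integral_diff[OF 1 2]
    unfolding has_contour_integral_unit_circle_iff by (simp add: K_def)
  define P where "P = (\<lambda>t. 8 * \<epsilon> * ((1 - r\<^sup>2) / (cmod (cis t - of_real r))\<^sup>2) + (64 * B / \<delta> ^ 4) * (1 - r\<^sup>2))"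
  have intP: "(P has_integral (8 * \<epsilon> * (2 * pi) + (2 * pi) * ((64 * B / \<delta> ^ 4) * (1 - r\<^sup>2)))) {0..2 * pi}"
    unfolding P_def
    using has_integral_add[OF has_integral_mult_right[OF poisson_kernel_integral[OF r], of "8 * \<epsilon>"]
        has_integral_const_real[of "(64 * B / \<delta> ^ 4) * (1 - r\<^sup>2)" 0 "2 * pi"]] by simp
  have bound: "cmod (K (cis t) * \<i> * cis t) \<le> P t" for t
  proof -
    define c where "c = cis t"
    define d where "d = cmod (c - of_real r)"
    have c: "cmod c = 1" by (simp add: c_def)
    note dist = dist_one_le[OF c r, folded d_def]
    have d: "d > 0" using dist(1) r by linarith
    have d2: "cmod (1 - of_real r * c) = d" using unit_circle_reflect(2)[OF c] by (simp add: d_def)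
    have nz: "c - of_real r \<noteq> 0" "1 - of_real r * c \<noteq> 0" using d d2 by (auto simp: d_def)
    \<comment> \<open>The difference of squares leaves the factor \<open>1 - r\<^sup>2\<close>, the numerator of the Poisson kernel.\<close>
    have alg: "(1 - of_real r * c)\<^sup>2 - (c - of_real r)\<^sup>2 = of_real (1 - r\<^sup>2) * ((1 - c) * (1 + c))"
      by (simp add: power2_eq_square algebra_simps)
    have "K c = H c * ((1 - of_real r * c)\<^sup>2 - (c - of_real r)\<^sup>2) / ((c - of_real r)\<^sup>2 * (1 - of_real r * c)\<^sup>2)"
      using nz by (simp add: K_def field_simps)
    then have "K c = H c * (of_real (1 - r\<^sup>2) * ((1 - c) * (1 + c))) / ((c - of_real r)\<^sup>2 * (1 - of_real r * c)\<^sup>2)"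
      unfolding alg .
    then have "cmod (K c) = cmod (H c) * ((1 - r\<^sup>2) * (cmod (1 - c) * cmod (1 + c))) / (d\<^sup>2 * d\<^sup>2)"
      using r2 d2 by (simp add: norm_mult norm_divide norm_power d_def del: of_real_diff of_real_power)
    also have "\<dots> \<le> cmod (H c) * ((1 - r\<^sup>2) * (cmod (1 - c) * 2)) / (d\<^sup>2 * d\<^sup>2)"
      using r2 d norm_triangle_ineq[of 1 c] c
      by (intro divide_right_mono mult_left_mono) auto
    also have "\<dots> = 2 * (1 - r\<^sup>2) * (cmod (H c) * cmod (c - 1)) / (d\<^sup>2 * d\<^sup>2)"
      by (simp only: norm_minus_commute[of 1 c] mult_ac)
    finally have K: "cmod (K c) \<le> 2 * (1 - r\<^sup>2) * (cmod (H c) * cmod (c - 1)) / (d\<^sup>2 * d\<^sup>2)" .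
    have "cmod (K c) \<le> P t"
    proof (cases "cmod (c - 1) < \<delta>")
      case True
      have "cmod (H c) * cmod (c - 1) \<le> (\<epsilon> * cmod (c - 1)) * cmod (c - 1)"
        using near[OF c True] by (rule mult_right_mono) simp
      also have "\<dots> = \<epsilon> * (cmod (c - 1) * cmod (c - 1))" by simp
      also have "\<dots> \<le> \<epsilon> * ((2 * d) * (2 * d))"
        using dist(2) pos d by (intro mult_left_mono mult_mono) auto
      finally have "cmod (H c) * cmod (c - 1) \<le> 4 * \<epsilon> * d\<^sup>2" by (simp add: power2_eq_square)
      then have "2 * (1 - r\<^sup>2) * (cmod (H c) * cmod (c - 1)) / (d\<^sup>2 * d\<^sup>2) \<le> 2 * (1 - r\<^sup>2) * (4 * \<epsilon> * d\<^sup>2) / (d\<^sup>2 * d\<^sup>2)"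
        using r2 d by (intro divide_right_mono mult_left_mono) auto
      also have "\<dots> = 8 * \<epsilon> * ((1 - r\<^sup>2) / d\<^sup>2)" using d by (simp add: field_simps)
      also have "\<dots> \<le> P t" using B0 pos r2 by (simp add: P_def d_def c_def)
      finally show ?thesis using K by linarith
    next
      case False
      then have "\<delta> / 2 \<le> d" using dist(2) by linarith
      then have "(\<delta> / 2) ^ 4 \<le> d ^ 4" using pos by (intro power_mono) auto
      then have d4: "\<delta> ^ 4 / 16 \<le> d\<^sup>2 * d\<^sup>2" by (simp add: power_divide flip: power_add)
      have "cmod (c - 1) \<le> 2" using norm_triangle_ineq4[of c 1] c by simp
      then have "cmod (H c) * cmod (c - 1) \<le> B * 2" using B[OF c] B0 by (intro mult_mono) auto
      then have "2 * (1 - r\<^sup>2) * (cmod (H c) * cmod (c - 1)) / (d\<^sup>2 * d\<^sup>2) \<le> 2 * (1 - r\<^sup>2) * (B * 2) / (\<delta> ^ 4 / 16)"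
        using r2 d4 pos B0 by (intro frac_le mult_left_mono) auto
      also have "\<dots> = (64 * B / \<delta> ^ 4) * (1 - r\<^sup>2)" by (simp add: field_simps)
      also have "\<dots> \<le> P t" using r2 pos by (simp add: P_def)
      finally show ?thesis using K by linarith
    qed
    then show ?thesis by (simp add: norm_mult c_def)
  qed
  have "cmod ((2 * pi * \<i>) * deriv H (of_real r)) \<le> 8 * \<epsilon> * (2 * pi) + (2 * pi) * ((64 * B / \<delta> ^ 4) * (1 - r\<^sup>2))"
    using integral_norm_bound_integral[of "\<lambda>t. K (cis t) * \<i> * cis t" "{0..2 * pi}" P] bound
      has_integral_integrable[OF int] has_integral_integrable[OF intP] integral_unique[OF int] integral_unique[OF intP]
    by auto
  also have "\<dots> = (2 * pi) * (8 * \<epsilon> + (64 * B / \<delta> ^ 4) * (1 - r\<^sup>2))" by (simp add: algebra_simps)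
  finally have "(2 * pi) * cmod (deriv H (of_real r)) \<le> (2 * pi) * (8 * \<epsilon> + (64 * B / \<delta> ^ 4) * (1 - r\<^sup>2))"
    by (simp add: norm_mult)
  then show ?thesis by (rule mult_left_le_imp_le) simp
qed

text \<open>
  Subtract the tangent at 1 and apply the previous bound to the remainder.
\<close>

theorem radial_limit_of_tangential_derivative:
  assumes cont: "continuous_on (cball 0 1) G" and hol: "G holomorphic_on ball 0 1"
    and tang: "\<And>\<epsilon>. \<epsilon> > 0 \<Longrightarrow> \<exists>\<delta>>0. \<forall>z. cmod z = 1 \<longrightarrow> cmod (z - 1) < \<delta> \<longrightarrow>
                  cmod (G z - G 1 - v * (z - 1)) \<le> \<epsilon> * cmod (z - 1)"
  shows "((\<lambda>r. deriv G (of_real r)) \<longlongrightarrow> v) (at_left (1::real))"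
proof -
  define H where "H = (\<lambda>z. G z - G 1 - v * (z - 1))"
  have contH: "continuous_on (cball 0 1) H" and holH: "H holomorphic_on ball 0 1"
    unfolding H_def by (intro continuous_intros cont holomorphic_intros hol)+
  have derivH: "deriv H w = deriv G w - v" if "cmod w < 1" for w
  proof -
    have "(G has_field_derivative deriv G w) (at w)"
      using holomorphic_derivI[OF hol open_ball, of w] that by auto
    then show ?thesis
      unfolding H_def by (intro DERIV_imp_deriv) (auto intro!: derivative_eq_intros)
  qed
  obtain B where B: "\<And>z. cmod z = 1 \<Longrightarrow> cmod (H z) \<le> B"
  proof -
    have "compact (H ` sphere 0 1)"
      by (intro compact_continuous_image continuous_on_subset[OF contH]) auto
    then show ?thesis
      using that compact_imp_bounded bounded_iff by (metis image_eqI mem_sphere_0)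
  qed
  show ?thesis
  proof (rule tendstoI)
    fix e :: real assume e: "e > 0"
    obtain \<delta> where \<delta>: "\<delta> > 0" "\<And>z. cmod z = 1 \<Longrightarrow> cmod (z - 1) < \<delta> \<Longrightarrow> cmod (H z) \<le> (e / 16) * cmod (z - 1)"
      using tang[of "e / 16"] e unfolding H_def by auto
    have "((\<lambda>r. 8 * (e / 16) + (64 * B / \<delta> ^ 4) * (1 - r\<^sup>2)) \<longlongrightarrow> 8 * (e / 16) + (64 * B / \<delta> ^ 4) * (1 - 1\<^sup>2)) (at_left 1)"
      by (intro tendsto_intros)
    then have "\<forall>\<^sub>F r in at_left 1. 8 * (e / 16) + (64 * B / \<delta> ^ 4) * (1 - r\<^sup>2) < e"
      by (rule order_tendstoD) (use e in simp)
    moreover note eventually_radius_in_unit_interval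
    ultimately show "\<forall>\<^sub>F r in at_left (1::real). dist (deriv G (of_real r)) v < e"
    proof eventually_elim
      case (elim r)
      have "cmod (deriv H (of_real r)) \<le> 8 * (e / 16) + (64 * B / \<delta> ^ 4) * (1 - r\<^sup>2)"
        by (rule radial_derivative_bound[OF contH holH B \<delta>(2) \<delta>(1)]) (use e elim in auto)
      with elim show ?case by (simp add: dist_norm derivH)
    qed
  qed
qed

section \<open>Boundary values of dilations\<close>

text \<open>
  A primitive of a bounded function is Lipschitz, hence extends continuously to the closed disc. Radial
  limits of \<open>g\<close> will be found where this extension is differentiable along the circle.
\<close>

lemma bounded_holomorphic_primitive:
  assumes "bdd_hol g"
  obtains G where "continuous_on (cball 0 1) G"
    "\<And>z. cmod z < 1 \<Longrightarrow> (G has_field_derivative g z) (at z)"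
proof -
  obtain K where K: "K > 0" "\<And>z. cmod z < 1 \<Longrightarrow> cmod (g z) \<le> K"
    using bdd_holE[OF assms] by blast
  obtain G where G: "\<And>z. z \<in> ball 0 1 \<Longrightarrow> (G has_field_derivative g z) (at z within ball 0 1)"
    using holomorphic_convex_primitive'[of "ball 0 1" g] assms by (auto simp: bdd_hol_def)
  have lip: "cmod (G z - G w) \<le> K * cmod (z - w)" if "z \<in> ball 0 1" "w \<in> ball 0 1" for z w
    by (rule field_differentiable_bound[OF convex_ball G]) (use K that in auto)
  have "uniformly_continuous_on (ball 0 1) G"
    unfolding uniformly_continuous_on_def
  proof (intro allI impI)
    fix e :: real assume e: "e > 0"
    have "dist (G w) (G z) < e" if "z \<in> ball 0 1" "w \<in> ball 0 1" "dist w z < e / K" for z w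
    proof -
      have "K * cmod (w - z) < K * (e / K)"
        using that(3) K(1) by (intro mult_strict_left_mono) (auto simp: dist_norm)
      then show ?thesis using lip[OF that(2,1)] K(1) by (simp add: dist_norm)
    qed
    moreover have "e / K > 0" using e K by simp
    ultimately show "\<exists>d>0. \<forall>z\<in>ball 0 1. \<forall>w\<in>ball 0 1. dist w z < d \<longrightarrow> dist (G w) (G z) < e"
      by blast
  qed
  then obtain H where H: "uniformly_continuous_on (closure (ball 0 1)) H" "\<And>z. z \<in> ball 0 1 \<Longrightarrow> G z = H z"
    by (rule uniformly_continuous_on_extension_on_closure) blast
  show thesis
  proof (rule that)
    show "continuous_on (cball 0 1) H"
      using uniformly_continuous_imp_continuous[OF H(1)] by simp
    show "(H has_field_derivative g z) (at z)" if "cmod z < 1" for z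
    proof (rule has_field_derivative_transform_within_open[where S = "ball 0 1"])
      show "(G has_field_derivative g z) (at z)"
        using G[of z] that at_within_open[of z "ball 0 1"] by simp
    qed (use that H in auto)
  qed
qed

lemma dilations_L2_tendsto:
  assumes "bdd_hol g"
  shows "((\<lambda>r. \<Sum>n. (cmod (taylor_coeff g n))\<^sup>2 * (1 - r ^ n)\<^sup>2) \<longlongrightarrow> 0) (at_left (1::real))"
proof -
  note ev = eventually_radius_in_unit_interval
  have "((\<lambda>r. \<Sum>n. (cmod (taylor_coeff g n))\<^sup>2 * (1 - r ^ n)\<^sup>2) \<longlongrightarrow> (\<Sum>n::nat. 0)) (at_left (1::real))"
  proof (rule tannerys_theorem[THEN conjunct2, THEN conjunct2])
    show "summable (\<lambda>n. (cmod (taylor_coeff g n))\<^sup>2)"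
      by (rule summable_taylor_square[OF assms])
    show "((\<lambda>r. (cmod (taylor_coeff g n))\<^sup>2 * (1 - r ^ n)\<^sup>2) \<longlongrightarrow> 0) (at_left (1::real))" for n
      by (rule tendsto_eq_rhs, (rule tendsto_intros)+) simp
    have "\<forall>\<^sub>F (k, r) in at_top \<times>\<^sub>F at_left (1::real). r \<in> {0<..<1}"
      using eventually_prodI[OF always_eventually[of "\<lambda>_. True"] ev, of at_top]
      by (auto simp: case_prod_unfold)
    then show "\<forall>\<^sub>F (k, r) in at_top \<times>\<^sub>F at_left (1::real).
        norm ((cmod (taylor_coeff g k))\<^sup>2 * (1 - r ^ k)\<^sup>2) \<le> (cmod (taylor_coeff g k))\<^sup>2"
      by eventually_elim
         (auto simp: power_le_one abs_mult intro!: mult_left_le power_le_one)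
  qed auto
  then show ?thesis by simp
qed

text \<open>
  Dilations \<open>g (r z)\<close> converge in mean square as \<open>r \<rightarrow> 1\<close>. Along a sequence for which the distances decay
  geometrically, the successive differences are almost everywhere summable.
\<close>

theorem radial_subsequence_converges_AE:
  assumes g: "bdd_hol g"
  obtains r :: "nat \<Rightarrow> real" where "\<And>k. 0 < r k" "\<And>k. r k < 1" "r \<longlonglongrightarrow> 1"
    "AE t in angle_measure. convergent (\<lambda>k. g (of_real (r k) * cis t))"
proof -
  let ?a = "\<lambda>n. (cmod (taylor_coeff g n))\<^sup>2"
  have ev: "\<forall>\<^sub>F r in at_left (1::real). r \<in> {1 - d<..<1}" if "d > 0" for d
    using that by (intro eventually_at_leftI[of "1 - d"]) auto
  have "\<exists>r::real. 1 - 1 / (real k + 1) < r \<and> r < 1 \<and> (\<Sum>n. ?a n * (1 - r ^ n)\<^sup>2) < 1 / 8 ^ k" (is "\<exists>r. ?P k r") for k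
  proof -
    have "\<forall>\<^sub>F r in at_left (1::real). (\<Sum>n. ?a n * (1 - r ^ n)\<^sup>2) < 1 / 8 ^ k"
      by (rule order_tendstoD[OF dilations_L2_tendsto[OF g]]) simp
    with ev[of "1 / (real k + 1)"] have "\<forall>\<^sub>F r in at_left (1::real).
        1 - 1 / (real k + 1) < r \<and> r < 1 \<and> (\<Sum>n. ?a n * (1 - r ^ n)\<^sup>2) < 1 / 8 ^ k"
      by (simp add: eventually_conj_iff)
    then show ?thesis
      using eventually_happens trivial_limit_at_left_real by blast
  qed
  then have "\<exists>r. \<forall>k. ?P k (r k)"
    by (intro choice allI)
  then obtain r where r: "\<And>k. 1 - 1 / (real k + 1) < r k" "\<And>k. r k < 1"
      "\<And>k. (\<Sum>n. ?a n * (1 - r k ^ n)\<^sup>2) < 1 / 8 ^ k"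
    by blast
  have r0: "0 < r k" for k
  proof -
    have "1 / (real k + 1) \<le> 1" by simp
    with r(1)[of k] show ?thesis by linarith
  qed
  have lim: "r \<longlonglongrightarrow> 1"
  proof (rule tendsto_sandwich)
    show "(\<lambda>k. 1 - 1 / (real k + 1)) \<longlonglongrightarrow> 1" by real_asymp
  qed (use r in \<open>auto intro!: always_eventually less_imp_le\<close>)
  define D where "D = (\<lambda>k t. g (of_real (r (Suc k)) * cis t) - g (of_real (r k) * cis t))"
  have contg: "continuous_on UNIV (\<lambda>t. g (of_real (r k) * cis t))" for k
    by (intro continuous_on_circle bdd_hol_holomorphic g) (use r0 r in \<open>auto intro: less_imp_le\<close>)
  have contD: "continuous_on UNIV (D k)" for k
    unfolding D_def by (intro continuous_intros contg)
  obtain K where K: "K > 0" "\<And>z. cmod z < 1 \<Longrightarrow> cmod (g z) \<le> K"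
    using bdd_holE[OF g] by blast
  have bg: "cmod (g (of_real (r k) * cis t)) \<le> K" for k t
    using r0[of k] r(2)[of k] by (intro K) (simp add: norm_mult)
  have bD: "cmod (D k t) \<le> 2 * K" for k t
    unfolding D_def using norm_triangle_ineq4 bg by (smt (verit))
  have intD: "integrable angle_measure (\<lambda>t. cmod (D k t))" for k
    using contD bD by (intro integrable_angle_measure[of _ "2 * K"] continuous_intros) auto
  have intD2: "integrable angle_measure (\<lambda>t. (cmod (D k t))\<^sup>2)" for k
  proof (rule integrable_angle_measure[of _ "(2 * K)\<^sup>2"])
    show "norm ((cmod (D k t))\<^sup>2) \<le> (2 * K)\<^sup>2" for t
      using power_mono[OF bD[of k t], of 2] by simp
  qed (intro continuous_intros contD)
  have L2: "(LINT t|angle_measure. (cmod (D k t))\<^sup>2) \<le> 4 / 8 ^ k" for k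
  proof -
    \<comment> \<open>The coefficients of the difference, to which the Parseval identity applies on the unit circle itself.\<close>
    define c where "c = (\<lambda>n. taylor_coeff g n * (of_real (r (Suc k)) ^ n - of_real (r k) ^ n))"
    have s: "summable (\<lambda>n. cmod (taylor_coeff g n * of_real (r k) ^ n))" for k
      by (intro taylor_summable bdd_hol_holomorphic g less_imp_le r0 r)
    have "summable (\<lambda>n. cmod (taylor_coeff g n * of_real (r (Suc k)) ^ n) + cmod (taylor_coeff g n * of_real (r k) ^ n))"
      by (intro summable_add s)
    then have c: "summable (\<lambda>n. cmod (c n))"
      by (rule summable_comparison_test[rotated])
         (auto simp: c_def right_diff_distrib intro!: norm_triangle_ineq4)
    have D: "D k t = (\<Sum>n. c n * cis t ^ n)" for t
    proof -
      have "(\<lambda>n. taylor_coeff g n * (of_real (r k) * cis t) ^ n) sums g (of_real (r k) * cis t)" for k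
        using r0[of k] r(2)[of k] by (intro taylor_sums bdd_hol_holomorphic g) (simp add: norm_mult)
      from sums_diff[OF this[of "Suc k"] this[of k]]
      show ?thesis
        by (simp add: D_def c_def sums_iff power_mult_distrib algebra_simps)
    qed
    have "(\<lambda>n. c n * cnj (c n)) sums (LINT t|angle_measure. D k t * cnj (D k t))"
      using parseval_cis_series[OF c c] by (simp only: D)
    then have "(\<lambda>n. complex_of_real ((cmod (c n))\<^sup>2)) sums (LINT t|angle_measure. complex_of_real ((cmod (D k t))\<^sup>2))"
      by (simp only: complex_norm_square)
    then have sums: "(\<lambda>n. (cmod (c n))\<^sup>2) sums (LINT t|angle_measure. (cmod (D k t))\<^sup>2)"
      by (simp only: integral_complex_of_real sums_of_real_iff)
    define p where "p = (\<lambda>k n. ?a n * (1 - r k ^ n)\<^sup>2)"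
    have ps: "summable (p k)" for k
      unfolding p_def using r0[of k] r(2)[of k]
      by (intro summable_comparison_test[OF _ summable_taylor_square[OF g]])
         (auto simp: abs_mult power_le_one intro!: mult_left_le power_le_one)
    have "(cmod (c n))\<^sup>2 \<le> 2 * p (Suc k) n + 2 * p k n" for n
    proof -
      have "(x - y)\<^sup>2 \<le> 2 * (1 - x)\<^sup>2 + 2 * (1 - y)\<^sup>2" for x y :: real
        using zero_le_power2[of "(1 - x) + (1 - y)"] by (simp add: power2_eq_square algebra_simps)
      then have "?a n * (r (Suc k) ^ n - r k ^ n)\<^sup>2 \<le> ?a n * (2 * (1 - r (Suc k) ^ n)\<^sup>2 + 2 * (1 - r k ^ n)\<^sup>2)"
        by (intro mult_left_mono) auto
      moreover have "(cmod (c n))\<^sup>2 = ?a n * (r (Suc k) ^ n - r k ^ n)\<^sup>2"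
      proof -
        have "c n = taylor_coeff g n * of_real (r (Suc k) ^ n - r k ^ n)" by (simp add: c_def)
        then show ?thesis by (simp only: norm_mult norm_of_real power_mult_distrib power2_abs)
      qed
      ultimately show ?thesis by (simp add: p_def algebra_simps)
    qed
    then have "(LINT t|angle_measure. (cmod (D k t))\<^sup>2) \<le> (\<Sum>n. 2 * p (Suc k) n + 2 * p k n)"
      by (rule sums_le[OF _ sums summable_sums]) (intro summable_add summable_mult ps)
    also have "\<dots> = 2 * (\<Sum>n. p (Suc k) n) + 2 * (\<Sum>n. p k n)"
      by (simp add: suminf_add[symmetric] suminf_mult[symmetric] ps summable_mult)
    also have "\<dots> \<le> 2 * (1 / 8 ^ Suc k) + 2 * (1 / 8 ^ k)"
      using r(3)[of k] r(3)[of "Suc k"] unfolding p_def by linarith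
    also have "\<dots> \<le> 4 / 8 ^ k" by (simp add: field_simps)
    finally show ?thesis .
  qed
  \<comment> \<open>The arithmetic-geometric mean inequality turns the quadratic bound into a linear one.\<close>
  have L1: "(LINT t|angle_measure. cmod (D k t)) \<le> 5 * (1 / 2) ^ k" for k
  proof -
    have "x \<le> (1/2) ^ k + 2 ^ k * x\<^sup>2" if "0 \<le> x" for x :: real
    proof -
      have "2 ^ k * (x - (1/2) ^ k)\<^sup>2 \<ge> 0" by simp
      moreover have "2 ^ k * (x - (1/2) ^ k)\<^sup>2 = 2 ^ k * x\<^sup>2 - 2 * x + (1/2) ^ k"
        by (simp add: power2_eq_square field_simps)
      ultimately show ?thesis using that by linarith
    qed
    then have "(LINT t|angle_measure. cmod (D k t)) \<le> (LINT t|angle_measure. (1/2) ^ k + 2 ^ k * (cmod (D k t))\<^sup>2)"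
      using intD intD2 by (intro integral_mono Bochner_Integration.integrable_add integrable_mult_right) auto
    also have "\<dots> = (1/2) ^ k + 2 ^ k * (LINT t|angle_measure. (cmod (D k t))\<^sup>2)"
      using intD2[of k] angle.prob_space by (subst Bochner_Integration.integral_add) auto
    also have "\<dots> \<le> (1/2) ^ k + 2 ^ k * (4 / 8 ^ k)"
      using L2[of k] by (intro add_left_mono mult_left_mono) auto
    also have "2 ^ k * (4 / 8 ^ k) = 4 * (1/2) ^ k * (1/2 :: real) ^ k"
    proof -
      have "(8::real) ^ k = 2 ^ k * 2 ^ k * 2 ^ k" by (simp flip: power_mult_distrib)
      then show ?thesis by (simp add: field_simps)
    qed
    also have "\<dots> \<le> 4 * (1/2) ^ k * 1" by (intro mult_left_mono) (auto simp: power_le_one)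
    finally show ?thesis by simp
  qed
  have "(\<integral>\<^sup>+t. (\<Sum>k. ennreal (cmod (D k t))) \<partial>angle_measure) = (\<Sum>k. \<integral>\<^sup>+t. ennreal (cmod (D k t)) \<partial>angle_measure)"
    using intD by (intro nn_integral_suminf) auto
  also have "\<dots> = (\<Sum>k. ennreal (LINT t|angle_measure. cmod (D k t)))"
    by (intro suminf_cong nn_integral_eq_integral intD) auto
  also have "\<dots> \<noteq> top"
  proof (rule ennreal_suminf_neq_top)
    show "summable (\<lambda>k. LINT t|angle_measure. cmod (D k t))"
    proof (rule summable_comparison_test)
      show "summable (\<lambda>k. 5 * (1 / 2 :: real) ^ k)" by (intro summable_mult summable_geometric) auto
      show "\<exists>N. \<forall>k\<ge>N. norm (LINT t|angle_measure. cmod (D k t)) \<le> 5 * (1 / 2) ^ k"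
        using L1 by (auto simp: integral_nonneg_AE)
    qed
  qed (auto intro: integral_nonneg_AE)
  finally have fin: "(\<integral>\<^sup>+t. (\<Sum>k. ennreal (cmod (D k t))) \<partial>angle_measure) \<noteq> \<infinity>" by simp
  have "AE t in angle_measure. (\<Sum>k. ennreal (cmod (D k t))) \<noteq> \<infinity>"
    using intD by (intro nn_integral_PInf_AE fin borel_measurable_suminf) auto
  then have "AE t in angle_measure. convergent (\<lambda>k. g (of_real (r k) * cis t))"
  proof eventually_elim
    case (elim t)
    then have "summable (\<lambda>k. cmod (D k t))"
      by (intro summable_suminf_not_top) auto
    then have "summable (\<lambda>k. D k t)" by (rule summable_norm_cancel)
    then have "convergent (\<lambda>n. \<Sum>k<n. D k t)" by (simp add: summable_iff_convergent)
    then have "convergent (\<lambda>n. (\<Sum>k<n. D k t) + g (of_real (r 0) * cis t))"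
      by (intro convergent_add convergent_const)
    moreover have "(\<Sum>k<n. D k t) + g (of_real (r 0) * cis t) = g (of_real (r n) * cis t)" for n
      unfolding D_def by (subst sum_lessThan_telescope[of "\<lambda>k. g (of_real (r k) * cis t)" n]) simp
    ultimately show ?case by simp
  qed
  with r0 r(2) lim show thesis by (rule that)
qed

section \<open>Existence of radial limits of bounded holomorphic functions\<close>

lemma has_vector_derivative_cis: "(cis has_vector_derivative \<i> * cis t) (at t)"
proof -
  have "((\<lambda>z. exp (\<i> * z)) has_field_derivative \<i> * exp (\<i> * of_real t)) (at (of_real t))"
    by (auto intro!: derivative_eq_intros)
  from has_vector_derivative_real_field[OF this, of UNIV] show ?thesis
    by (simp add: cis_conv_exp[abs_def])
qed

text \<open>
  The derivative of \<open>G\<close> along the circle of radius \<open>r\<close> is \<open>\<i> r cis t g (r cis t)\<close>. Along the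
  sequence of radii found above it converges almost everywhere and boundedly, and its limit is a
  density of the boundary function of \<open>G\<close>.
\<close>

lemma boundary_derivative_density:
  assumes g: "bdd_hol g" and contG: "continuous_on (cball 0 1) G"
    and G: "\<And>z. cmod z < 1 \<Longrightarrow> (G has_field_derivative g z) (at z)"
  obtains k :: "real \<Rightarrow> complex" where "\<And>a b. k integrable_on cbox a b"
    "\<And>a b. 0 \<le> a \<Longrightarrow> a \<le> b \<Longrightarrow> b \<le> 2 * pi \<Longrightarrow> G (cis b) - G (cis a) = integral {a..b} k"
proof -
  obtain r where r: "\<And>k. 0 < r k" "\<And>k. r k < 1" "r \<longlonglongrightarrow> 1"
    and AE: "AE t in angle_measure. convergent (\<lambda>k. g (of_real (r k) * cis t))"
    using radial_subsequence_converges_AE[OF g] by blast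
  obtain K where K: "K > 0" "\<And>z. cmod z < 1 \<Longrightarrow> cmod (g z) \<le> K"
    using bdd_holE[OF g] by blast
  have "AE t in lborel. t \<in> {0..<2 * pi} \<longrightarrow> convergent (\<lambda>k. g (of_real (r k) * cis t))"
    using AE unfolding angle_measure_def by (subst (asm) AE_uniform_measure) auto
  then obtain N0 where N0: "{t. \<not> (t \<in> {0..<2 * pi} \<longrightarrow> convergent (\<lambda>k. g (of_real (r k) * cis t)))} \<subseteq> N0"
      "emeasure lborel N0 = 0" "N0 \<in> sets lborel"
    by (rule AE_E) (simp add: subset_eq)
  then have "N0 \<in> null_sets lborel" by auto
  then have "negligible N0"
    by (simp add: negligible_iff_null_sets null_sets_completionI)
  define N where "N = insert (2 * pi) N0"
  have N: "negligible N" using \<open>negligible N0\<close> by (simp add: N_def)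
  have conv: "convergent (\<lambda>k. g (of_real (r k) * cis t))" if "t \<in> {0..2 * pi} - N" for t
    using that N0(1) by (auto simp: N_def)
  define X where "X = (\<lambda>k t. if t \<in> {0..2 * pi} - N then g (of_real (r k) * cis t) * (\<i> * of_real (r k) * cis t) else 0)"
  define kf where "kf = (\<lambda>t. if t \<in> {0..2 * pi} - N then lim (\<lambda>k. g (of_real (r k) * cis t)) * (\<i> * cis t) else 0)"
  have int: "(kf has_integral (G (cis b) - G (cis a))) {a..b}"
    if ab: "0 \<le> a" "a \<le> b" "b \<le> 2 * pi" for a b
  proof (rule has_integral_dominated_convergence)
    fix k
    have "((\<lambda>t. of_real (r k) * (\<i> * cis t) * g (of_real (r k) * cis t)) has_integral
        (G (of_real (r k) * cis b) - G (of_real (r k) * cis a))) {a..b}"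
    proof (rule fundamental_theorem_of_calculus[OF ab(2)])
      fix t
      have "((\<lambda>t. of_real (r k) * cis t) has_vector_derivative of_real (r k) * (\<i> * cis t)) (at t)"
        by (intro has_vector_derivative_mult_right has_vector_derivative_cis)
      moreover have "(G has_field_derivative g (of_real (r k) * cis t)) (at (of_real (r k) * cis t))"
        using r(1)[of k] r(2)[of k] by (intro G) (simp add: norm_mult)
      ultimately have "((G \<circ> (\<lambda>t. of_real (r k) * cis t)) has_vector_derivative
          of_real (r k) * (\<i> * cis t) * g (of_real (r k) * cis t)) (at t)"
        by (rule field_vector_diff_chain_at)
      then show "((\<lambda>t. G (of_real (r k) * cis t)) has_vector_derivative
          of_real (r k) * (\<i> * cis t) * g (of_real (r k) * cis t)) (at t within {a..b})"
        unfolding o_def by (rule has_vector_derivative_at_within)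
    qed
    then show "(X k has_integral (G (of_real (r k) * cis b) - G (of_real (r k) * cis a))) {a..b}"
      by (rule has_integral_spike[OF N, rotated]) (use ab in \<open>auto simp: X_def mult_ac\<close>)
    show "\<forall>t\<in>{a..b}. norm (X k t) \<le> K"
    proof
      fix t
      have "cmod (g (of_real (r k) * cis t)) \<le> K"
        using r(1)[of k] r(2)[of k] by (intro K) (simp add: norm_mult)
      then have "cmod (g (of_real (r k) * cis t)) * r k \<le> K * 1"
        using r(1)[of k] r(2)[of k] K(1) by (intro mult_mono) auto
      then show "norm (X k t) \<le> K"
        using r(1)[of k] K(1) by (simp add: X_def norm_mult)
    qed
  next
    show "\<forall>t\<in>{a..b}. (\<lambda>k. X k t) \<longlonglongrightarrow> kf t"
    proof
      fix t
      show "(\<lambda>k. X k t) \<longlonglongrightarrow> kf t"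
      proof (cases "t \<in> {0..2 * pi} - N")
        case True
        have "(\<lambda>k. g (of_real (r k) * cis t) * (\<i> * of_real (r k) * cis t)) \<longlonglongrightarrow>
            lim (\<lambda>k. g (of_real (r k) * cis t)) * (\<i> * of_real 1 * cis t)"
          using conv[OF True] by (intro tendsto_intros r(3)) (simp add: convergent_LIMSEQ_iff)
        with True show ?thesis by (simp add: X_def kf_def)
      qed (simp only: X_def kf_def if_False tendsto_const)
    qed
    have "(\<lambda>k. G (of_real (r k) * cis t)) \<longlonglongrightarrow> G (cis t)" for t
    proof (rule continuous_on_tendsto_compose[OF contG])
      show "(\<lambda>k. of_real (r k) * cis t) \<longlonglongrightarrow> cis t"
        by (rule tendsto_eq_rhs, (rule tendsto_intros r(3))+) simp
      show "\<forall>\<^sub>F k in sequentially. of_real (r k) * cis t \<in> cball 0 1"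
        using r(1,2) by (intro always_eventually allI) (simp add: norm_mult less_imp_le)
    qed simp
    then show "(\<lambda>k. G (of_real (r k) * cis b) - G (of_real (r k) * cis a)) \<longlonglongrightarrow> G (cis b) - G (cis a)"
      by (intro tendsto_diff)
  qed (rule integrable_const_ivl)
  have "kf integrable_on UNIV"
  proof -
    have "((\<lambda>t. if t \<in> {0..2 * pi} then kf t else 0) has_integral (G (cis (2 * pi)) - G (cis 0))) UNIV"
      using int[of 0 "2 * pi"] by (subst has_integral_restrict_UNIV) auto
    moreover have "(\<lambda>t. if t \<in> {0..2 * pi} then kf t else 0) = kf"
      by (auto simp: kf_def)
    ultimately show ?thesis by (metis has_integral_integrable)
  qed
  then have "kf integrable_on cbox a b" for a b
    by (rule integrable_on_subcbox) simp
  moreover have "G (cis b) - G (cis a) = integral {a..b} kf" if "0 \<le> a" "a \<le> b" "b \<le> 2 * pi" for a b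
    using int[OF that] by (simp add: integral_unique)
  ultimately show thesis by (rule that)
qed

lemma lebesgue_differentiation_one_sided:
  fixes k :: "real \<Rightarrow> complex"
  assumes "\<And>a b. k integrable_on cbox a b"
  obtains N where "negligible N"
    "\<And>t e. t \<notin> N \<Longrightarrow> e > 0 \<Longrightarrow>
       \<exists>d>0. \<forall>s. 0 < s \<and> s < d \<longrightarrow> norm (integral {t..t + s} k - s *\<^sub>R k t) \<le> e * s"
proof -
  obtain N where N: "negligible N" "\<And>t e. t \<notin> N \<Longrightarrow> 0 < e \<Longrightarrow>
      \<exists>d>0. \<forall>h. 0 < h \<and> h < d \<longrightarrow>
        norm (integral (cbox t (t + h *\<^sub>R One)) k /\<^sub>R h ^ DIM(real) - k t) < e"
    using integrable_ccontinuous_explicit[OF assms] by blast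
  have le: "norm (integral {t..t + s} k - s *\<^sub>R k t) \<le> e * s"
    if s: "0 < s" "norm (integral (cbox t (t + s *\<^sub>R One)) k /\<^sub>R s ^ DIM(real) - k t) < e" for t e s
  proof -
    have "integral {t..t + s} k - s *\<^sub>R k t = s *\<^sub>R (integral (cbox t (t + s *\<^sub>R One)) k /\<^sub>R s ^ DIM(real) - k t)"
      using s(1) by (simp add: algebra_simps)
    also have "norm \<dots> = s * norm (integral (cbox t (t + s *\<^sub>R One)) k /\<^sub>R s ^ DIM(real) - k t)"
      using s(1) by (simp only: norm_scaleR abs_of_pos)
    also have "\<dots> \<le> s * e" using s by (intro mult_left_mono) auto
    finally show ?thesis by (simp add: mult.commute)
  qed
  show thesis
  proof (rule that[OF N(1)])
    fix t e :: real assume "t \<notin> N" "e > 0"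
    from N(2)[OF this] obtain d where d: "d > 0" "\<And>h. 0 < h \<Longrightarrow> h < d \<Longrightarrow>
        norm (integral (cbox t (t + h *\<^sub>R One)) k /\<^sub>R h ^ DIM(real) - k t) < e"
      by blast
    have "norm (integral {t..t + s} k - s *\<^sub>R k t) \<le> e * s" if "0 < s" "s < d" for s
      by (rule le[OF that(1) d(2)[OF that]])
    with d(1) show "\<exists>d>0. \<forall>s. 0 < s \<and> s < d \<longrightarrow> norm (integral {t..t + s} k - s *\<^sub>R k t) \<le> e * s"
      by blast
  qed
qed

text \<open>
  The left-hand averages of \<open>k\<close> are right-hand averages of the reflected function.
\<close>

lemma lebesgue_differentiation_two_sided:
  fixes k :: "real \<Rightarrow> complex"
  assumes k: "\<And>a b. k integrable_on cbox a b"
  obtains N where "negligible N"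
    "\<And>t e. t \<notin> N \<Longrightarrow> e > 0 \<Longrightarrow>
       \<exists>d>0. \<forall>s. 0 < s \<and> s < d \<longrightarrow> norm (integral {t..t + s} k - s *\<^sub>R k t) \<le> e * s \<and>
         norm (integral {t - s..t} k - s *\<^sub>R k t) \<le> e * s"
proof -
  obtain N1 where N1: "negligible N1"
    "\<And>t e. t \<notin> N1 \<Longrightarrow> e > 0 \<Longrightarrow>
       \<exists>d>0. \<forall>s. 0 < s \<and> s < d \<longrightarrow> norm (integral {t..t + s} k - s *\<^sub>R k t) \<le> e * s"
    using lebesgue_differentiation_one_sided[OF k] by blast
  have "(\<lambda>x. k (- x)) integrable_on cbox a b" for a b
    using k[of "-b" "-a"] Henstock_Kurzweil_Integration.integrable_reflect_real[of k "-a" "-b"] by simp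
  then obtain N2 where N2: "negligible N2"
    "\<And>t e. t \<notin> N2 \<Longrightarrow> e > 0 \<Longrightarrow>
       \<exists>d>0. \<forall>s. 0 < s \<and> s < d \<longrightarrow> norm (integral {t..t + s} (\<lambda>x. k (- x)) - s *\<^sub>R k (- t)) \<le> e * s"
    using lebesgue_differentiation_one_sided[of "\<lambda>x. k (- x)"] by blast
  show thesis
  proof (rule that[of "N1 \<union> uminus ` N2"])
    have "negligible (uminus ` N2)"
      by (rule negligible_differentiable_image_negligible[OF order_refl N2(1)])
         (auto simp: differentiable_on_def intro!: derivative_intros)
    with N1 show "negligible (N1 \<union> uminus ` N2)" by simp
    fix t e :: real assume t: "t \<notin> N1 \<union> uminus ` N2" and e: "e > 0"
    then have "t \<notin> N1" "- t \<notin> N2" by (auto simp: image_iff)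
    obtain d1 where d1: "d1 > 0" "\<And>s. 0 < s \<Longrightarrow> s < d1 \<Longrightarrow> norm (integral {t..t + s} k - s *\<^sub>R k t) \<le> e * s"
      using N1(2)[OF \<open>t \<notin> N1\<close> e] by blast
    obtain d2 where d2: "d2 > 0" "\<And>s. 0 < s \<Longrightarrow> s < d2 \<Longrightarrow>
        norm (integral {- t..- t + s} (\<lambda>x. k (- x)) - s *\<^sub>R k t) \<le> e * s"
      using N2(2)[OF \<open>- t \<notin> N2\<close> e] by (auto simp only: minus_minus)
    have "integral {- t..- t + s} (\<lambda>x. k (- x)) = integral {t - s..t} k" for s
      using Henstock_Kurzweil_Integration.integral_reflect_real[of t "t - s" k] by simp
    with d1 d2 show "\<exists>d>0. \<forall>s. 0 < s \<and> s < d \<longrightarrow> norm (integral {t..t + s} k - s *\<^sub>R k t) \<le> e * s \<and>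
         norm (integral {t - s..t} k - s *\<^sub>R k t) \<le> e * s"
      by (intro exI[of _ "min d1 d2"]) auto
  qed
qed

lemma cis_linear_approx:
  assumes "e > 0"
  obtains d where "d > 0" "\<And>s. \<bar>s\<bar> < d \<Longrightarrow> cmod (cis s - 1 - \<i> * of_real s) \<le> e * \<bar>s\<bar>"
proof -
  have "(cis has_derivative (\<lambda>x. x *\<^sub>R (\<i> * cis 0))) (at 0)"
    using has_vector_derivative_cis[of 0] by (simp only: has_vector_derivative_def)
  then obtain d where "d > 0" "\<And>y. norm (y - 0) < d \<Longrightarrow> norm (cis y - cis 0 - (y - 0) *\<^sub>R (\<i> * cis 0)) \<le> e * norm (y - 0)"
    unfolding has_derivative_at_alt using assms by blast
  then show thesis by (intro that[of d]) (auto simp: scaleR_conv_of_real mult.commute)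
qed

text \<open>
  Rotate \<open>cis t\<close> to 1. Differentiability in the angle becomes the tangential condition in the chord
  \<open>z - 1\<close>, because \<open>z = cis s\<close> satisfies \<open>z - 1 = \<i> s\<close> up to an error that is small compared with \<open>s\<close>.
\<close>

lemma radial_limit_at_differentiability_point:
  assumes g: "bdd_hol g" and contG: "continuous_on (cball 0 1) G"
    and G: "\<And>z. cmod z < 1 \<Longrightarrow> (G has_field_derivative g z) (at z)"
    and diff: "\<And>e. e > 0 \<Longrightarrow> \<exists>d>0. \<forall>s. \<bar>s\<bar> < d \<longrightarrow>
       cmod (G (cis (t + s)) - G (cis t) - of_real s * v) \<le> e * \<bar>s\<bar>"
  shows "\<exists>w. ((\<lambda>r. g (of_real r * cis t)) \<longlongrightarrow> w) (at_left 1)"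
proof -
  define G0 where "G0 = (\<lambda>w. G (cis t * w))"
  have contG0: "continuous_on (cball 0 1) G0"
    unfolding G0_def
    by (rule continuous_on_compose2[OF contG]) (auto intro!: continuous_intros simp: norm_mult)
  have dG0: "(G0 has_field_derivative cis t * g (cis t * w)) (at w)" if "cmod w < 1" for w
  proof -
    have "((\<lambda>w. cis t * w) has_field_derivative cis t) (at w)"
      by (auto intro!: derivative_eq_intros)
    moreover have "(G has_field_derivative g (cis t * w)) (at (cis t * w))"
      using that by (intro G) (simp add: norm_mult)
    ultimately show ?thesis unfolding G0_def
      using DERIV_chain2[of G "g (cis t * w)" "\<lambda>w. cis t * w" w "cis t"] by (simp add: mult.commute)
  qed
  have holG0: "G0 holomorphic_on ball 0 1"
    unfolding holomorphic_on_def field_differentiable_def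
    by (intro ballI exI, rule has_field_derivative_at_within[OF dG0]) simp
  have "((\<lambda>r. deriv G0 (of_real r)) \<longlongrightarrow> v / \<i>) (at_left (1::real))"
  proof (rule radial_limit_of_tangential_derivative[OF contG0 holG0])
    fix \<epsilon> :: real assume \<epsilon>: "\<epsilon> > 0"
    define e where "e = \<epsilon> / 4"
    \<comment> \<open>The bound 1/2 gives \<open>|s| \<le> 2 |z - 1|\<close>; the other bound absorbs the slope \<open>v\<close>.\<close>
    define e' where "e' = min (1/2) (\<epsilon> / (4 * (cmod v + 1)))"
    have e: "e > 0" using \<epsilon> by (simp add: e_def)
    have e': "e' > 0" "e' \<le> 1/2" "cmod v * e' \<le> \<epsilon> / 4"
    proof -
      have v: "0 < cmod v + 1" using norm_ge_zero[of v] by linarith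
      then show "e' > 0" using \<epsilon> by (simp add: e'_def)
      show "e' \<le> 1/2" unfolding e'_def by (rule min.cobounded1)
      have "cmod v * e' \<le> (cmod v + 1) * (\<epsilon> / (4 * (cmod v + 1)))"
        using \<open>e' > 0\<close> by (intro mult_mono) (auto simp: e'_def)
      also have "\<dots> = \<epsilon> / 4" using v by (simp add: field_simps)
      finally show "cmod v * e' \<le> \<epsilon> / 4" .
    qed
    obtain d1 where d1: "d1 > 0" "\<And>s. \<bar>s\<bar> < d1 \<Longrightarrow>
       cmod (G (cis (t + s)) - G (cis t) - of_real s * v) \<le> e * \<bar>s\<bar>"
      using diff[OF e] by blast
    obtain d2 where d2: "d2 > 0" "\<And>s. \<bar>s\<bar> < d2 \<Longrightarrow> cmod (cis s - 1 - \<i> * of_real s) \<le> e' * \<bar>s\<bar>"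
      using cis_linear_approx[OF e'(1)] by blast
    have "0 < min d1 d2" using d1(1) d2(1) by simp
    moreover have "continuous (at 1) Arg" by (rule continuous_at_Arg) auto
    ultimately obtain \<delta> where \<delta>: "\<delta> > 0" "\<And>z. dist z 1 < \<delta> \<Longrightarrow> dist (Arg z) (Arg 1) < min d1 d2"
      unfolding continuous_at_eps_delta by blast
    have "cmod (G0 z - G0 1 - v / \<i> * (z - 1)) \<le> \<epsilon> * cmod (z - 1)"
      if z: "cmod z = 1" "cmod (z - 1) < \<delta>" for z
    proof -
      define s where "s = Arg z"
      have zs: "z = cis s" using z(1) cis_Arg[of z] by (cases "z = 0") (auto simp: s_def sgn_eq)
      have s: "\<bar>s\<bar> < d1" "\<bar>s\<bar> < d2" using \<delta>(2)[of z] z(2) by (auto simp: s_def dist_norm)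
      have a: "cmod (z - 1 - \<i> * of_real s) \<le> e' * \<bar>s\<bar>" using d2(2)[OF s(2)] zs by simp
      have "\<bar>s\<bar> = cmod (\<i> * of_real s)" by (simp add: norm_mult)
      also have "\<dots> \<le> cmod (z - 1) + cmod (z - 1 - \<i> * of_real s)"
        using norm_triangle_ineq4[of "z - 1" "z - 1 - \<i> * of_real s"] by simp
      also have "\<dots> \<le> cmod (z - 1) + 1/2 * \<bar>s\<bar>"
        using a e'(2) mult_right_mono[OF e'(2), of "\<bar>s\<bar>"] by linarith
      finally have s2: "\<bar>s\<bar> \<le> 2 * cmod (z - 1)" by linarith
      have b: "cmod (v / \<i> * (z - 1 - \<i> * of_real s)) \<le> cmod v * (e' * \<bar>s\<bar>)"
        using mult_left_mono[OF a, of "cmod v"] by (simp add: norm_mult norm_divide)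
      have "G0 z - G0 1 - v / \<i> * (z - 1) =
          (G (cis (t + s)) - G (cis t) - of_real s * v) - v / \<i> * (z - 1 - \<i> * of_real s)"
        by (simp add: G0_def zs cis_mult algebra_simps)
      also have "cmod \<dots> \<le> e * \<bar>s\<bar> + cmod v * (e' * \<bar>s\<bar>)"
        by (rule order_trans[OF norm_triangle_ineq4 add_mono[OF d1(2)[OF s(1)] b]])
      also have "\<dots> \<le> \<epsilon> / 4 * \<bar>s\<bar> + \<epsilon> / 4 * \<bar>s\<bar>"
        using mult_right_mono[OF e'(3), of "\<bar>s\<bar>"] by (simp add: e_def mult.assoc)
      also have "\<dots> = \<epsilon> / 2 * \<bar>s\<bar>" by simp
      also have "\<dots> \<le> \<epsilon> / 2 * (2 * cmod (z - 1))" using s2 \<epsilon> by (intro mult_left_mono) auto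
      finally show ?thesis by simp
    qed
    with \<delta>(1) show "\<exists>\<delta>>0. \<forall>z. cmod z = 1 \<longrightarrow> cmod (z - 1) < \<delta> \<longrightarrow>
        cmod (G0 z - G0 1 - v / \<i> * (z - 1)) \<le> \<epsilon> * cmod (z - 1)" by blast
  qed
  then have "((\<lambda>r. cnj (cis t) * deriv G0 (of_real r)) \<longlongrightarrow> cnj (cis t) * (v / \<i>)) (at_left (1::real))"
    by (intro tendsto_intros)
  moreover have "\<forall>\<^sub>F r in at_left (1::real). cnj (cis t) * deriv G0 (of_real r) = g (of_real r * cis t)"
  proof -
    from eventually_radius_in_unit_interval
    show ?thesis
    proof eventually_elim
      case (elim r)
      then have "deriv G0 (of_real r) = cis t * g (cis t * of_real r)"
        by (intro DERIV_imp_deriv dG0) simp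
      moreover have "cnj (cis t) * cis t = 1" by (simp add: cis_cnj cis_mult)
      ultimately show ?case by (simp add: mult.assoc[symmetric] mult.commute[of "of_real r"])
    qed
  qed
  ultimately have "((\<lambda>r. g (of_real r * cis t)) \<longlongrightarrow> cnj (cis t) * (v / \<i>)) (at_left 1)"
    by (rule Lim_transform_eventually)
  then show ?thesis by blast
qed

text \<open>
  Fatou's theorem: a primitive of \<open>g\<close> is absolutely continuous on the circle, so by Lebesgue it is
  differentiable along the circle almost everywhere, and there \<open>g\<close> has a radial limit.
\<close>

theorem fatou_radial_limits:
  assumes g: "bdd_hol g"
  shows "AE t in angle_measure. \<exists>w. ((\<lambda>r. g (of_real r * cis t)) \<longlongrightarrow> w) (at_left 1)"
proof -
  obtain G where contG: "continuous_on (cball 0 1) G"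
    and G: "\<And>z. cmod z < 1 \<Longrightarrow> (G has_field_derivative g z) (at z)"
    using bounded_holomorphic_primitive[OF g] by blast
  obtain k :: "real \<Rightarrow> complex" where k: "\<And>a b. k integrable_on cbox a b"
    "\<And>a b. 0 \<le> a \<Longrightarrow> a \<le> b \<Longrightarrow> b \<le> 2 * pi \<Longrightarrow> G (cis b) - G (cis a) = integral {a..b} k"
    using boundary_derivative_density[OF g contG G] by blast
  obtain N where N: "negligible N"
    "\<And>t e. t \<notin> N \<Longrightarrow> e > 0 \<Longrightarrow>
       \<exists>d>0. \<forall>s. 0 < s \<and> s < d \<longrightarrow> norm (integral {t..t + s} k - s *\<^sub>R k t) \<le> e * s \<and>
         norm (integral {t - s..t} k - s *\<^sub>R k t) \<le> e * s"
    using lebesgue_differentiation_two_sided[OF k(1)] by blast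
  have ex: "\<exists>w. ((\<lambda>r. g (of_real r * cis t)) \<longlongrightarrow> w) (at_left 1)" if t: "t \<in> {0<..<2 * pi} - N" for t
  proof (rule radial_limit_at_differentiability_point[OF g contG G])
    fix e :: real assume e: "e > 0"
    obtain d where d: "d > 0" "\<And>s. 0 < s \<Longrightarrow> s < d \<Longrightarrow> norm (integral {t..t + s} k - s *\<^sub>R k t) \<le> e * s"
       "\<And>s. 0 < s \<Longrightarrow> s < d \<Longrightarrow> norm (integral {t - s..t} k - s *\<^sub>R k t) \<le> e * s"
      using N(2)[of t e] t e by blast
    define d' where "d' = min d (min t (2 * pi - t))"
    have "cmod (G (cis (t + s)) - G (cis t) - of_real s * k t) \<le> e * \<bar>s\<bar>" if s: "\<bar>s\<bar> < d'" for s
    proof (cases s "0::real" rule: linorder_cases)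
      case greater
      then show ?thesis
        using k(2)[of t "t + s"] d(2)[of s] s t by (auto simp: d'_def scaleR_conv_of_real)
    next
      case less
      have "G (cis t) - G (cis (t + s)) = integral {t + s..t} k"
        using k(2)[of "t + s" t] less s t by (auto simp: d'_def)
      then have "cmod (G (cis t) - G (cis (t + s)) + of_real s * k t) \<le> e * \<bar>s\<bar>"
        using d(3)[of "- s"] less s t by (auto simp: d'_def scaleR_conv_of_real)
      moreover have "G (cis (t + s)) - G (cis t) - of_real s * k t = - (G (cis t) - G (cis (t + s)) + of_real s * k t)"
        by simp
      ultimately show ?thesis by (simp only: norm_minus_cancel)
    qed simp
    moreover have "d' > 0" using d(1) t by (auto simp: d'_def)
    ultimately show "\<exists>d>0. \<forall>s. \<bar>s\<bar> < d \<longrightarrow> cmod (G (cis (t + s)) - G (cis t) - of_real s * k t) \<le> e * \<bar>s\<bar>"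
      by blast
  qed auto
  have "AE t in lebesgue. t \<notin> insert 0 N"
    using N(1) by (intro AE_not_in) (simp flip: negligible_iff_null_sets)
  then have "AE t in lebesgue. t \<in> {0..<2 * pi} \<longrightarrow> (\<exists>w. ((\<lambda>r. g (of_real r * cis t)) \<longlongrightarrow> w) (at_left 1))"
    by eventually_elim (use ex in auto)
  then have "AE t in lborel. t \<in> {0..<2 * pi} \<longrightarrow> (\<exists>w. ((\<lambda>r. g (of_real r * cis t)) \<longlongrightarrow> w) (at_left 1))"
    by (simp only: AE_completion_iff)
  then show ?thesis
    unfolding angle_measure_def by (subst AE_uniform_measure) auto
qed

section \<open>Boundary integrals as Hardy space inner products\<close>

lemma circle_measure_eq_distr:
  "circle_measure = distr angle_measure (restrict_space borel (sphere 0 1)) cis"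
  by (simp add: circle_measure_def angle_measure_def)

lemma measurable_cis_sphere: "cis \<in> angle_measure \<rightarrow>\<^sub>M restrict_space borel (sphere 0 1)"
proof -
  have "cis \<in> borel \<rightarrow>\<^sub>M restrict_space borel (sphere 0 1)"
    by (intro measurable_restrict_space2 borel_measurable_continuous_onI continuous_on_cis continuous_on_id) auto
  then show ?thesis by (simp cong: measurable_cong_sets)
qed

text \<open>
  A sequence of radii along which dominated convergence is applied.
\<close>

definition radius :: "nat \<Rightarrow> real" where "radius i = 1 - 1 / (real i + 2)"

lemma radius_bounds: "0 < radius i" "radius i < 1"
  by (auto simp: radius_def field_simps)

lemma filterlim_radius: "filterlim radius (at_left 1) sequentially"
  unfolding radius_def by real_asymp

text \<open>
  The averages of \<open>|f|\<^sup>2\<close> over circles tend to 1 by dominated convergence.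
\<close>

lemma inner_function_imp_inner_map:
  assumes "inner_function f" "f 0 = 0"
  shows "inner_map f"
proof -
  have f: "f holomorphic_on ball 0 1" "f ` ball 0 1 \<subseteq> ball 0 1"
    using assms(1) by (auto simp: inner_function_def)
  have lt: "cmod (f z) < 1" if "cmod z < 1" for z
    using f(2) that by (auto simp: image_subset_iff)
  have bf: "bdd_hol f" using f(1) lt by (intro bdd_holI[of _ 1]) (auto intro: less_imp_le)
  have "AE z in distr angle_measure (restrict_space borel (sphere 0 1)) cis.
      \<exists>w. ((\<lambda>r. f (of_real r * z)) \<longlongrightarrow> w) (at_left 1) \<and> cmod w = 1"
    using assms(1) unfolding inner_function_def circle_measure_eq_distr by blast
  then have AE: "AE t in angle_measure.
      \<exists>w. ((\<lambda>r. f (of_real r * cis t)) \<longlongrightarrow> w) (at_left 1) \<and> cmod w = 1"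
    by (rule AE_distrD[OF measurable_cis_sphere])
  have "(\<lambda>i. circle_mean (radius i) f f) \<longlonglongrightarrow> (LINT t|angle_measure. 1)"
    unfolding circle_mean_def
  proof (rule integral_dominated_convergence[where w = "\<lambda>_. 1"])
    show "AE t in angle_measure. (\<lambda>i. f (of_real (radius i) * cis t) * cnj (f (of_real (radius i) * cis t))) \<longlonglongrightarrow> 1"
      using AE
    proof eventually_elim
      case (elim t)
      then obtain w where w: "((\<lambda>r. f (of_real r * cis t)) \<longlongrightarrow> w) (at_left 1)" "cmod w = 1" by blast
      have "(\<lambda>i. f (of_real (radius i) * cis t)) \<longlonglongrightarrow> w"
        by (rule filterlim_compose[OF w(1) filterlim_radius])
      then have "(\<lambda>i. f (of_real (radius i) * cis t) * cnj (f (of_real (radius i) * cis t))) \<longlonglongrightarrow> w * cnj w"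
        by (intro tendsto_intros)
      also have "w * cnj w = 1" using complex_norm_square[of w] w(2) by simp
      finally show ?case .
    qed
    show "AE t in angle_measure. norm (f (of_real (radius i) * cis t) * cnj (f (of_real (radius i) * cis t))) \<le> 1" for i
    proof (intro AE_I2)
      fix t
      have "cmod (f (of_real (radius i) * cis t)) \<le> 1"
        using radius_bounds[of i] by (intro less_imp_le lt) (simp add: norm_mult)
      then show "norm (f (of_real (radius i) * cis t) * cnj (f (of_real (radius i) * cis t))) \<le> 1"
        by (simp add: norm_mult mult_le_one)
    qed
    have "continuous_on UNIV (\<lambda>t. f (of_real (radius i) * cis t) * cnj (f (of_real (radius i) * cis t)))" for i
      using radius_bounds[of i] by (intro continuous_intros continuous_on_circle f) auto
    from borel_measurable_continuous_onI[OF this]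
    show "(\<lambda>t. f (of_real (radius i) * cis t) * cnj (f (of_real (radius i) * cis t))) \<in> borel_measurable angle_measure" for i
      by simp
  qed auto
  moreover have "(\<lambda>i. circle_mean (radius i) f f) \<longlonglongrightarrow> h2_inner f f"
    by (rule filterlim_compose[OF h2_inner_limit[OF bf bf] filterlim_radius])
  ultimately have "h2_inner f f = 1"
    using LIMSEQ_unique angle.prob_space by fastforce
  with f assms(2) show ?thesis by (simp add: inner_map_def)
qed

text \<open>
  By Fatou's theorem for the iterates the integrand is the radial limit of \<open>A cnj B\<close>, so the integral is the
  limit of the circle means.
\<close>

lemma iterate_integral_le_h2_inner:
  assumes f: "inner_map f" and e: "\<And>j. j \<in> {1..k} \<Longrightarrow> \<epsilon> j \<in> {1, -1}"
  shows "iterate_integral f k \<epsilon> n \<le>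
    cmod (h2_inner (\<lambda>z. \<Prod>j\<in>{j\<in>{1..k}. \<epsilon> j = 1}. (f ^^ n j) z) (\<lambda>z. \<Prod>j\<in>{j\<in>{1..k}. \<epsilon> j \<noteq> 1}. (f ^^ n j) z))"
proof -
  define A where "A = (\<lambda>z. \<Prod>j\<in>{j\<in>{1..k}. \<epsilon> j = 1}. (f ^^ n j) z)"
  define B where "B = (\<lambda>z. \<Prod>j\<in>{j\<in>{1..k}. \<epsilon> j \<noteq> 1}. (f ^^ n j) z)"
  define P where "P = (\<lambda>z. \<Prod>j=1..k. signed_iterate f (\<epsilon> j) (n j) z)"
  have fn: "bdd_hol (f ^^ m)" for m by (intro inner_map_bdd_hol inner_map_funpow f)
  have bA: "bdd_hol A" and bB: "bdd_hol B"
    unfolding A_def B_def by (intro bdd_hol_intros fn)+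
  have lt: "cmod ((f ^^ m) z) \<le> 1" if "cmod z < 1" for m z
    using inner_mapD(5)[OF inner_map_funpow[OF f] that] by (rule less_imp_le)
  have AB: "A z * cnj (B z) = (\<Prod>j=1..k. if \<epsilon> j = 1 then (f ^^ n j) z else cnj ((f ^^ n j) z))" for z
  proof -
    have "(\<Prod>j=1..k. if \<epsilon> j = 1 then (f ^^ n j) z else cnj ((f ^^ n j) z)) =
        (\<Prod>j\<in>{1..k} \<inter> {j. \<epsilon> j = 1}. (f ^^ n j) z) * (\<Prod>j\<in>{1..k} \<inter> - {j. \<epsilon> j = 1}. cnj ((f ^^ n j) z))"
      by (rule prod.If_cases) simp
    also have "{1..k} \<inter> {j. \<epsilon> j = 1} = {j\<in>{1..k}. \<epsilon> j = 1}" by auto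
    also have "{1..k} \<inter> - {j. \<epsilon> j = 1} = {j\<in>{1..k}. \<epsilon> j \<noteq> 1}" by auto
    finally show ?thesis by (simp only: A_def B_def cnj_prod)
  qed
  show ?thesis
  proof (cases "integrable circle_measure P")
    \<comment> \<open>A non-integrable product has Bochner integral 0, so that only the other case matters.\<close>
    case False
    then have "(LINT z|circle_measure. P z) = 0" by (rule not_integrable_integral_eq)
    then show ?thesis
      by (simp add: iterate_integral_def P_def)
  next
    case True
    then have meas: "P \<in> borel_measurable (restrict_space borel (sphere 0 1))"
      unfolding circle_measure_eq_distr by auto
    have AE: "AE t in angle_measure. \<forall>j\<in>{1..k}. \<exists>w. ((\<lambda>r. (f ^^ n j) (of_real r * cis t)) \<longlongrightarrow> w) (at_left 1)"
      by (intro AE_finite_allI fatou_radial_limits fn) auto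
    have "(\<lambda>i. circle_mean (radius i) A B) \<longlonglongrightarrow> (LINT t|angle_measure. P (cis t))"
      unfolding circle_mean_def
    proof (rule integral_dominated_convergence[where w = "\<lambda>_. 1"])
      show "AE t in angle_measure. (\<lambda>i. A (of_real (radius i) * cis t) * cnj (B (of_real (radius i) * cis t))) \<longlonglongrightarrow> P (cis t)"
        using AE
      proof eventually_elim
        case (elim t)
        have lim: "(\<lambda>i. (f ^^ n j) (of_real (radius i) * cis t)) \<longlonglongrightarrow> boundary_fun (f ^^ n j) (cis t)"
          if j: "j \<in> {1..k}" for j
        proof -
          obtain w where w: "((\<lambda>r. (f ^^ n j) (of_real r * cis t)) \<longlongrightarrow> w) (at_left 1)"
            using elim j by blast
          then have "boundary_fun (f ^^ n j) (cis t) = w"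
            unfolding boundary_fun_def by (rule tendsto_Lim[OF trivial_limit_at_left_real])
          then show ?thesis using filterlim_compose[OF w filterlim_radius] by simp
        qed
        show ?case
          unfolding AB P_def signed_iterate_def
        proof (rule tendsto_prod)
          fix j assume j: "j \<in> {1..k}"
          show "(\<lambda>i. if \<epsilon> j = 1 then (f ^^ n j) (of_real (radius i) * cis t) else cnj ((f ^^ n j) (of_real (radius i) * cis t)))
              \<longlonglongrightarrow> (if \<epsilon> j = 1 then boundary_fun (f ^^ n j) (cis t) else cnj (boundary_fun (f ^^ n j) (cis t)))"
            using lim[OF j] by (cases "\<epsilon> j = 1") (auto intro!: tendsto_cnj)
        qed
      qed
      show "AE t in angle_measure. norm (A (of_real (radius i) * cis t) * cnj (B (of_real (radius i) * cis t))) \<le> 1" for i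
      proof (intro AE_I2)
        fix t
        have "cmod (of_real (radius i) * cis t) < 1" using radius_bounds[of i] by (simp add: norm_mult)
        then show "norm (A (of_real (radius i) * cis t) * cnj (B (of_real (radius i) * cis t))) \<le> 1"
          unfolding AB prod_norm[symmetric] by (intro prod_le_1) (auto intro: lt)
      qed
      have "continuous_on UNIV (\<lambda>t. A (of_real (radius i) * cis t) * cnj (B (of_real (radius i) * cis t)))" for i
        using radius_bounds[of i] by (intro continuous_intros continuous_on_circle bdd_hol_holomorphic bA bB) auto
      from borel_measurable_continuous_onI[OF this]
      show "(\<lambda>t. A (of_real (radius i) * cis t) * cnj (B (of_real (radius i) * cis t))) \<in> borel_measurable angle_measure" for i
        by simp
      show "(\<lambda>t. P (cis t)) \<in> borel_measurable angle_measure"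
        by (rule measurable_compose[OF measurable_cis_sphere meas])
    qed auto
    moreover have "(\<lambda>i. circle_mean (radius i) A B) \<longlonglongrightarrow> h2_inner A B"
      by (rule filterlim_compose[OF h2_inner_limit[OF bA bB] filterlim_radius])
    ultimately have "(LINT t|angle_measure. P (cis t)) = h2_inner A B"
      by (rule LIMSEQ_unique)
    moreover have "(LINT z|circle_measure. P z) = (LINT t|angle_measure. P (cis t))"
      unfolding circle_measure_eq_distr by (rule integral_distr[OF measurable_cis_sphere meas])
    ultimately show ?thesis
      by (simp add: iterate_integral_def P_def A_def B_def)
  qed
qed

section \<open>Attraction to the origin\<close>

text \<open>
  Apply the Schwarz lemma to \<open>(h z - h 0) / 3\<close>, where \<open>f z = z h z\<close>; the divisor 3 exceeds
  \<open>|h z - h 0| \<le> 2\<close>.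
\<close>

lemma self_map_second_order:
  assumes "f holomorphic_on ball 0 1" "f ` ball 0 1 \<subseteq> ball 0 1" "f 0 = 0" "cmod z < 1"
  shows "cmod (f z) \<le> cmod z * (cmod (deriv f 0) + 3 * cmod z)"
proof -
  obtain h where h: "h holomorphic_on ball 0 1" "\<And>z. cmod z < 1 \<Longrightarrow> f z = z * h z"
    "\<And>z. cmod z < 1 \<Longrightarrow> cmod (h z) \<le> 1" "h 0 = deriv f 0"
    using self_map_factor[OF assms(1-3)] by blast
  define H where "H = (\<lambda>z. (h z - h 0) / 3)"
  have "cmod (H z) \<le> cmod z"
  proof (rule Schwarz_Lemma(1)[OF _ _ _ assms(4)])
    show "H holomorphic_on ball 0 1" unfolding H_def by (intro holomorphic_intros h) auto
    fix z :: complex assume "cmod z < 1"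
    then have "cmod (h z - h 0) \<le> 1 + 1" using h(3)[of z] h(3)[of 0]
      by (intro order_trans[OF norm_triangle_ineq4] add_mono) auto
    then show "cmod (H z) < 1" by (simp add: H_def norm_divide)
  qed (simp add: H_def)
  then have "cmod (h z - h 0) \<le> 3 * cmod z" by (simp add: H_def norm_divide)
  then have "cmod (h z) \<le> cmod (deriv f 0) + 3 * cmod z"
    using norm_triangle_ineq[of "h z - h 0" "h 0"] h(4) by simp
  then show ?thesis using h(2)[OF assms(4)] by (simp add: norm_mult mult_left_mono)
qed

text \<open>
  Close to 0 the map contracts by a factor \<open>b < 1\<close>, so the orbit decays geometrically. Then the correction to
  the exact factor \<open>a\<close> in step \<open>m\<close> is at most \<open>1 + c b\<^sup>m\<close>, and the product of these corrections converges.
\<close>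

theorem koenigs_bound:
  assumes f: "f holomorphic_on ball 0 1" "f ` ball 0 1 \<subseteq> ball 0 1" "f 0 = 0"
    and a: "a = cmod (deriv f 0)" "0 < a" "a < 1"
  obtains \<rho> K where "0 < \<rho>" "\<rho> < 1" "1 \<le> K"
    "\<And>m z. cmod z \<le> \<rho> \<Longrightarrow> cmod ((f ^^ m) z) \<le> K * a ^ m"
proof -
  \<comment> \<open>With this radius the contraction factor \<open>b\<close> is \<open>(1 + a) / 2\<close>.\<close>
  define \<rho> where "\<rho> = (1 - a) / 6"
  define b where "b = a + 3 * \<rho>"
  have \<rho>: "0 < \<rho>" "\<rho> < 1" and b: "0 < b" "b < 1"
    using a(2,3) unfolding \<rho>_def b_def by (auto simp: field_simps)
  define c where "c = 3 * \<rho> / a"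
  have c: "0 < c" using \<rho> a by (simp add: c_def)
  have step: "cmod (f w) \<le> cmod w * (a + 3 * cmod w)" if "cmod w \<le> \<rho>" for w
    using self_map_second_order[OF f, of w] that \<rho> a by simp
  have geo: "cmod ((f ^^ m) z) \<le> \<rho> * b ^ m" if z: "cmod z \<le> \<rho>" for m z
  proof (induction m)
    case (Suc m)
    define w where "w = (f ^^ m) z"
    have "\<rho> * b ^ m \<le> \<rho>" using \<rho> b by (simp add: mult_left_le power_le_one)
    with Suc have w: "cmod w \<le> \<rho>" by (simp add: w_def)
    have "cmod (f w) \<le> cmod w * (a + 3 * cmod w)" by (rule step[OF w])
    also have "\<dots> \<le> (\<rho> * b ^ m) * b"
      using Suc w \<rho> b a by (intro mult_mono) (auto simp: w_def b_def)
    finally show ?case by (simp add: w_def mult_ac)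
  qed (use z in simp)
  have main: "cmod ((f ^^ m) z) \<le> \<rho> * a ^ m * exp (c * (\<Sum>i<m. b ^ i))" if z: "cmod z \<le> \<rho>" for m z
  proof (induction m)
    case (Suc m)
    define w where "w = (f ^^ m) z"
    have wb: "cmod w \<le> \<rho> * b ^ m" unfolding w_def by (rule geo[OF z])
    also have "\<dots> \<le> \<rho>" using \<rho> b by (simp add: mult_left_le power_le_one)
    finally have w: "cmod w \<le> \<rho>" .
    have "cmod (f w) \<le> cmod w * (a + 3 * cmod w)" by (rule step[OF w])
    also have "\<dots> \<le> cmod w * (a + 3 * (\<rho> * b ^ m))" using wb by (intro mult_left_mono) auto
    also have "a + 3 * (\<rho> * b ^ m) = a * (1 + c * b ^ m)" using a by (simp add: c_def field_simps)
    also have "cmod w * (a * (1 + c * b ^ m)) \<le>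
        (\<rho> * a ^ m * exp (c * (\<Sum>i<m. b ^ i))) * (a * exp (c * b ^ m))"
      using Suc a \<rho> b c exp_ge_add_one_self[of "c * b ^ m"]
      by (intro mult_mono) (auto simp: w_def intro!: add_nonneg_nonneg)
    also have "\<dots> = \<rho> * a ^ Suc m * exp (c * (\<Sum>i<Suc m. b ^ i))"
      by (simp add: exp_add distrib_left mult_ac)
    finally show ?case by (simp add: w_def)
  qed (use z in simp)
  define K where "K = exp (c * (1 / (1 - b)))"
  have "cmod ((f ^^ m) z) \<le> K * a ^ m" if z: "cmod z \<le> \<rho>" for m z
  proof -
    have "(\<Sum>i<m. b ^ i) \<le> (\<Sum>i. b ^ i)"
      using b by (intro sum_le_suminf summable_geometric) auto
    also have "\<dots> = 1 / (1 - b)" using b by (intro suminf_geometric) auto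
    finally have e: "exp (c * (\<Sum>i<m. b ^ i)) \<le> K"
      using c unfolding K_def by (intro iffD2[OF exp_le_cancel_iff] mult_left_mono) auto
    have "cmod ((f ^^ m) z) \<le> \<rho> * a ^ m * exp (c * (\<Sum>i<m. b ^ i))" by (rule main[OF z])
    also have "\<dots> \<le> 1 * a ^ m * K" using \<rho> a e by (intro mult_mono) auto
    finally show ?thesis by (simp add: mult.commute)
  qed
  moreover have "1 \<le> K" using b c by (simp add: K_def)
  ultimately show thesis using \<rho> that by blast
qed

text \<open>
  The inner product is the conjugate of a Taylor coefficient of \<open>\<phi>\<^sup>j\<close>, which the Cauchy estimate controls.
\<close>

lemma taylor_coeff_power_bound:
  assumes \<phi>: "bdd_hol \<phi>" and \<rho>: "0 < \<rho>" "\<rho> < 1" and M: "\<And>z. cmod z \<le> \<rho> \<Longrightarrow> cmod (\<phi> z) \<le> M"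
  shows "cmod (h2_inner (\<lambda>z. z ^ l) (\<lambda>z. \<phi> z ^ j)) \<le> M ^ j / \<rho> ^ l"
proof -
  have hol: "(\<lambda>z. \<phi> z ^ j) holomorphic_on ball 0 1"
    by (intro bdd_hol_holomorphic bdd_hol_intros \<phi>)
  have "cmod ((deriv ^^ l) (\<lambda>z. \<phi> z ^ j) 0) \<le> fact l * M ^ j / \<rho> ^ l"
  proof (rule Cauchy_inequality)
    show "(\<lambda>z. \<phi> z ^ j) holomorphic_on ball 0 \<rho>"
      using \<rho> by (intro holomorphic_on_subset[OF hol]) auto
    show "continuous_on (cball 0 \<rho>) (\<lambda>z. \<phi> z ^ j)"
      using \<rho> by (intro holomorphic_on_imp_continuous_on holomorphic_on_subset[OF hol]) auto
    show "cmod (\<phi> z ^ j) \<le> M ^ j" if "cmod (0 - z) = \<rho>" for z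
      unfolding norm_power using that by (intro power_mono M) auto
  qed (use \<rho> in auto)
  then show ?thesis
    by (simp add: h2_inner_power_left taylor_coeff_def norm_divide field_simps)
qed

section \<open>One step of the correlation recursion\<close>

text \<open>
  Iterates are counted from the base time \<open>m\<close>, that is, as functions of \<open>f\<^sup>m z\<close>.
\<close>

definition tail_prod :: "(complex \<Rightarrow> complex) \<Rightarrow> (nat \<Rightarrow> nat) \<Rightarrow> nat \<Rightarrow> nat set \<Rightarrow> complex \<Rightarrow> complex" where
  "tail_prod f n m J z = (\<Prod>j\<in>J. (f ^^ (n j - m)) z)"

text \<open>
  The correlation of the times in \<open>P\<close> (with sign 1) and \<open>Q\<close> (with sign -1) with the character of frequency
  \<open>l\<close>. The power of \<open>z\<close> stands on the left for positive and on the right for negative frequency.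
\<close>

definition tail_corr ::
    "(complex \<Rightarrow> complex) \<Rightarrow> (nat \<Rightarrow> nat) \<Rightarrow> nat \<Rightarrow> nat set \<Rightarrow> nat set \<Rightarrow> int \<Rightarrow> complex" where
  "tail_corr f n m P Q l =
     h2_inner (\<lambda>z. z ^ nat l * tail_prod f n m P z) (\<lambda>z. z ^ nat (- l) * tail_prod f n m Q z)"

lemma bdd_hol_tail_prod: "inner_map f \<Longrightarrow> bdd_hol (tail_prod f n m J)"
  unfolding tail_prod_def[abs_def] by (intro bdd_hol_prod inner_map_bdd_hol inner_map_funpow)

lemma tail_corr_swap: "inner_map f \<Longrightarrow> tail_corr f n m P Q (- l) = cnj (tail_corr f n m Q P l)"
  unfolding tail_corr_def minus_minus
  by (intro h2_inner_cnj bdd_hol_intros bdd_hol_tail_prod)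

lemma tail_prod_rebase:
  assumes "m \<le> m'" "\<And>j. j \<in> J \<Longrightarrow> m' \<le> n j"
  shows "tail_prod f n m J z = tail_prod f n m' J ((f ^^ (m' - m)) z)"
  unfolding tail_prod_def
proof (rule prod.cong[OF refl])
  fix j assume "j \<in> J"
  then have "n j - m = (n j - m') + (m' - m)" using assms by fastforce
  then show "(f ^^ (n j - m)) z = (f ^^ (n j - m')) ((f ^^ (m' - m)) z)"
    by (simp only: funpow_add o_apply)
qed

lemma tail_prod_split:
  "finite J \<Longrightarrow> i \<in> J \<Longrightarrow> tail_prod f n (n i) J z = z * tail_prod f n (n i) (J - {i}) z"
  unfolding tail_prod_def by (subst prod.remove[of J i]) auto

text \<open>
  The transfer identity moves the base from \<open>m\<close> to the next time \<open>n (Suc i)\<close>. The factor belonging to that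
  time is then the identity map, so it can be absorbed into the power of \<open>z\<close>: it shifts the frequency by
  \<open>d\<close>, which is \<open>1\<close> or \<open>-1\<close> according to the sign of this factor. A factor of \<open>Q\<close> cancels against a
  positive power of \<open>z\<close> because multiplication by \<open>z\<close> is an isometry.
\<close>

theorem tail_corr_step:
  assumes f: "inner_map f" and i: "i < k" and PQ: "P \<union> Q = {i<..k}" "P \<inter> Q = {}"
    and m: "m \<le> n (Suc i)" and mono: "\<And>j. Suc i \<le> j \<Longrightarrow> j \<le> k \<Longrightarrow> n (Suc i) \<le> n j"
  obtains P' Q' d where "d \<in> {1, - 1 :: int}" "P' \<union> Q' = {Suc i<..k}" "P' \<inter> Q' = {}"
    "\<And>l. tail_corr f n m P Q (int l) =
       (\<Sum>j\<le>l. h2_inner (\<lambda>z. z ^ l) (\<lambda>z. (f ^^ (n (Suc i) - m)) z ^ j) *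
          tail_corr f n (n (Suc i)) P' Q' (int j + d))"
proof -
  define m' where "m' = n (Suc i)"
  define \<phi> where "\<phi> = f ^^ (m' - m)"
  note bt = bdd_hol_tail_prod[OF f]
  have \<phi>: "inner_map \<phi>" unfolding \<phi>_def by (intro inner_map_funpow f)
  have fin: "finite P" "finite Q" using PQ(1) by (metis finite_Un finite_greaterThanAtMost)+
  have sub: "m' \<le> n j" if "j \<in> P \<or> j \<in> Q" for j
  proof -
    have "j \<in> {i<..k}" using that PQ(1) by blast
    then show ?thesis unfolding m'_def by (intro mono) auto
  qed
  have rebase: "tail_prod f n m P z = tail_prod f n m' P (\<phi> z)" "tail_prod f n m Q z = tail_prod f n m' Q (\<phi> z)" for z
    unfolding \<phi>_def using m sub by (auto intro!: tail_prod_rebase simp: m'_def)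
  have tr: "tail_corr f n m P Q (int l) =
      (\<Sum>j\<le>l. h2_inner (\<lambda>z. z ^ l) (\<lambda>z. \<phi> z ^ j) *
         h2_inner (\<lambda>z. z ^ j * tail_prod f n m' P z) (tail_prod f n m' Q))" for l
    using h2_inner_transfer[OF \<phi> bt bt] by (simp add: tail_corr_def rebase)
  have "Suc i \<in> P \<union> Q" using i PQ(1) by simp
  then consider "Suc i \<in> P" "Suc i \<notin> Q" | "Suc i \<in> Q" "Suc i \<notin> P" using PQ(2) by blast
  then show thesis
  proof cases
    case 1
    show thesis
    proof (rule that[of 1 "P - {Suc i}" Q])
      have "P \<union> Q - {Suc i} = {Suc i<..k}" unfolding PQ(1) using i by auto
      then show "P - {Suc i} \<union> Q = {Suc i<..k}" using 1 by blast
      show "(P - {Suc i}) \<inter> Q = {}" using PQ(2) by blast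
      have "h2_inner (\<lambda>z. z ^ j * tail_prod f n m' P z) (tail_prod f n m' Q) =
          tail_corr f n m' (P - {Suc i}) Q (int j + 1)" for j
        using tail_prod_split[OF fin(1) 1(1), of f n]
        by (simp add: tail_corr_def m'_def nat_add_distrib mult_ac)
      then show "tail_corr f n m P Q (int l) =
       (\<Sum>j\<le>l. h2_inner (\<lambda>z. z ^ l) (\<lambda>z. (f ^^ (n (Suc i) - m)) z ^ j) *
          tail_corr f n (n (Suc i)) (P - {Suc i}) Q (int j + 1))" for l
        by (simp only: tr \<phi>_def m'_def)
    qed simp
  next
    case 2
    show thesis
    proof (rule that[of "- 1" P "Q - {Suc i}"])
      have "P \<union> Q - {Suc i} = {Suc i<..k}" unfolding PQ(1) using i by auto
      then show "P \<union> (Q - {Suc i}) = {Suc i<..k}" using 2 by blast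
      show "P \<inter> (Q - {Suc i}) = {}" using PQ(2) by blast
      have Q_eq: "tail_prod f n m' Q = (\<lambda>z. z * tail_prod f n m' (Q - {Suc i}) z)"
        using tail_prod_split[OF fin(2) 2(1), of f n] by (auto simp: m'_def)
      have "h2_inner (\<lambda>z. z ^ j * tail_prod f n m' P z) (tail_prod f n m' Q) =
          tail_corr f n m' P (Q - {Suc i}) (int j + - 1)" for j
      proof (cases j)
        case 0
        then show ?thesis by (simp add: tail_corr_def Q_eq)
      next
        case (Suc j')
        have "h2_inner (\<lambda>z. z * (z ^ j' * tail_prod f n m' P z)) (\<lambda>z. z * tail_prod f n m' (Q - {Suc i}) z) =
            h2_inner (\<lambda>z. z ^ j' * tail_prod f n m' P z) (tail_prod f n m' (Q - {Suc i}))"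
          by (intro h2_inner_mult_inner_map inner_map_ident bdd_hol_intros bt)
        then show ?thesis
          by (simp add: tail_corr_def Suc Q_eq mult.assoc)
      qed
      then show "tail_corr f n m P Q (int l) =
       (\<Sum>j\<le>l. h2_inner (\<lambda>z. z ^ l) (\<lambda>z. (f ^^ (n (Suc i) - m)) z ^ j) *
          tail_corr f n (n (Suc i)) P (Q - {Suc i}) (int j + - 1))" for l
        by (simp only: tr \<phi>_def m'_def)
    qed simp
  qed
qed

section \<open>The cheapest path and the correlation bound\<close>

text \<open>
  The cheapest way to go from non-zero frequency at time \<open>i\<close> to frequency 0 at time \<open>k\<close>: the gap after \<open>i\<close>
  is paid, and then the frequency at time \<open>i + 1\<close> is either still non-zero, or it is 0 and the next gap is
  free, after which it is non-zero again at time \<open>i + 2\<close>. Arriving at time \<open>k\<close> with frequency 0 costs nothing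
  more, which is the value 0 beyond \<open>k\<close>. A path that is at a non-zero frequency at time \<open>k\<close> contributes
  nothing to the correlation. The value at \<open>k\<close>, the last gap, keeps such a path from being chosen: it ties with the cost at
  \<open>k - 1\<close>, so that the last gap is never declared free, and it does not undercut the paths that end at
  frequency 0.
\<close>

function path_cost :: "(nat \<Rightarrow> nat) \<Rightarrow> nat \<Rightarrow> nat \<Rightarrow> nat" where
  "path_cost n k i =
     (if k < i then 0
      else if i = k then n k - n (k - 1)
      else (n (Suc i) - n i) + min (path_cost n k (Suc i)) (path_cost n k (Suc (Suc i))))"
  by auto
termination by (relation "Wellfounded.measure (\<lambda>(n, k, i). Suc k - i)") auto

declare path_cost.simps [simp del]

lemma path_cost_beyond: "k < i \<Longrightarrow> path_cost n k i = 0"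
  by (simp add: path_cost.simps)

lemma path_cost_step:
  "i < k \<Longrightarrow> path_cost n k i = (n (Suc i) - n i) + min (path_cost n k (Suc i)) (path_cost n k (Suc (Suc i)))"
  by (subst path_cost.simps) simp

lemma path_cost_last:
  assumes "Suc i = k" shows "path_cost n k i = n k - n i" "path_cost n k k = n k - n i"
proof -
  show "path_cost n k k = n k - n i" using assms by (subst path_cost.simps) auto
  show "path_cost n k i = n k - n i" using assms by (subst path_cost_step) (auto simp: path_cost_beyond)
qed

lemma geometric_tail_le:
  fixes x :: real
  assumes "0 \<le> x" "x \<le> 1 / 2"
  shows "(\<Sum>j\<le>l. if j = 0 then 0 else x ^ j) \<le> 2 * x"
proof -
  have "(\<Sum>j\<le>l. if j = 0 then 0 else x ^ j) \<le> 2 * x - 2 * x * (1 / 2) ^ l"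
  proof (induction l)
    case (Suc l)
    have "x ^ Suc l \<le> x * (1 / 2) ^ l"
      using assms power_mono[OF assms(2,1), of l] by (simp add: mult_left_mono)
    with Suc show ?case by simp
  qed simp
  also have "\<dots> \<le> 2 * x" using assms by simp
  finally show ?thesis .
qed

lemma step_constant_bounds:
  fixes \<rho> K C :: real
  assumes \<rho>: "0 < \<rho>" "\<rho> < 1" and K: "1 \<le> K" and C: "C = 2 * K / \<rho>\<^sup>2"
  shows "1 / \<rho> \<le> C" "1 \<le> C" "0 < C"
proof -
  have "\<rho>\<^sup>2 \<le> \<rho>" using \<rho> by (simp add: power2_eq_square mult_left_le)
  then have "1 / \<rho> \<le> 1 / \<rho>\<^sup>2" using \<rho> by (intro divide_left_mono) auto
  also have "\<dots> \<le> C" unfolding C using K \<rho> by (intro divide_right_mono) auto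
  finally show "1 / \<rho> \<le> C" .
  moreover have "1 \<le> 1 / \<rho>" using \<rho> by simp
  ultimately show "1 \<le> C" "0 < C" by linarith+
qed

text \<open>
  Backwards induction over the times. In the step, the term of frequency \<open>j\<close> has weight at most
  \<open>(K a\<^sup>g)\<^sup>j / \<rho>\<^sup>l\<close> and the correlation that it multiplies is at most a constant over \<open>\<rho>\<^sup>j\<^sup>+\<^sup>1\<close>,
  whatever the shift by \<open>1\<close> or \<open>-1\<close> does. This is a geometric series in \<open>K a\<^sup>g / \<rho>\<close>. Its sum
  reproduces the factor \<open>1 / \<rho>\<^sup>l\<close>, so the weights of high frequencies do not accumulate along the induction.
\<close>

theorem tail_corr_bound:
  assumes f: "inner_map f" and a: "0 < a" "a < 1"
    and \<rho>: "0 < \<rho>" "\<rho> < 1" and K: "1 \<le> K"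
    and small: "\<And>m z. cmod z \<le> \<rho> \<Longrightarrow> cmod ((f ^^ m) z) \<le> K * a ^ m"
    and mono: "\<And>i j. 1 \<le> i \<Longrightarrow> i \<le> j \<Longrightarrow> j \<le> k \<Longrightarrow> n i \<le> n j"
    and gap: "\<And>j. 1 \<le> j \<Longrightarrow> j < k \<Longrightarrow> K * a ^ (n (Suc j) - n j) / \<rho> \<le> 1 / 2"
    and C: "C = 2 * K / \<rho>\<^sup>2"
    and i: "1 \<le> i" "i \<le> k" and PQ: "P \<union> Q = {i<..k}" "P \<inter> Q = {}"
  shows "cmod (tail_corr f n (n i) P Q l) \<le>
    C ^ (k - i) * (if l = 0 then a ^ path_cost n k (Suc i) / \<rho> else a ^ path_cost n k i / \<rho> ^ nat \<bar>l\<bar>)"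
  using i(2,1) PQ
proof (induction i arbitrary: P Q l rule: inc_induct)
  case base
  then have "P = {}" "Q = {}" by auto
  then have "tail_corr f n (n k) P Q l = of_bool (l = 0)"
    unfolding tail_corr_def tail_prod_def
    by (cases l "0::int" rule: linorder_cases)
       (auto simp: h2_inner_one_left h2_inner_one_right)
  then show ?case using \<rho> a by (auto simp: path_cost_beyond)
next
  case (step i)
  define B where "B = C ^ (k - Suc i) * a ^ min (path_cost n k (Suc i)) (path_cost n k (Suc (Suc i)))"
  define g where "g = n (Suc i) - n i"
  define x where "x = K * a ^ g / \<rho>"
  note C1 = step_constant_bounds[OF \<rho> K C]
  have B0: "0 \<le> B" using C1 a by (simp add: B_def)
  have x: "0 \<le> x" "x \<le> 1 / 2"
    using gap[of i] step.hyps step.prems(1) K a \<rho> by (auto simp: x_def g_def)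
  have Ck: "C * C ^ (k - Suc i) = C ^ (k - i)"
    using step.hyps by (metis Suc_diff_Suc power_Suc)
  \<comment> \<open>Negative frequencies reduce to positive ones by exchanging \<open>P\<close> and \<open>Q\<close>.\<close>
  have key: "cmod (tail_corr f n (n i) P Q (int l)) \<le>
    C ^ (k - i) * (if l = 0 then a ^ path_cost n k (Suc i) / \<rho> else a ^ path_cost n k i / \<rho> ^ l)"
    if PQ: "P \<union> Q = {i<..k}" "P \<inter> Q = {}" for P Q l
  proof -
    obtain P' Q' d where d: "d \<in> {1, - 1 :: int}" and PQ': "P' \<union> Q' = {Suc i<..k}" "P' \<inter> Q' = {}"
      and eq: "\<And>l. tail_corr f n (n i) P Q (int l) =
       (\<Sum>j\<le>l. h2_inner (\<lambda>z. z ^ l) (\<lambda>z. (f ^^ g) z ^ j) * tail_corr f n (n (Suc i)) P' Q' (int j + d))"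
      unfolding g_def
      by (rule tail_corr_step[OF f _ PQ, where m = "n i" and n = n]) (use step.hyps step.prems(1) mono in auto)
    have IH: "cmod (tail_corr f n (n (Suc i)) P' Q' l) \<le> C ^ (k - Suc i) *
        (if l = 0 then a ^ path_cost n k (Suc (Suc i)) / \<rho> else a ^ path_cost n k (Suc i) / \<rho> ^ nat \<bar>l\<bar>)" for l
      using step.IH[OF _ PQ'] by simp
    have T: "cmod (tail_corr f n (n (Suc i)) P' Q' (int j + d)) \<le> B / \<rho> ^ Suc j" for j
    proof (cases "int j + d = 0")
      case True
      then have "cmod (tail_corr f n (n (Suc i)) P' Q' (int j + d)) \<le> C ^ (k - Suc i) * (a ^ path_cost n k (Suc (Suc i)) / \<rho>)"
        using IH[of 0] by simp
      also have "\<dots> \<le> C ^ (k - Suc i) * (a ^ min (path_cost n k (Suc i)) (path_cost n k (Suc (Suc i))) / \<rho> ^ Suc j)"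
        using C1 a \<rho> power_decreasing[of 1 "Suc j" \<rho>]
        by (intro mult_left_mono frac_le power_decreasing) auto
      finally show ?thesis by (simp add: B_def)
    next
      case False
      have "nat \<bar>int j + d\<bar> \<le> Suc j" using d by auto
      have "cmod (tail_corr f n (n (Suc i)) P' Q' (int j + d)) \<le> C ^ (k - Suc i) * (a ^ path_cost n k (Suc i) / \<rho> ^ nat \<bar>int j + d\<bar>)"
        using IH[of "int j + d"] False by simp
      also have "\<dots> \<le> C ^ (k - Suc i) * (a ^ min (path_cost n k (Suc i)) (path_cost n k (Suc (Suc i))) / \<rho> ^ Suc j)"
        using C1 a \<rho> \<open>nat \<bar>int j + d\<bar> \<le> Suc j\<close>
        by (intro mult_left_mono frac_le power_decreasing) auto
      finally show ?thesis by (simp add: B_def)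
    qed
    show ?thesis
    proof (cases "l = 0")
      case True
      have "tail_corr f n (n i) P Q (int 0) = tail_corr f n (n (Suc i)) P' Q' d"
        unfolding eq by (simp add: h2_inner_one_left)
      then have "cmod (tail_corr f n (n i) P Q (int l)) \<le> C ^ (k - Suc i) * (a ^ path_cost n k (Suc i) / \<rho>)"
        using IH[of d] d True by auto
      also have "\<dots> \<le> C ^ (k - i) * (a ^ path_cost n k (Suc i) / \<rho>)"
        using C1 a \<rho> by (intro mult_right_mono power_increasing) auto
      finally show ?thesis using True by simp
    next
      case False
      have "cmod (h2_inner (\<lambda>z. z ^ l) (\<lambda>z. (f ^^ g) z ^ j) * tail_corr f n (n (Suc i)) P' Q' (int j + d)) \<le>
          B / \<rho> ^ Suc l * (if j = 0 then 0 else x ^ j)" for j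
      proof (cases "j = 0")
        case True
        have "h2_inner (\<lambda>z. z ^ l) (\<lambda>z. 1) = 0"
          unfolding h2_inner_one_right using False by simp
        then show ?thesis using True by simp
      next
        case False
        have "cmod (h2_inner (\<lambda>z. z ^ l) (\<lambda>z. (f ^^ g) z ^ j) * tail_corr f n (n (Suc i)) P' Q' (int j + d)) \<le>
            ((K * a ^ g) ^ j / \<rho> ^ l) * (B / \<rho> ^ Suc j)"
          unfolding norm_mult
          using K a \<rho> by (intro mult_mono T taylor_coeff_power_bound small inner_map_bdd_hol inner_map_funpow f) auto
        also have "\<dots> = B / \<rho> ^ Suc l * x ^ j"
          by (simp add: x_def power_divide mult_ac)
        finally show ?thesis using False by simp
      qed
      then have "cmod (tail_corr f n (n i) P Q (int l)) \<le> (\<Sum>j\<le>l. B / \<rho> ^ Suc l * (if j = 0 then 0 else x ^ j))"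
        unfolding eq by (intro sum_norm_le) auto
      also have "\<dots> \<le> B / \<rho> ^ Suc l * (2 * x)"
        unfolding sum_distrib_left[symmetric]
        using B0 \<rho> by (intro mult_left_mono geometric_tail_le x) auto
      also have "\<dots> = B * (2 * K / \<rho>\<^sup>2) * a ^ g / \<rho> ^ l"
        by (simp add: x_def power2_eq_square mult_ac)
      also have "\<dots> = B * C * a ^ g / \<rho> ^ l" by (simp only: C)
      also have "\<dots> = (C * C ^ (k - Suc i)) * (a ^ path_cost n k i / \<rho> ^ l)"
        using step.hyps by (simp add: B_def g_def path_cost_step[of i k] power_add mult_ac)
      finally show ?thesis using False Ck by simp
    qed
  qed
  show ?case
  proof (cases "0 \<le> l")
    case True
    then show ?thesis using key[OF step.prems(2,3), of "nat l"] by auto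
  next
    case False
    have "Q \<union> P = {i<..k}" "Q \<inter> P = {}" using step.prems by auto
    from key[OF this, of "nat (- l)"] False
    have "cmod (tail_corr f n (n i) Q P (- l)) \<le> C ^ (k - i) * (a ^ path_cost n k i / \<rho> ^ nat \<bar>l\<bar>)"
      by auto
    moreover have "cmod (tail_corr f n (n i) P Q l) = cmod (tail_corr f n (n i) Q P (- l))"
      using tail_corr_swap[OF f, of n "n i" P Q "- l"] by simp
    ultimately show ?thesis using False by simp
  qed
qed

text \<open>
  The gap from base 0 to the first time is crossed at frequency 0, that is, for free: the correlation is
  invariant under a common shift of the times.
\<close>

lemma iterate_integral_le_tail_corr:
  assumes f: "inner_map f" and k: "1 \<le> k" and e: "\<And>j. j \<in> {1..k} \<Longrightarrow> \<epsilon> j \<in> {1, -1}"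
    and mono: "\<And>i j. 1 \<le> i \<Longrightarrow> i \<le> j \<Longrightarrow> j \<le> k \<Longrightarrow> n i \<le> n j"
  obtains P Q l where "P \<union> Q = {1<..k}" "P \<inter> Q = {}" "l \<in> {1, - 1 :: int}"
    "iterate_integral f k \<epsilon> n \<le> cmod (tail_corr f n (n 1) P Q l)"
proof -
  let ?P = "{j\<in>{1..k}. \<epsilon> j = 1}" and ?Q = "{j\<in>{1..k}. \<epsilon> j \<noteq> 1}"
  have part: "?P \<union> ?Q = {0<..k}" "?P \<inter> ?Q = {}" by auto
  obtain P Q d where d: "d \<in> {1, - 1 :: int}" "P \<union> Q = {Suc 0<..k}" "P \<inter> Q = {}"
    and eq: "\<And>l. tail_corr f n 0 ?P ?Q (int l) =
       (\<Sum>j\<le>l. h2_inner (\<lambda>z. z ^ l) (\<lambda>z. (f ^^ (n (Suc 0) - 0)) z ^ j) * tail_corr f n (n (Suc 0)) P Q (int j + d))"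
    by (rule tail_corr_step[OF f _ part, of 0 n]) (use k mono in auto)
  have "tail_corr f n 0 ?P ?Q 0 = tail_corr f n (n 1) P Q d"
    using eq[of 0] by (simp add: h2_inner_one_left)
  moreover have "iterate_integral f k \<epsilon> n \<le> cmod (tail_corr f n 0 ?P ?Q 0)"
    using iterate_integral_le_h2_inner[OF f e] by (simp add: tail_corr_def tail_prod_def[abs_def])
  ultimately show thesis using that[of P Q d] d by simp
qed

lemma deriv_funpow_zero:
  assumes "inner_map f" "deriv f 0 = 0"
  shows "deriv (f ^^ Suc g) 0 = 0"
proof -
  have diff: "h field_differentiable at 0" if "inner_map h" for h
    using inner_mapD(1)[OF that] by (rule holomorphic_on_imp_differentiable_at) auto
  have "deriv ((f ^^ g) \<circ> f) 0 = deriv (f ^^ g) (f 0) * deriv f 0"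
    using assms(1) inner_mapD(3)[OF assms(1)]
    by (intro deriv_chain diff) (auto intro: diff inner_map_funpow)
  then show ?thesis by (simp only: funpow_Suc_right assms(2) mult_zero_right)
qed

text \<open>
  If \<open>f\<close> has no linear term, frequency 1 does not survive a gap.
\<close>

lemma tail_corr_one_eq_zero:
  assumes f: "inner_map f" "deriv f 0 = 0" and i: "1 \<le> i" "i \<le> k" and PQ: "P \<union> Q = {i<..k}" "P \<inter> Q = {}"
    and mono: "\<And>i j. 1 \<le> i \<Longrightarrow> i < j \<Longrightarrow> j \<le> k \<Longrightarrow> n i < n j"
  shows "tail_corr f n (n i) P Q 1 = 0"
proof (cases "i = k")
  case True
  then show ?thesis
    using PQ by (auto simp: tail_corr_def tail_prod_def h2_inner_one_right)
next
  case False
  then have i': "i < k" using i by simp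
  have le: "n (Suc i) \<le> n j" if "Suc i \<le> j" "j \<le> k" for j
    using mono[of "Suc i" j] that by (cases "Suc i = j") auto
  define g where "g = n (Suc i) - n i"
  obtain P' Q' d where
    eq: "\<And>l. tail_corr f n (n i) P Q (int l) =
       (\<Sum>j\<le>l. h2_inner (\<lambda>z. z ^ l) (\<lambda>z. (f ^^ g) z ^ j) * tail_corr f n (n (Suc i)) P' Q' (int j + d))"
    unfolding g_def
    by (rule tail_corr_step[OF f(1) i' PQ, where m = "n i" and n = n]) (use mono[of i "Suc i"] i i' le in auto)
  obtain g' where "g = Suc g'"
    using mono[of i "Suc i"] i i' by (cases g) (auto simp: g_def)
  then have "deriv (f ^^ g) 0 = 0" using deriv_funpow_zero[OF f] by simp
  then have "taylor_coeff (f ^^ g) 1 = 0" by (simp add: taylor_coeff_def)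
  then show ?thesis
    using eq[of 1] h2_inner_power_left[of 1 "f ^^ g"] by (simp add: h2_inner_one_right)
qed

section \<open>Coefficients from the cheapest path\<close>

text \<open>
  The coefficients of the cheapest path, followed forwards: after a free gap the next one must be paid in
  full, and otherwise a gap is free if jumping over it is cheaper. The value at 0 makes the first
  coefficient 1.
\<close>

primrec gap_coeff :: "(nat \<Rightarrow> nat) \<Rightarrow> nat \<Rightarrow> nat \<Rightarrow> real" where
  "gap_coeff n k 0 = 0"
| "gap_coeff n k (Suc j) =
     (if gap_coeff n k j = 0 then 1
      else if path_cost n k (Suc (Suc j)) < path_cost n k (Suc j) then 0
      else 1 / 2)"

lemma gap_coeff_range: "gap_coeff n k j \<in> {0, 1 / 2, 1}"
  by (cases j) auto

lemma coeff_conditions_gap_coeff: "coeff_conditions k (gap_coeff n k)"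
  unfolding coeff_conditions_def
proof (intro conjI ballI impI)
  show "gap_coeff n k j \<in> {0, 1 / 2, 1}" for j by (rule gap_coeff_range)
  show "gap_coeff n k 1 = 1" by simp
  show "gap_coeff n k (k - 1) \<ge> 1 / 2" if k: "2 \<le> k"
  proof -
    obtain j where j: "k = Suc (Suc j)" using k by (metis add_2_eq_Suc le_Suc_ex)
    have "path_cost n k (Suc (Suc j)) = path_cost n k (Suc j)"
      using path_cost_last[of "Suc j" k n] j by simp
    then show ?thesis by (simp add: j)
  qed
  fix j assume "j \<in> {2..k - 1}"
  then show "(gap_coeff n k j = 1) = (gap_coeff n k (j - 1) = 0)"
    by (cases j) auto
qed

text \<open>
  The path followed by the coefficients realizes the minimum in the recursion for the cost at every step, and
  the coefficient 1/2 only undercuts the full price of a paid gap.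
\<close>

lemma sum_gap_coeff_le_path_cost:
  assumes "1 \<le> j" "j < k" "gap_coeff n k j \<noteq> 0"
    and mono: "\<And>i. 1 \<le> i \<Longrightarrow> i < k \<Longrightarrow> n i \<le> n (Suc i)"
  shows "(\<Sum>i=j..k - 1. gap_coeff n k i * (real (n (i + 1)) - real (n i))) \<le> real (path_cost n k j)"
  using assms(1-3)
proof (induction "k - j" arbitrary: j rule: less_induct)
  case less
  define G where "G = (\<lambda>i. real (n (i + 1)) - real (n i))"
  have G: "0 \<le> G i" "G i = real (n (Suc i) - n i)" if "1 \<le> i" "i < k" for i
    using mono[OF that] by (auto simp: G_def of_nat_diff)
  have first: "gap_coeff n k j * G j \<le> G j"
    using gap_coeff_range[of n k j] G(1)[of j] less.prems by (intro mult_left_le_one_le) auto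
  have split: "(\<Sum>i=j..k - 1. gap_coeff n k i * G i) =
      gap_coeff n k j * G j + (\<Sum>i=Suc j..k - 1. gap_coeff n k i * G i)"
    using less.prems by (intro sum.atLeast_Suc_atMost) simp
  have rest: "(\<Sum>i=Suc j..k - 1. gap_coeff n k i * G i) \<le>
      real (min (path_cost n k (Suc j)) (path_cost n k (Suc (Suc j))))"
  proof (cases "Suc j = k")
    case True
    then show ?thesis by simp
  next
    case False
    then have j: "Suc j < k" using less.prems by simp
    show ?thesis
    proof (cases "gap_coeff n k (Suc j) = 0")
      case True
      then have lt: "path_cost n k (Suc (Suc j)) < path_cost n k (Suc j)"
        by (auto split: if_splits)
      then have j2: "Suc (Suc j) < k"
        using j path_cost_last[of "Suc j" k n] by (cases "Suc (Suc j) = k") auto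
      have "(\<Sum>i=Suc j..k - 1. gap_coeff n k i * G i) = (\<Sum>i=Suc (Suc j)..k - 1. gap_coeff n k i * G i)"
        using j True by (subst sum.atLeast_Suc_atMost) auto
      also have "\<dots> \<le> real (path_cost n k (Suc (Suc j)))"
        unfolding G_def using less.hyps[of "Suc (Suc j)"] j2 True by simp
      finally show ?thesis using lt by simp
    next
      case False
      then have "path_cost n k (Suc j) \<le> path_cost n k (Suc (Suc j))"
        using less.prems(3) by (auto split: if_splits)
      moreover have "(\<Sum>i=Suc j..k - 1. gap_coeff n k i * G i) \<le> real (path_cost n k (Suc j))"
        unfolding G_def by (rule less.hyps) (use j False in auto)
      ultimately show ?thesis by simp
    qed
  qed
  have "(\<Sum>i=j..k - 1. gap_coeff n k i * G i) \<le> G j + real (min (path_cost n k (Suc j)) (path_cost n k (Suc (Suc j))))"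
    unfolding split using first rest by (rule add_mono)
  also have "\<dots> = real (path_cost n k j)"
    using less.prems by (subst path_cost_step) (auto simp: G)
  finally show ?case by (simp add: G_def)
qed

lemma path_cost_cong:
  assumes "\<And>i. j \<le> i \<Longrightarrow> i \<le> k \<Longrightarrow> n i = n' i" "j < k" "j \<le> i"
  shows "path_cost n k i = path_cost n' k i"
  using assms(3)
proof (induction "Suc k - i" arbitrary: i rule: less_induct)
  case less
  consider "k < i" | "i = k" | "i < k" by linarith
  then show ?case
  proof cases
    case 2
    have "n k = n' k" "n (k - 1) = n' (k - 1)" using assms(1)[of k] assms(1)[of "k - 1"] assms(2) by auto
    then show ?thesis using 2 by (simp add: path_cost.simps[of _ k k])
  next
    case 3
    have "n (Suc i) = n' (Suc i)" "n i = n' i" using assms(1)[of "Suc i"] assms(1)[of i] less.prems 3 by auto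
    moreover have "path_cost n k (Suc i) = path_cost n' k (Suc i)"
      "path_cost n k (Suc (Suc i)) = path_cost n' k (Suc (Suc i))"
      using less.hyps[of "Suc i"] less.hyps[of "Suc (Suc i)"] less.prems 3 by auto
    ultimately show ?thesis using 3 by (simp add: path_cost_step)
  qed (simp add: path_cost_beyond)
qed

section \<open>The correlation estimate\<close>

theorem theorem13:
  fixes f :: "complex \<Rightarrow> complex" and a :: real
  assumes "inner_function f"
    and "f 0 = 0"
    and "a = cmod (deriv f 0)"
    and "a < 1"
  shows "\<exists>C>0. \<exists>q0>0. \<exists>\<delta> :: nat \<Rightarrow> (nat \<Rightarrow> int) \<Rightarrow> (nat \<Rightarrow> nat) \<Rightarrow> nat \<Rightarrow> real.
    (\<forall>(k::nat) (q::nat) \<epsilon> n. real q \<ge> q0 \<longrightarrow> admissible k q \<epsilon> n \<longrightarrow>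
       iterate_integral f k \<epsilon> n \<le> C ^ k * fact k * rpow a (Phi k (\<delta> k \<epsilon> n) n) \<and>
       coeff_conditions k (\<delta> k \<epsilon> n)) \<and>
    (\<forall>(k::nat) (q::nat) (q'::nat) \<epsilon> \<epsilon>' n n'.
       real q \<ge> q0 \<longrightarrow> admissible k q \<epsilon> n \<longrightarrow>
       real q' \<ge> q0 \<longrightarrow> admissible k q' \<epsilon>' n' \<longrightarrow>
       (\<forall>j\<in>{2..k-1}.
          \<delta> k \<epsilon> n (j - 1) > 0 \<and> \<delta> k \<epsilon>' n' (j - 1) > 0 \<and>
          (\<forall>i\<in>{j+1..k}. \<epsilon> i = \<epsilon>' i) \<and> (\<forall>i\<in>{j..k}. n i = n' i) \<longrightarrow>
          \<delta> k \<epsilon> n j = \<delta> k \<epsilon>' n' j))"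
proof -
  have f: "inner_map f" by (rule inner_function_imp_inner_map[OF assms(1,2)])
  define \<delta> :: "nat \<Rightarrow> (nat \<Rightarrow> int) \<Rightarrow> (nat \<Rightarrow> nat) \<Rightarrow> nat \<Rightarrow> real"
    where "\<delta> = (\<lambda>k \<epsilon> n. gap_coeff n k)"
  have locality: "\<delta> k \<epsilon> n j = \<delta> k \<epsilon>' n' j"
    if j: "j \<in> {2..k-1}" and pos: "\<delta> k \<epsilon> n (j - 1) > 0" "\<delta> k \<epsilon>' n' (j - 1) > 0"
      and eq: "\<forall>i\<in>{j..k}. n i = n' i"
    for k \<epsilon> \<epsilon>' n n' j
  proof -
    obtain j' where j': "j = Suc j'" using j by (cases j) auto
    have "path_cost n k i = path_cost n' k i" if "j \<le> i" for i
      by (rule path_cost_cong[of j]) (use that j eq in auto)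
    then show ?thesis using pos by (simp add: \<delta>_def j')
  qed
  have adm: "1 \<le> k" "\<And>j. j \<in> {1..k} \<Longrightarrow> \<epsilon> j \<in> {1, - 1}"
      "\<And>i j. 1 \<le> i \<Longrightarrow> i < j \<Longrightarrow> j \<le> k \<Longrightarrow> n i < n j"
      "\<And>i j. 1 \<le> i \<Longrightarrow> i \<le> j \<Longrightarrow> j \<le> k \<Longrightarrow> n i \<le> n j"
      "\<And>j. 1 \<le> j \<Longrightarrow> j < k \<Longrightarrow> q < n (Suc j) - n j"
    if "admissible k q \<epsilon> n" for k q \<epsilon> n
  proof -
    show "1 \<le> k" "\<And>j. j \<in> {1..k} \<Longrightarrow> \<epsilon> j \<in> {1, - 1}" using that by (auto simp: admissible_def)
    show lt: "n i < n j" if "1 \<le> i" "i < j" "j \<le> k" for i j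
      using \<open>admissible k q \<epsilon> n\<close> that by (auto simp: admissible_def strict_mono_on_def)
    show "n i \<le> n j" if "1 \<le> i" "i \<le> j" "j \<le> k" for i j
      using lt[of i j] that by (cases "i = j") auto
    show "q < n (Suc j) - n j" if "1 \<le> j" "j < k" for j
    proof -
      have "j \<in> {1..k - 1}" using that by auto
      then have "int (n (j + 1)) - int (n j) > int q"
        using \<open>admissible k q \<epsilon> n\<close> unfolding admissible_def by blast
      then show ?thesis by simp
    qed
  qed
  have "\<exists>C>0. \<exists>q0>0. \<forall>(k::nat) (q::nat) \<epsilon> n. real q \<ge> q0 \<longrightarrow> admissible k q \<epsilon> n \<longrightarrow>
      iterate_integral f k \<epsilon> n \<le> C ^ k * fact k * rpow a (Phi k (\<delta> k \<epsilon> n) n)"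
  proof (cases "a = 0")
    case True
    then have df: "deriv f 0 = 0" using assms(3) by simp
    have "iterate_integral f k \<epsilon> n \<le> 1 ^ k * fact k * rpow a (Phi k (\<delta> k \<epsilon> n) n)"
      if ad: "admissible k q \<epsilon> n" for k q \<epsilon> n
    proof -
      obtain P Q l where PQ: "P \<union> Q = {1<..k}" "P \<inter> Q = {}" and l: "l \<in> {1, - 1 :: int}"
        and le: "iterate_integral f k \<epsilon> n \<le> cmod (tail_corr f n (n 1) P Q l)"
        by (rule iterate_integral_le_tail_corr[OF f adm(1,2,4)[OF ad]]) auto
      have QP: "Q \<union> P = {1<..k}" "Q \<inter> P = {}" using PQ by auto
      have "tail_corr f n (n 1) P Q 1 = 0" "tail_corr f n (n 1) Q P 1 = 0"
        using tail_corr_one_eq_zero[OF f df order_refl adm(1)[OF ad] _ _ adm(3)[OF ad]] PQ QP by auto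
      then have "tail_corr f n (n 1) P Q l = 0"
        using l tail_corr_swap[OF f, of n "n 1" P Q 1] by auto
      moreover have "0 \<le> 1 ^ k * fact k * rpow a (Phi k (\<delta> k \<epsilon> n) n)" by (simp add: rpow_def)
      ultimately show ?thesis using le by simp
    qed
    then show ?thesis by (intro exI[of _ "1 :: real"] conjI allI impI zero_less_one) blast+
  next
    case False
    then have a: "0 < a" using assms(3) by simp
    obtain \<rho> K where \<rho>: "0 < \<rho>" "\<rho> < 1" and K: "1 \<le> K"
      and small: "\<And>m z. cmod z \<le> \<rho> \<Longrightarrow> cmod ((f ^^ m) z) \<le> K * a ^ m"
      using koenigs_bound[OF inner_mapD(1-3)[OF f] assms(3) a assms(4)] by blast
    \<comment> \<open>Gaps longer than \<open>N\<close> satisfy the smallness condition of the recursion.\<close>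
    obtain N where N: "a ^ N < \<rho> / (2 * K)"
      using real_arch_pow_inv[of "\<rho> / (2 * K)" a] \<rho> K assms(4) by auto
    define C where "C = 2 * K / \<rho>\<^sup>2"
    note C = step_constant_bounds(1,3)[OF \<rho> K C_def]
    have "iterate_integral f k \<epsilon> n \<le> C ^ k * fact k * rpow a (Phi k (\<delta> k \<epsilon> n) n)"
      if q: "real q \<ge> real (Suc N)" and ad: "admissible k q \<epsilon> n" for k q \<epsilon> n
    proof -
      note ad' = adm[OF ad]
      have gap: "K * a ^ (n (Suc j) - n j) / \<rho> \<le> 1 / 2" if j: "1 \<le> j" "j < k" for j
      proof -
        have "a ^ (n (Suc j) - n j) \<le> a ^ N"
          using ad'(5)[OF j] q a assms(4) by (intro power_decreasing) auto
        then have "K * a ^ (n (Suc j) - n j) \<le> K * (\<rho> / (2 * K))"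
          using N K by (intro mult_left_mono) auto
        then show ?thesis using K \<rho> by (simp add: field_simps)
      qed
      obtain P Q l where PQ: "P \<union> Q = {1<..k}" "P \<inter> Q = {}" and l: "l \<in> {1, - 1 :: int}"
        and le: "iterate_integral f k \<epsilon> n \<le> cmod (tail_corr f n (n 1) P Q l)"
        by (rule iterate_integral_le_tail_corr[OF f ad'(1,2,4)]) auto
      have "cmod (tail_corr f n (n 1) P Q l) \<le> C ^ (k - 1) * (a ^ path_cost n k 1 / \<rho>)"
        using tail_corr_bound[where i = 1 and n = n and l = l, OF f a assms(4) \<rho> K small ad'(4) gap C_def
            order_refl ad'(1) PQ] l
        by auto
      also have "\<dots> = C ^ (k - 1) * (1 / \<rho>) * a ^ path_cost n k 1" by simp
      also have "\<dots> \<le> C ^ (k - 1) * C * a ^ path_cost n k 1"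
        using C a by (intro mult_right_mono mult_left_mono) auto
      also have "C ^ (k - 1) * C = C ^ k" using ad'(1) by (simp add: power_eq_if)
      also have "C ^ k * a ^ path_cost n k 1 \<le> C ^ k * fact k * rpow a (Phi k (\<delta> k \<epsilon> n) n)"
      proof -
        have "Phi k (\<delta> k \<epsilon> n) n \<le> real (path_cost n k 1)"
        proof (cases "k = 1")
          case True
          then show ?thesis by (simp add: Phi_def)
        next
          case False
          then have "1 < k" using ad'(1) by simp
          then show ?thesis
            unfolding Phi_def \<delta>_def
            using ad'(4) by (intro sum_gap_coeff_le_path_cost) auto
        qed
        then have "a powr real (path_cost n k 1) \<le> a powr Phi k (\<delta> k \<epsilon> n) n"
          using a assms(4) by (intro powr_mono') auto
        then have "a ^ path_cost n k 1 \<le> rpow a (Phi k (\<delta> k \<epsilon> n) n)"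
          using a by (auto simp: rpow_def powr_realpow split: if_splits)
        then have "C ^ k * a ^ path_cost n k 1 \<le> (C ^ k * fact k) * rpow a (Phi k (\<delta> k \<epsilon> n) n)"
          using C a fact_ge_1[of k, where 'a = real] by (intro mult_mono) auto
        then show ?thesis .
      qed
      finally show ?thesis using le by linarith
    qed
    with C(2) show ?thesis by (intro exI[of _ C] conjI exI[of _ "real (Suc N)"]) auto
  qed
  then obtain C q0 where "C > 0" "q0 > 0" and bound: "\<forall>(k::nat) (q::nat) \<epsilon> n. real q \<ge> q0 \<longrightarrow> admissible k q \<epsilon> n \<longrightarrow>
      iterate_integral f k \<epsilon> n \<le> C ^ k * fact k * rpow a (Phi k (\<delta> k \<epsilon> n) n)" by blast
  moreover have "coeff_conditions k (\<delta> k \<epsilon> n)" for k \<epsilon> n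
    unfolding \<delta>_def by (rule coeff_conditions_gap_coeff)
  ultimately show ?thesis
    using locality by (intro exI[of _ C] exI[of _ q0] exI[of _ \<delta>] conjI) (assumption | blast)+
qed

end
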